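(* There is an algorithm (the paper's algorithm $[1,2]$-MINSET) which, given a generalized series-parallel graph $G=(V,E)$, computes a minimum $[1,2]$-set of $G$ (that is, a $\gamma_{[1,2]}$-set of $G$) in time $O(\vert V\vert)$.
   Context: All graphs are finite and simple. For a graph $G=(V,E)$ and $v\in V$, $N(v)=\{u : uv\in E\}$. A set $S\subseteq V$ is a $[1,2]$-set of $G$ if every vertex $v\in V\setminus S$ satisfies $1\le \vert N(v)\cap S\vert\le 2$. The $[1,2]$-domination number $\gamma_{[1,2]}(G)$ is the minimum cardinality of a $[1,2]$-set of $G$, and a $[1,2]$-set of this cardinality is called a $\gamma_{[1,2]}$-set. A generalized series-parallel (GSP) graph is a graph $G=(V,E,s,t)$ with two distinguished terminal vertices, defined recursively: (1) a single edge with its two endpoints as terminals is a GSP graph; (2) series operation: for GSP graphs $G_1=(V_1,E_1,s_1,t_1)$ and $G_2=(V_2,E_2,s_2,t_2)$ (on disjoint vertex sets), $G_1 o_s G_2$ is obtained from their disjoint union by identifying $t_1$ with $s_2$, with terminals $s_1,t_2$; (3) parallel operation: $G_1 o_p G_2$ is obtained by identifying $s_1$ with $s_2$ and $t_1$ with $t_2$, with terminals $s_1,t_1$; (4) generalized series operation: $G_1 o_g G_2$ is obtained by identifying $t_1$ with $s_2$, with terminals $s_1,t_1$; (5) every GSP graph is obtained by finitely many applications of (1)–(4). *)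

theory Defs
  imports Complex_Main "HOL-Library.Landau_Symbols"
begin

section \<open>[1,2]-sets\<close>

definition nbh :: "'a set set \<Rightarrow> 'a \<Rightarrow> 'a set" where
  "nbh E v = {u. {u, v} \<in> E}"

definition set12 :: "'a set \<Rightarrow> 'a set set \<Rightarrow> 'a set \<Rightarrow> bool" where
  "set12 V E S \<longleftrightarrow>
     S \<subseteq> V \<and> (\<forall>v \<in> V - S. 1 \<le> card (nbh E v \<inter> S) \<and> card (nbh E v \<inter> S) \<le> 2)"

definition gamma12 :: "'a set \<Rightarrow> 'a set set \<Rightarrow> nat" where
  "gamma12 V E = Min (card ` {S. set12 V E S})"

definition gamma12_set :: "'a set \<Rightarrow> 'a set set \<Rightarrow> 'a set \<Rightarrow> bool" where
  "gamma12_set V E S \<longleftrightarrow> set12 V E S \<and> card S = gamma12 V E"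


section \<open>Generalized series-parallel graphs\<close>

text \<open>
  Gluing is expressed on representatives that already share exactly the vertices to be
  identified; up to isomorphism this is the disjoint union followed by the identification.
  As graphs are simple, an edge between the two terminals that is present in both arguments
  of a parallel operation occurs once in the result.
\<close>

inductive gsp :: "'a set \<Rightarrow> 'a set set \<Rightarrow> 'a \<Rightarrow> 'a \<Rightarrow> bool" where
  edge: "s \<noteq> t \<Longrightarrow> gsp {s, t} {{s, t}} s t"
| series: "\<lbrakk>gsp V1 E1 s x; gsp V2 E2 x t; V1 \<inter> V2 = {x}\<rbrakk>
    \<Longrightarrow> gsp (V1 \<union> V2) (E1 \<union> E2) s t"
| parallel: "\<lbrakk>gsp V1 E1 s t; gsp V2 E2 s t; V1 \<inter> V2 = {s, t}\<rbrakk>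
    \<Longrightarrow> gsp (V1 \<union> V2) (E1 \<union> E2) s t"
| gen_series: "\<lbrakk>gsp V1 E1 s t; gsp V2 E2 t t'; V1 \<inter> V2 = {t}\<rbrakk>
    \<Longrightarrow> gsp (V1 \<union> V2) (E1 \<union> E2) s t"

lemma gsp_simple_graph:
  assumes "gsp V E s t"
  shows "finite V \<and> s \<in> V \<and> t \<in> V \<and> s \<noteq> t \<and>
         (\<forall>e \<in> E. \<exists>u v. e = {u, v} \<and> u \<in> V \<and> v \<in> V \<and> u \<noteq> v)"
  using assms
proof induction
  case (series V1 E1 s x V2 E2 t)
  then have "s \<noteq> t" by blast
  with series show ?case by (simp add: ball_Un) metis
next
  case (parallel V1 E1 s t V2 E2)
  then show ?case by (simp add: ball_Un) metis
next
  case (gen_series V1 E1 s t V2 E2 t')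
  then show ?case by (simp add: ball_Un) metis
qed auto


section \<open>The machine model\<close>

text \<open>
  Algorithms are programs of a word RAM in structured form. The memory consists of scalar
  variables and of arrays, both named by numbers; a program mentions only finitely many of
  them, and array names are fixed in the program text, whereas array indices are computed.
  A step of evaluating an expression has unit cost. In return all numbers handled, including
  array indices and intermediate results, have to be smaller than a word bound W:
  a computation that exceeds W has no execution.
\<close>

datatype binop = Plus | Minus | Times | Div | Mod | Less | Equal

datatype exp =
    Const nat
  | Var nat
  | Read nat exp
  | Bin binop exp exp

datatype cmd =
    Skip
  | Assign nat exp
  | Write nat exp exp
  | Seq cmd cmd
  | Cond exp cmd cmd
  | While exp cmd

record state =
  scalar :: "nat \<Rightarrow> nat"
  cell :: "nat \<Rightarrow> nat \<Rightarrow> nat"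

text \<open>Subtraction is truncated; comparisons yield 0 or 1, and any nonzero number counts as true.\<close>

fun apply_binop :: "binop \<Rightarrow> nat \<Rightarrow> nat \<Rightarrow> nat" where
  "apply_binop Plus x y = x + y"
| "apply_binop Minus x y = x - y"
| "apply_binop Times x y = x * y"
| "apply_binop Div x y = x div y"
| "apply_binop Mod x y = x mod y"
| "apply_binop Less x y = (if x < y then 1 else 0)"
| "apply_binop Equal x y = (if x = y then 1 else 0)"

fun eval :: "state \<Rightarrow> exp \<Rightarrow> nat" where
  "eval \<sigma> (Const k) = k"
| "eval \<sigma> (Var x) = scalar \<sigma> x"
| "eval \<sigma> (Read a e) = cell \<sigma> a (eval \<sigma> e)"
| "eval \<sigma> (Bin f e1 e2) = apply_binop f (eval \<sigma> e1) (eval \<sigma> e2)"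

fun fits :: "nat \<Rightarrow> state \<Rightarrow> exp \<Rightarrow> bool" where
  "fits W \<sigma> (Const k) \<longleftrightarrow> k < W"
| "fits W \<sigma> (Var x) \<longleftrightarrow> scalar \<sigma> x < W"
| "fits W \<sigma> (Read a e) \<longleftrightarrow> fits W \<sigma> e \<and> eval \<sigma> (Read a e) < W"
| "fits W \<sigma> (Bin f e1 e2) \<longleftrightarrow> fits W \<sigma> e1 \<and> fits W \<sigma> e2 \<and> eval \<sigma> (Bin f e1 e2) < W"

fun cost :: "exp \<Rightarrow> nat" where
  "cost (Const k) = 1"
| "cost (Var x) = 1"
| "cost (Read a e) = cost e + 1"
| "cost (Bin f e1 e2) = cost e1 + cost e2 + 1"

text \<open>exec W c \<sigma> \<tau> \<sigma>': with word bound W, program c started in \<sigma> halts in \<sigma>' after \<tau> steps.\<close>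

inductive exec :: "nat \<Rightarrow> cmd \<Rightarrow> state \<Rightarrow> nat \<Rightarrow> state \<Rightarrow> bool" for W where
  Skip: "exec W Skip \<sigma> 1 \<sigma>"
| Assign: "fits W \<sigma> e \<Longrightarrow>
    exec W (Assign x e) \<sigma> (cost e + 1) (\<sigma>\<lparr>scalar := (scalar \<sigma>)(x := eval \<sigma> e)\<rparr>)"
| Write: "\<lbrakk>fits W \<sigma> i; fits W \<sigma> e\<rbrakk> \<Longrightarrow>
    exec W (Write a i e) \<sigma> (cost i + cost e + 1)
      (\<sigma>\<lparr>cell := (cell \<sigma>)(a := (cell \<sigma> a)(eval \<sigma> i := eval \<sigma> e))\<rparr>)"
| Seq: "\<lbrakk>exec W c1 \<sigma> \<tau>1 \<sigma>1; exec W c2 \<sigma>1 \<tau>2 \<sigma>2\<rbrakk> \<Longrightarrow>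
    exec W (Seq c1 c2) \<sigma> (\<tau>1 + \<tau>2) \<sigma>2"
| CondTrue: "\<lbrakk>fits W \<sigma> b; eval \<sigma> b \<noteq> 0; exec W c1 \<sigma> \<tau> \<sigma>'\<rbrakk> \<Longrightarrow>
    exec W (Cond b c1 c2) \<sigma> (cost b + 1 + \<tau>) \<sigma>'"
| CondFalse: "\<lbrakk>fits W \<sigma> b; eval \<sigma> b = 0; exec W c2 \<sigma> \<tau> \<sigma>'\<rbrakk> \<Longrightarrow>
    exec W (Cond b c1 c2) \<sigma> (cost b + 1 + \<tau>) \<sigma>'"
| WhileFalse: "\<lbrakk>fits W \<sigma> b; eval \<sigma> b = 0\<rbrakk> \<Longrightarrow>
    exec W (While b c) \<sigma> (cost b + 1) \<sigma>"
| WhileTrue: "\<lbrakk>fits W \<sigma> b; eval \<sigma> b \<noteq> 0; exec W c \<sigma> \<tau>1 \<sigma>1; exec W (While b c) \<sigma>1 \<tau>2 \<sigma>2\<rbrakk> \<Longrightarrow>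
    exec W (While b c) \<sigma> (cost b + 1 + \<tau>1 + \<tau>2) \<sigma>2"

inductive_cases exec_elims:
  "exec W Skip \<sigma> \<tau> \<sigma>'"
  "exec W (Assign x e) \<sigma> \<tau> \<sigma>'"
  "exec W (Write a i e) \<sigma> \<tau> \<sigma>'"
  "exec W (Seq c1 c2) \<sigma> \<tau> \<sigma>'"
  "exec W (Cond b c1 c2) \<sigma> \<tau> \<sigma>'"
  "exec W (While b c) \<sigma> \<tau> \<sigma>'"

text \<open>
  Programs are deterministic, so the existence of a halting execution with a certain result
  says that this is the result of running the program.
\<close>

lemma exec_deterministic:
  "exec W c \<sigma> \<tau> \<sigma>' \<Longrightarrow> exec W c \<sigma> \<upsilon> \<sigma>'' \<Longrightarrow> \<upsilon> = \<tau> \<and> \<sigma>'' = \<sigma>'"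
proof (induction arbitrary: \<upsilon> \<sigma>'' rule: exec.induct)
  case (Seq c1 \<sigma> \<tau>1 \<sigma>1 c2 \<tau>2 \<sigma>2)
  from Seq.prems obtain \<upsilon>1 \<rho> \<upsilon>2
    where 1: "exec W c1 \<sigma> \<upsilon>1 \<rho>" and 2: "exec W c2 \<rho> \<upsilon>2 \<sigma>''" and "\<upsilon> = \<upsilon>1 + \<upsilon>2"
    by (rule exec_elims(4))
  moreover from Seq.IH(1)[OF 1] have "\<upsilon>1 = \<tau>1" "\<rho> = \<sigma>1" by simp_all
  ultimately show ?case using Seq.IH(2)[of \<upsilon>2 \<sigma>''] by simp
next
  case (CondTrue \<sigma> b c1 \<tau> \<sigma>' c2)
  from CondTrue.prems CondTrue.hyps(2) obtain \<upsilon>1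
    where "exec W c1 \<sigma> \<upsilon>1 \<sigma>''" and "\<upsilon> = cost b + 1 + \<upsilon>1"
    by (elim exec_elims(5)) simp_all
  then show ?case using CondTrue.IH[of \<upsilon>1 \<sigma>''] by simp
next
  case (CondFalse \<sigma> b c2 \<tau> \<sigma>' c1)
  from CondFalse.prems CondFalse.hyps(2) obtain \<upsilon>1
    where "exec W c2 \<sigma> \<upsilon>1 \<sigma>''" and "\<upsilon> = cost b + 1 + \<upsilon>1"
    by (elim exec_elims(5)) simp_all
  then show ?case using CondFalse.IH[of \<upsilon>1 \<sigma>''] by simp
next
  case (WhileFalse \<sigma> b c)
  from WhileFalse.prems show ?case
    by (rule exec_elims(6)) (use WhileFalse.hyps(2) in simp_all)
next
  case (WhileTrue \<sigma> b c \<tau>1 \<sigma>1 \<tau>2 \<sigma>2)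
  from WhileTrue.prems obtain \<upsilon>1 \<rho> \<upsilon>2
    where 1: "exec W c \<sigma> \<upsilon>1 \<rho>" and 2: "exec W (While b c) \<rho> \<upsilon>2 \<sigma>''"
      and "\<upsilon> = cost b + 1 + \<upsilon>1 + \<upsilon>2"
    by (rule exec_elims(6)) (use WhileTrue.hyps(2) in simp_all)
  moreover from WhileTrue.IH(1)[OF 1] have "\<upsilon>1 = \<tau>1" "\<rho> = \<sigma>1" by simp_all
  ultimately show ?case using WhileTrue.IH(2)[of \<upsilon>2 \<sigma>''] by simp
qed (auto elim: exec_elims(1-3))


section \<open>Graphs as input, vertex sets as output\<close>

text \<open>Every edge is listed exactly once, in arbitrary order and orientation.\<close>

definition edge_list :: "(nat \<times> nat) list \<Rightarrow> nat set set \<Rightarrow> bool" where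
  "edge_list es E \<longleftrightarrow>
     distinct (map (\<lambda>(u, v). {u, v}) es) \<and> set (map (\<lambda>(u, v). {u, v}) es) = E"

text \<open>
  The input is a graph with vertices 0, ..., n-1: variables 0 and 1 hold the numbers of
  vertices and of edges, arrays 0 and 1 the first and second endpoints of the edges.
  The rest of the memory is 0. The output is read off array 2 as a characteristic function.
\<close>

definition graph_input :: "nat \<Rightarrow> (nat \<times> nat) list \<Rightarrow> state" where
  "graph_input n es =
     \<lparr>scalar = (\<lambda>x. if x = 0 then n else if x = 1 then length es else 0),
      cell = (\<lambda>a i. if i < length es
                     then (if a = 0 then fst (es ! i) else if a = 1 then snd (es ! i) else 0)
                     else 0)\<rparr>"

definition set_output :: "nat \<Rightarrow> state \<Rightarrow> nat set" where
  "set_output n \<sigma> = {v \<in> {..<n}. cell \<sigma> 2 v \<noteq> 0}"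

text \<open>
  Words have O(log n) bits, that is, the word bound is polynomial in n; adding 2 to n only
  avoids the degenerate bases 0 and 1.
\<close>

definition computes_gamma12_set :: "cmd \<Rightarrow> nat \<Rightarrow> (nat \<Rightarrow> nat) \<Rightarrow> bool" where
  "computes_gamma12_set c k T \<longleftrightarrow>
     (\<forall>n E s t es. gsp {..<n} E s t \<longrightarrow> edge_list es E \<longrightarrow>
        (\<exists>\<tau> \<sigma>. exec ((n + 2) ^ k) c (graph_input n es) \<tau> \<sigma> \<and> \<tau> \<le> T n \<and>
               gamma12_set {..<n} E (set_output n \<sigma>)))"

end

theory Submission
  imports Defs
begin

text \<open>
  A generalized series-parallel graph can be dismantled by repeatedly deleting a vertex of degree at
  most two and joining its neighbours by an edge. The order in which two vertices are deleted does
  not influence the resulting graph, and deletions never increase degrees; hence every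
  greedy choice of vertices succeeds, and no decomposition of the input has to be known.

  Deleted vertices are grouped into pieces, each attached to a pair of remaining
  vertices. For every piece a table with 16 entries stores, for each pair of states of the two
  attachment vertices, a smallest partial solution inside the piece, where a state tells whether
  the vertex is selected and, if not, how many selected neighbours the piece provides. When v with
  neighbours a and b is deleted, the tables of the pieces at (v, a), at (v, b), at v alone and at
  (a, b) are combined in constant time into a table at (a, b).

  Tables refer to nodes of a directed acyclic graph that represents sets as unions of smaller
  ones, so that a solution is read off by a single pass over the nodes in decreasing order.
  As the memory is initially 0, an adjacency matrix decides in constant time whether an edge is present.
\<close>


section \<open>Elimination of vertices of degree at most two\<close>

text \<open>A state records the exact number of selected neighbours and not only whether there is
  one, because the requirement on an attachment vertex is settled only when that vertex is
  eliminated and all contributions are known. The counts 0, 1, 2 and the mark 3 for a selected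
  vertex give the 4 * 4 entries of a table. Contributions of several pieces to one vertex may be
  added only if no edge is counted twice, so the edge between two attachment vertices is accounted
  for in the table of that pair. Degrees 0 and 1 would need rules of their own; two isolated dummy
  vertices reduce them to degree 2. Two things threaten linear time. Sets cannot be copied, so a
  table entry is a mere node number. Eliminated vertices are not removed from neighbour lists, so a
  scan also meets dead entries; a potential that contains the list lengths of the remaining vertices
  pays for them. An elimination tries 7 * 7 * 10 = 490 combinations of states and creates at most
  that many nodes. All stored numbers stay below B = (n + 2) ^ 7 and all intermediate values below B
  ^ 8.\<close>

definition fill :: "'a \<Rightarrow> ('a \<Rightarrow> 'a \<Rightarrow> bool) \<Rightarrow> 'a \<Rightarrow> 'a \<Rightarrow> bool" where
  "fill v A x y \<longleftrightarrow> x \<noteq> v \<and> y \<noteq> v \<and> (A x y \<or> x \<noteq> y \<and> A x v \<and> A v y)"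

definition graph_on :: "'a set \<Rightarrow> ('a \<Rightarrow> 'a \<Rightarrow> bool) \<Rightarrow> bool" where
  "graph_on L A \<longleftrightarrow> finite L \<and> (\<forall>x y. A x y \<longrightarrow> x \<in> L \<and> y \<in> L \<and> x \<noteq> y \<and> A y x)"

inductive reducible :: "'a set \<Rightarrow> ('a \<Rightarrow> 'a \<Rightarrow> bool) \<Rightarrow> bool" where
  empty: "reducible {} A"
| step: "\<lbrakk>v \<in> L; card (Collect (A v)) \<le> 2; reducible (L - {v}) (fill v A)\<rbrakk> \<Longrightarrow> reducible L A"

inductive reduces :: "'a set \<Rightarrow> ('a \<Rightarrow> 'a \<Rightarrow> bool) \<Rightarrow> 'a set \<Rightarrow> ('a \<Rightarrow> 'a \<Rightarrow> bool) \<Rightarrow> bool" where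
  stop: "reduces L A L A"
| step: "\<lbrakk>v \<in> L; card (Collect (A v)) \<le> 2; reduces (L - {v}) (fill v A) L' A'\<rbrakk> \<Longrightarrow> reduces L A L' A'"

lemma graph_on_finite_nbrs: "graph_on L A \<Longrightarrow> finite (Collect (A v))"
  by (rule finite_subset[of _ L]) (auto simp: graph_on_def)

lemma graph_on_fill: "graph_on L A \<Longrightarrow> graph_on (L - {v}) (fill v A)"
  by (auto simp: graph_on_def fill_def)

lemma fill_commute: "graph_on L A \<Longrightarrow> fill u (fill v A) = fill v (fill u A)"
  by (intro ext) (auto simp: graph_on_def fill_def)

text \<open>Losing the neighbour \<open>u\<close> makes up for the new neighbours: besides
  \<open>v\<close>, the vertex \<open>u\<close> has at most one neighbour to pass on.\<close>

lemma fill_degree_le: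
  assumes "graph_on L A" "card (Collect (A u)) \<le> 2"
  shows "card (Collect (fill u A v)) \<le> card (Collect (A v))"
proof (cases "A v u")
  case True
  let ?N = "Collect (A v) - {u}" and ?M = "Collect (A u) - {v}"
  have fin: "finite (Collect (A x))" for x using graph_on_finite_nbrs[OF assms(1)] .
  have "A u v" using True assms(1) by (auto simp: graph_on_def)
  then have "card ?M \<le> 1" using assms(2) fin[of u] by (simp add: card_Diff_singleton)
  moreover have "Suc (card ?N) = card (Collect (A v))"
    using True fin[of v] by (metis card.remove mem_Collect_eq)
  moreover have "card (Collect (fill u A v)) \<le> card (?N \<union> ?M)"
    by (rule card_mono) (use fin in \<open>auto simp: fill_def\<close>)
  moreover have "card (?N \<union> ?M) \<le> card ?N + card ?M" by (rule card_Un_le)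
  ultimately show ?thesis by linarith
next
  case False
  then show ?thesis
    by (intro card_mono graph_on_finite_nbrs[OF assms(1)]) (auto simp: fill_def)
qed

text \<open>Exchange argument. If a successful order starts with \<open>u\<close>, then
  \<open>v\<close> keeps degree at most two after \<open>u\<close> is deleted, and conversely; as
  the two deletions commute, \<open>v\<close> can be moved to the front. This licenses the greedy
  choice.\<close>

lemma reducible_fill:
  assumes "reducible L A" "graph_on L A" "v \<in> L" "card (Collect (A v)) \<le> 2"
  shows "reducible (L - {v}) (fill v A)"
  using assms
proof (induction)
  case (step u L A)
  show ?case
  proof (cases "u = v")
    case False
    have "card (Collect (fill u A v)) \<le> 2"
      using fill_degree_le[OF step.prems(1) step.hyps(2), of v] step.prems(3) by simp
    then have "reducible (L - {u} - {v}) (fill v (fill u A))"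
      using step.prems False by (intro step.IH graph_on_fill) simp_all
    moreover have "L - {u} - {v} = L - {v} - {u}" by blast
    ultimately have "reducible (L - {v} - {u}) (fill u (fill v A))"
      using fill_commute[OF step.prems(1), of u v] by simp
    moreover have "card (Collect (fill v A u)) \<le> 2"
      using fill_degree_le[OF step.prems(1) step.prems(3), of u] step.hyps(2) by simp
    ultimately show ?thesis
      using step.hyps(1) False reducible.step[of u "L - {v}" "fill v A"] by simp
  qed (use step in auto)
qed auto

lemma reducible_low_degree:
  assumes "reducible L A" "L \<noteq> {}"
  obtains v where "v \<in> L" "card (Collect (A v)) \<le> 2"
  using assms by (cases rule: reducible.cases) auto

text \<open>Ordered pairs are counted. A vertex of degree at most two lies on at most 4 of them, and
  all others survive in \<open>fill v A\<close>. This makes the input and the initial neighbour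
  lists linear in the number of vertices.\<close>

lemma reducible_card_edges:
  assumes "reducible L A" "graph_on L A"
  shows "card {(x, y). A x y} \<le> 4 * card L"
  using assms
proof (induction)
  case (empty A)
  then have "{(x, y). A x y} = {}" by (auto simp: graph_on_def)
  then show ?case by simp
next
  case (step v L A)
  have fin: "finite (Collect (A v))" using step.prems by (rule graph_on_finite_nbrs)
  have g': "graph_on (L - {v}) (fill v A)" using step.prems by (rule graph_on_fill)
  have fin': "finite {(x, y). fill v A x y}"
    by (rule finite_subset[of _ "L \<times> L"]) (use step.prems g' in \<open>auto simp: graph_on_def\<close>)
  have "{(x, y). A x y} \<subseteq> {(x, y). fill v A x y} \<union> ({v} \<times> Collect (A v) \<union> Collect (A v) \<times> {v})"
    using step.prems by (auto simp: graph_on_def fill_def)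
  then have "card {(x, y). A x y} \<le> card ({(x, y). fill v A x y} \<union> ({v} \<times> Collect (A v) \<union> Collect (A v) \<times> {v}))"
    using fin fin' by (intro card_mono) auto
  also have "\<dots> \<le> card {(x, y). fill v A x y} + (card ({v} \<times> Collect (A v)) + card (Collect (A v) \<times> {v}))"
    by (meson card_Un_le le_trans add_left_mono)
  also have "\<dots> \<le> 4 * card (L - {v}) + 4"
    using step.IH[OF g'] step.hyps(2) by (simp add: card_cartesian_product)
  also have "\<dots> = 4 * card L"
    using card.remove[of L v] step.hyps(1) step.prems by (simp add: graph_on_def)
  finally show ?case .
qed

lemma reduces_trans: "reduces L A L' A' \<Longrightarrow> reduces L' A' L'' A'' \<Longrightarrow> reduces L A L'' A''"
  by (induction rule: reduces.induct) (auto intro: reduces.step)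

lemma reduces_reducible: "reduces L A L' A' \<Longrightarrow> reducible L' A' \<Longrightarrow> reducible L A"
  by (induction rule: reduces.induct) (auto intro: reducible.step)

lemma reduces_graph_on: "reduces L A L' A' \<Longrightarrow> graph_on L A \<Longrightarrow> graph_on L' A' \<and> L' \<subseteq> L"
  by (induction rule: reduces.induct) (auto dest: graph_on_fill)

text \<open>Deletions in one part do not notice foreign edges \<open>X\<close> and foreign vertices
  \<open>M\<close> that avoid the deleted vertices \<open>L - L'\<close>. Leaving \<open>X\<close>
  and \<open>M\<close> arbitrary lets the lemma serve both halves of a union in turn.\<close>

lemma reduces_context:
  assumes "reduces L A L' A'" "graph_on L A"
    and "\<And>x y. X x y \<Longrightarrow> x \<notin> L - L' \<and> y \<notin> L - L'" "M \<inter> (L - L') = {}"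
  shows "reduces (L \<union> M) (\<lambda>x y. A x y \<or> X x y) (L' \<union> M) (\<lambda>x y. A' x y \<or> X x y)"
  using assms
proof (induction)
  case (step v L A L' A')
  have "v \<notin> L'" using reduces_graph_on[OF step.hyps(3) graph_on_fill[OF step.prems(1)]] by auto
  then have v: "\<not> X x v" "\<not> X v x" "v \<notin> M" for x using step by auto
  have "reduces (L - {v} \<union> M) (\<lambda>x y. fill v A x y \<or> X x y) (L' \<union> M) (\<lambda>x y. A' x y \<or> X x y)"
    using step.prems by (intro step.IH graph_on_fill) auto
  moreover have "(\<lambda>x y. fill v A x y \<or> X x y) = fill v (\<lambda>x y. A x y \<or> X x y)"
    using v by (auto simp: fill_def fun_eq_iff)
  moreover have "L - {v} \<union> M = (L \<union> M) - {v}" using v by auto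
  ultimately show ?case using step.hyps(1,2) v
    reduces.step[of v "L \<union> M" "\<lambda>x y. A x y \<or> X x y"] by simp
qed (auto intro: reduces.stop)

lemma reduces_Un:
  assumes "reduces V1 A1 W1 B1" "reduces V2 A2 W2 B2" "graph_on V1 A1" "graph_on V2 A2"
    "V1 \<inter> V2 \<subseteq> W1 \<inter> W2"
  shows "reduces (V1 \<union> V2) (\<lambda>x y. A1 x y \<or> A2 x y) (W1 \<union> W2) (\<lambda>x y. B1 x y \<or> B2 x y)"
proof -
  have 1: "graph_on W1 B1" "W1 \<subseteq> V1" using reduces_graph_on[OF assms(1,3)] by auto
  have "reduces (V1 \<union> V2) (\<lambda>x y. A1 x y \<or> A2 x y) (W1 \<union> V2) (\<lambda>x y. B1 x y \<or> A2 x y)"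
    by (rule reduces_context[OF assms(1,3)]) (use assms(4,5) in \<open>fastforce simp: graph_on_def\<close>)+
  moreover have "reduces (V2 \<union> W1) (\<lambda>x y. A2 x y \<or> B1 x y) (W2 \<union> W1) (\<lambda>x y. B2 x y \<or> B1 x y)"
    by (rule reduces_context[OF assms(2,4)]) (use assms(5) 1 in \<open>fastforce simp: graph_on_def\<close>)+
  then have "reduces (W1 \<union> V2) (\<lambda>x y. B1 x y \<or> A2 x y) (W1 \<union> W2) (\<lambda>x y. B1 x y \<or> B2 x y)"
    by (simp add: disj_commute Un_commute)
  ultimately show ?thesis by (rule reduces_trans)
qed

section \<open>Generalized series-parallel graphs are reducible\<close>

definition adj :: "'a set set \<Rightarrow> 'a \<Rightarrow> 'a \<Rightarrow> bool" where
  "adj E x y \<longleftrightarrow> {x, y} \<in> E"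

lemma adj_Un: "adj (E1 \<union> E2) = (\<lambda>x y. adj E1 x y \<or> adj E2 x y)"
  by (auto simp: adj_def fun_eq_iff)

lemma gsp_graph_on: "gsp V E s t \<Longrightarrow> graph_on V (adj E)"
  unfolding graph_on_def adj_def
  by (drule gsp_simple_graph) (fastforce simp: insert_commute doubleton_eq_iff)

lemma reduces_last:
  assumes "reduces V A (insert v W) B" "graph_on (insert v W) B" "v \<notin> W" "Collect (B v) \<subseteq> {x, y}"
  shows "\<exists>B'. reduces V A W B'"
proof -
  have "card (Collect (B v)) \<le> card {x, y}" using assms(4) by (intro card_mono) auto
  also have "\<dots> \<le> 2" by (simp add: card_insert_if)
  finally have "reduces (insert v W) B W (fill v B)"
    using assms(3) reduces.step[of v "insert v W" B] reduces.stop[of W "fill v B"] by simp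
  then show ?thesis using assms(1) reduces_trans by blast
qed

text \<open>The terminals are spared since they may be glued again. Each operation identifies
  terminals only, so \<open>reduces_Un\<close> applies; the vertex that ceases to be a terminal,
  \<open>x\<close> in a series and \<open>t'\<close> in a generalized series operation, then has at
  most the two new terminals as neighbours and is deleted last.\<close>

lemma gsp_reduces: "gsp V E s t \<Longrightarrow> \<exists>B. reduces V (adj E) {s, t} B"
proof (induction rule: gsp.induct)
  case (edge s t)
  then show ?case by (auto intro: reduces.stop)
next
  case (series V1 E1 s x V2 E2 t)
  from series.IH obtain B1 B2 where B: "reduces V1 (adj E1) {s, x} B1" "reduces V2 (adj E2) {x, t} B2" by auto
  note g = gsp_graph_on[OF series.hyps(1)] gsp_graph_on[OF series.hyps(2)]
  note s = gsp_simple_graph[OF series.hyps(1)] gsp_simple_graph[OF series.hyps(2)]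
  have r: "reduces (V1 \<union> V2) (adj (E1 \<union> E2)) (insert x {s, t}) (\<lambda>x y. B1 x y \<or> B2 x y)"
    using reduces_Un[OF B g] series.hyps(3) by (simp add: adj_Un insert_commute)
  have g': "graph_on (insert x {s, t}) (\<lambda>x y. B1 x y \<or> B2 x y)"
    using reduces_graph_on[OF B(1) g(1)] reduces_graph_on[OF B(2) g(2)] by (auto simp: graph_on_def)
  show ?case by (rule reduces_last[OF r g', of s t]) (use s g' in \<open>auto simp: graph_on_def\<close>)
next
  case (parallel V1 E1 s t V2 E2)
  from parallel.IH obtain B1 B2 where B: "reduces V1 (adj E1) {s, t} B1" "reduces V2 (adj E2) {s, t} B2" by auto
  note g = gsp_graph_on[OF parallel.hyps(1)] gsp_graph_on[OF parallel.hyps(2)]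
  show ?case using reduces_Un[OF B g] parallel.hyps(3) by (auto simp: adj_Un)
next
  case (gen_series V1 E1 s t V2 E2 t')
  from gen_series.IH obtain B1 B2 where B: "reduces V1 (adj E1) {s, t} B1" "reduces V2 (adj E2) {t, t'} B2" by auto
  note g = gsp_graph_on[OF gen_series.hyps(1)] gsp_graph_on[OF gen_series.hyps(2)]
  note s = gsp_simple_graph[OF gen_series.hyps(1)] gsp_simple_graph[OF gen_series.hyps(2)]
  have r: "reduces (V1 \<union> V2) (adj (E1 \<union> E2)) (insert t' {s, t}) (\<lambda>x y. B1 x y \<or> B2 x y)"
    using reduces_Un[OF B g] gen_series.hyps(3) by (simp add: adj_Un insert_commute)
  have g': "graph_on (insert t' {s, t}) (\<lambda>x y. B1 x y \<or> B2 x y)"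
    using reduces_graph_on[OF B(1) g(1)] reduces_graph_on[OF B(2) g(2)] by (auto simp: graph_on_def)
  show ?case
    by (rule reduces_last[OF r g', of s t]) (use s gen_series.hyps(3) g' in \<open>auto simp: graph_on_def\<close>)
qed

lemma gsp_reducible:
  assumes "gsp V E s t"
  shows "reducible V (adj E)"
proof -
  obtain B where B: "reduces V (adj E) {s, t} B" using gsp_reduces[OF assms] by blast
  have g: "graph_on {s, t} B" "s \<noteq> t"
    using reduces_graph_on[OF B gsp_graph_on[OF assms]] gsp_simple_graph[OF assms] by auto
  have "\<exists>B'. reduces V (adj E) {t} B'"
    by (rule reduces_last[OF B, of s t]) (use g in \<open>auto simp: graph_on_def\<close>)
  then obtain B' where B': "reduces V (adj E) {t} B'" ..
  have g': "graph_on {t} B'" using reduces_graph_on[OF B' gsp_graph_on[OF assms]] by auto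
  have "\<exists>B'. reduces V (adj E) {} B'"
    by (rule reduces_last[OF B', of t t]) (use g' in \<open>auto simp: graph_on_def\<close>)
  then show ?thesis using reduces_reducible reducible.empty by blast
qed

section \<open>Partial solutions\<close>

definition cnt :: "'a set set \<Rightarrow> 'a \<Rightarrow> 'a set \<Rightarrow> nat" where
  "cnt E v S = card (nbh E v \<inter> S)"

text \<open>
  A vertex has state 3 if it is selected, and otherwise the number of its selected neighbours.
\<close>

definition term_in :: "nat \<Rightarrow> 'a \<Rightarrow> 'a set" where
  "term_in i x = (if i = 3 then {x} else {})"

definition has_state :: "'a set set \<Rightarrow> 'a \<Rightarrow> nat \<Rightarrow> 'a set \<Rightarrow> bool" where
  "has_state E x i S \<longleftrightarrow> i = 3 \<or> cnt E x S = i"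

text \<open>The attachment vertices are kept out of \<open>S\<close> and enter through
  \<open>term_in\<close>, so that pieces sharing one of them do not count it twice in their sizes.
  As \<open>S'\<close> contains the selected ones, the edge between \<open>x\<close> and
  \<open>y\<close> is accounted for here. Domination of \<open>x\<close> and \<open>y\<close>
  themselves is not yet demanded.\<close>

definition psol :: "'a set set \<Rightarrow> 'a set \<Rightarrow> 'a \<Rightarrow> 'a \<Rightarrow> nat \<Rightarrow> nat \<Rightarrow> 'a set \<Rightarrow> bool" where
  "psol E D x y i j S \<longleftrightarrow> S \<subseteq> D \<and>
     (let S' = S \<union> term_in i x \<union> term_in j y in
       (\<forall>d \<in> D - S. cnt E d S' = 1 \<or> cnt E d S' = 2) \<and> has_state E x i S' \<and> has_state E y j S')"

lemma psol_commute: "psol E D x y i j S = psol E D y x j i S"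
  unfolding psol_def Let_def by (auto simp: Un_ac)

text \<open>The states that two pieces may give to a vertex they share. \<open>i + j < 3\<close>
  also excludes that exactly one of them is 3, so agreement on selection needs no clause of its
  own.\<close>

definition compat :: "nat \<Rightarrow> nat \<Rightarrow> bool" where
  "compat i j \<longleftrightarrow> i = 3 \<and> j = 3 \<or> i + j < 3"

definition join :: "nat \<Rightarrow> nat \<Rightarrow> nat" where
  "join i j = (if i = 3 then 3 else i + j)"

text \<open>The states of the eliminated vertex in its three pieces. Here the defining condition of
  a [1,2]-set is finally imposed on it; as in \<open>compat\<close>, small sums rule out a mixture
  with 3.\<close>

definition closes :: "nat \<Rightarrow> nat \<Rightarrow> nat \<Rightarrow> bool" where
  "closes p q u \<longleftrightarrow> p = 3 \<and> q = 3 \<and> u = 3 \<or> p + q + u = 1 \<or> p + q + u = 2"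

lemma compat_less: "compat i j \<Longrightarrow> i < 4 \<and> j < 4 \<and> join i j < 4 \<and> (i = 3 \<longleftrightarrow> j = 3) \<and> (join i j = 3 \<longleftrightarrow> i = 3)"
  by (auto simp: compat_def join_def)

lemma closes_less: "closes p q u \<Longrightarrow> p < 4 \<and> q < 4 \<and> u < 4 \<and> (q = 3 \<longleftrightarrow> p = 3) \<and> (u = 3 \<longleftrightarrow> p = 3)"
  by (auto simp: closes_def)

lemma nbh_commute: "u \<in> nbh E v \<longleftrightarrow> v \<in> nbh E u"
  by (auto simp: nbh_def insert_commute)

lemma cnt_disjoint:
  assumes "nbh E x \<inter> S = nbh E y \<inter> S1 \<union> nbh E z \<inter> S2" "nbh E y \<inter> S1 \<inter> (nbh E z \<inter> S2) = {}" "finite S1" "finite S2"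
  shows "cnt E x S = cnt E y S1 + cnt E z S2"
  using assms by (simp add: cnt_def card_Un_disjoint)

lemma disjoint_mono: "N \<subseteq> A \<Longrightarrow> X \<subseteq> B \<Longrightarrow> A \<inter> B = {} \<Longrightarrow> N \<inter> X = {}"
  by blast

text \<open>
  The vertex v with neighbours a and b is eliminated. Its pieces D1, D2, D3 at the pairs
  (v, a), (v, b), (v, z) and the piece D0 at (a, c) are merged into one piece at (a, c), where
  usually c = b. Missing neighbours are replaced by isolated dummies; z is always a dummy, so
  that D3 hangs at v alone.
\<close>

locale elimination =
  fixes E :: "'a set set" and D0 D1 D2 D3 :: "'a set" and a b c v z :: 'a
  assumes fin: "finite D0" "finite D1" "finite D2" "finite D3"
    and disj: "D0 \<inter> D1 = {}" "D0 \<inter> D2 = {}" "D0 \<inter> D3 = {}" "D1 \<inter> D2 = {}" "D1 \<inter> D3 = {}" "D2 \<inter> D3 = {}"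
    and out: "{a, b, c, v, z} \<inter> (D0 \<union> D1 \<union> D2 \<union> D3) = {}"
    and v: "v \<noteq> a" "v \<noteq> b" "v \<noteq> c" "v \<noteq> z" and ac: "a \<noteq> c"
    and loopfree: "\<And>x. x \<notin> nbh E x"
    and cl: "\<And>d. d \<in> D0 \<Longrightarrow> nbh E d \<subseteq> D0 \<union> {a, c}" "\<And>d. d \<in> D1 \<Longrightarrow> nbh E d \<subseteq> D1 \<union> {v, a}"
      "\<And>d. d \<in> D2 \<Longrightarrow> nbh E d \<subseteq> D2 \<union> {v, b}" "\<And>d. d \<in> D3 \<Longrightarrow> nbh E d \<subseteq> D3 \<union> {v, z}"
    and nv: "nbh E v \<subseteq> D1 \<union> D2 \<union> D3 \<union> {a, b}"
    and nz: "nbh E z = {}" and nab: "a = b \<Longrightarrow> nbh E a = {}"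
    and nbc: "b = c \<or> nbh E b = {} \<and> nbh E c = {}"
begin

definition "D = insert v (D0 \<union> D1 \<union> D2 \<union> D3)"

context
  fixes i1 i2 j1 j2 p q u :: nat and S S0 S1 S2 S3 T T0 T1 T2 T3 :: "'a set"
  assumes c1: "compat i1 i2" and c2: "compat j1 j2" and c3: "(q = 3) = (p = 3)" "(u = 3) = (p = 3)"
    and sub: "S0 \<subseteq> D0" "S1 \<subseteq> D1" "S2 \<subseteq> D2" "S3 \<subseteq> D3"
    and S_eq: "S = S0 \<union> S1 \<union> S2 \<union> S3 \<union> term_in p v"
    and T_eq: "T = S \<union> term_in (join i1 i2) a \<union> term_in (join j1 j2) c"
    and T0: "T0 = S0 \<union> term_in i1 a \<union> term_in j1 c"
    and T1: "T1 = S1 \<union> term_in p v \<union> term_in i2 a"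
    and T2: "T2 = S2 \<union> term_in q v \<union> term_in j2 b"
    and T3: "T3 = S3 \<union> term_in u v \<union> term_in 0 z"
begin

text \<open>The selected sets depend on the states only through being 3 or not. The counting lemmas
  below use no more than that, which allows \<open>psol_split\<close> to apply them with provisional
  states.\<close>

lemma terms: "term_in i2 a = term_in i1 a" "term_in (join i1 i2) a = term_in i1 a"
  "term_in j2 b = term_in j1 b" "term_in (join j1 j2) c = term_in j1 c"
  "term_in q v = term_in p v" "term_in u v = term_in p v" "term_in 0 z = {}"
  using c1 c2 c3 by (auto simp: term_in_def compat_def join_def)

lemma sub_terms: "term_in i x \<subseteq> {x}" by (auto simp: term_in_def)

text \<open>The merged piece is attached at \<open>c\<close> where the old one was attached at
  \<open>b\<close>; whenever the two differ, both are isolated and no neighbourhood sees the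
  exchange.\<close>

lemma b_term: "nbh E x \<inter> term_in j1 b = nbh E x \<inter> term_in j1 c"
  using nbc nbh_commute[of x E b] nbh_commute[of x E c] by (auto simp: term_in_def nbh_commute)

lemma fin_T: "finite T0" "finite T1" "finite T2" "finite T3"
  using sub fin by (auto simp: T0 T1 T2 T3 term_in_def intro: finite_subset)

lemma out_single: "a \<notin> D0" "a \<notin> D1" "a \<notin> D2" "a \<notin> D3" "b \<notin> D0" "b \<notin> D1" "b \<notin> D2" "b \<notin> D3"
  "c \<notin> D0" "c \<notin> D1" "c \<notin> D2" "c \<notin> D3" "v \<notin> D0" "v \<notin> D1" "v \<notin> D2" "v \<notin> D3"
  "z \<notin> D0" "z \<notin> D1" "z \<notin> D2" "z \<notin> D3"
  using out by auto

lemma a_D2: "nbh E a \<inter> D2 = {}"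
proof -
  have "a \<notin> nbh E d" if "d \<in> D2" for d
    using cl(3)[OF that] that v(1) out_single nab nbh_commute[of d E a] by blast
  then show ?thesis using nbh_commute[of a E] by blast
qed

lemma a_D3: "nbh E a \<inter> D3 = {}"
proof -
  have "a \<notin> nbh E d" if "d \<in> D3" for d
    using cl(4)[OF that] that v(1) out_single nz nbh_commute[of d E a] by blast
  then show ?thesis using nbh_commute[of a E] by blast
qed

lemma c_D1: "nbh E c \<inter> D1 = {}"
proof -
  have "c \<notin> nbh E d" if "d \<in> D1" for d
    using cl(2)[OF that] that v(3) ac out_single by blast
  then show ?thesis using nbh_commute[of c E] by blast
qed

lemma c_D3: "nbh E c \<inter> D3 = {}"
proof -
  have "c \<notin> nbh E d" if "d \<in> D3" for d
    using cl(4)[OF that] that v(3) out_single nz nbh_commute[of d E c] by blast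
  then show ?thesis using nbh_commute[of c E] by blast
qed

lemma v_D0: "nbh E v \<inter> D0 = {}"
  using nv disj out_single by blast

lemma nbh_D0: "d \<in> D0 \<Longrightarrow> nbh E d \<inter> T = nbh E d \<inter> T0"
proof -
  assume "d \<in> D0"
  note n = cl(1)[OF this]
  have "nbh E d \<inter> S1 = {}" "nbh E d \<inter> S2 = {}" "nbh E d \<inter> S3 = {}" "nbh E d \<inter> term_in p v = {}"
    by (rule disjoint_mono[OF n sub(2)] disjoint_mono[OF n sub(3)] disjoint_mono[OF n sub(4)]
      disjoint_mono[OF n sub_terms], (use disj out_single v in auto)[1])+
  then show ?thesis unfolding T_eq T0 S_eq terms by blast
qed

lemma nbh_D1: "d \<in> D1 \<Longrightarrow> nbh E d \<inter> T = nbh E d \<inter> T1"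
proof -
  assume d: "d \<in> D1"
  note n = cl(2)[OF this]
  have "nbh E d \<inter> S0 = {}" "nbh E d \<inter> S2 = {}" "nbh E d \<inter> S3 = {}" "nbh E d \<inter> term_in j1 c = {}"
    by (rule disjoint_mono[OF n sub(1)] disjoint_mono[OF n sub(3)] disjoint_mono[OF n sub(4)]
      disjoint_mono[OF n sub_terms], (use disj out_single v ac in auto)[1])+
  then show ?thesis unfolding T_eq T1 S_eq terms by blast
qed

lemma nbh_D2: "d \<in> D2 \<Longrightarrow> nbh E d \<inter> T = nbh E d \<inter> T2"
proof -
  assume d: "d \<in> D2"
  note n = cl(3)[OF this]
  have "a \<notin> nbh E d" using a_D2 d nbh_commute[of d E a] by blast
  then have "nbh E d \<inter> term_in i1 a = {}" using sub_terms[of i1 a] by blast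
  moreover have "nbh E d \<inter> S0 = {}" "nbh E d \<inter> S1 = {}" "nbh E d \<inter> S3 = {}"
    by (rule disjoint_mono[OF n sub(1)] disjoint_mono[OF n sub(2)] disjoint_mono[OF n sub(4)],
      (use disj out_single v in auto)[1])+
  ultimately show ?thesis using b_term[of d] unfolding T_eq T2 S_eq terms by blast
qed

lemma nbh_D3: "d \<in> D3 \<Longrightarrow> nbh E d \<inter> T = nbh E d \<inter> T3"
proof -
  assume d: "d \<in> D3"
  have n: "nbh E d \<subseteq> D3 \<union> {v}" using cl(4)[OF d] nz nbh_commute[of d E z] by blast
  have "nbh E d \<inter> S0 = {}" "nbh E d \<inter> S1 = {}" "nbh E d \<inter> S2 = {}" "nbh E d \<inter> term_in i1 a = {}"
    "nbh E d \<inter> term_in j1 c = {}"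
    by (rule disjoint_mono[OF n sub(1)] disjoint_mono[OF n sub(2)] disjoint_mono[OF n sub(3)]
      disjoint_mono[OF n sub_terms], (use disj out_single v in auto)[1])+
  then show ?thesis unfolding T_eq T3 S_eq terms by blast
qed

text \<open>The summands are disjoint because an edge to \<open>c\<close> is charged to
  \<open>T0\<close> and an edge to \<open>v\<close> to \<open>T1\<close>. A selected
  \<open>a\<close> lies in both sets, but it is not its own neighbour.\<close>

lemma cnt_a: "cnt E a T = cnt E a T0 + cnt E a T1"
proof (rule cnt_disjoint)
  have "nbh E a \<inter> S2 = {}" "nbh E a \<inter> S3 = {}" using a_D2 a_D3 sub by blast+
  then show "nbh E a \<inter> T = nbh E a \<inter> T0 \<union> nbh E a \<inter> T1"
    unfolding T_eq T0 T1 S_eq terms by blast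
  have "S0 \<inter> S1 = {}" "S0 \<inter> term_in p v = {}" "S1 \<inter> term_in j1 c = {}" "nbh E a \<inter> term_in i1 a = {}"
    "term_in j1 c \<inter> term_in p v = {}"
    by (rule disjoint_mono[OF sub(1,2)] disjoint_mono[OF sub(1) sub_terms] disjoint_mono[OF sub(2) sub_terms]
      disjoint_mono[OF sub_terms sub_terms] disjoint_mono[OF subset_refl sub_terms], (use disj out_single v loopfree[of a] in auto)[1])+
  then show "nbh E a \<inter> T0 \<inter> (nbh E a \<inter> T1) = {}"
    unfolding T0 T1 terms by blast
qed (rule fin_T)+

lemma cnt_c: "cnt E c T = cnt E c T0 + cnt E b T2"
proof (cases "b = c")
  case True
  show ?thesis
  proof (rule cnt_disjoint)
    have "nbh E c \<inter> S1 = {}" "nbh E c \<inter> S3 = {}" using c_D1 c_D3 sub by blast+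
    then show "nbh E c \<inter> T = nbh E c \<inter> T0 \<union> nbh E b \<inter> T2"
      unfolding T_eq T0 T2 S_eq terms unfolding True by blast
    have "S0 \<inter> S2 = {}" "S0 \<inter> term_in p v = {}" "S2 \<inter> term_in i1 a = {}" "nbh E c \<inter> term_in j1 c = {}"
      "term_in i1 a \<inter> term_in p v = {}"
      by (rule disjoint_mono[OF sub(1,3)] disjoint_mono[OF sub(1) sub_terms] disjoint_mono[OF sub(3) sub_terms]
      disjoint_mono[OF sub_terms sub_terms] disjoint_mono[OF subset_refl sub_terms], (use disj out_single v loopfree[of c] in auto)[1])+
    then show "nbh E c \<inter> T0 \<inter> (nbh E b \<inter> T2) = {}"
      unfolding T0 T2 terms unfolding True by blast
  qed (rule fin_T)+
qed (use nbc in \<open>simp add: cnt_def\<close>)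

lemma cnt_v: "cnt E v T = cnt E v T1 + cnt E v T2 + cnt E v T3"
proof -
  have l: "nbh E v \<inter> term_in p v = {}" using loopfree[of v] sub_terms[of p v] by blast
  have "cnt E v T = cnt E v (T1 \<union> T2) + cnt E v T3"
  proof (rule cnt_disjoint)
    have "nbh E v \<inter> S0 = {}" using v_D0 sub by blast
    then show "nbh E v \<inter> T = nbh E v \<inter> (T1 \<union> T2) \<union> nbh E v \<inter> T3"
      using b_term[of v] unfolding T_eq T1 T2 T3 S_eq terms by blast
    have "S1 \<inter> S3 = {}" "S2 \<inter> S3 = {}" "S3 \<inter> term_in i1 a = {}" "S3 \<inter> term_in j1 b = {}"
      by (rule disjoint_mono[OF sub(2,4)] disjoint_mono[OF sub(3,4)] disjoint_mono[OF sub(4) sub_terms],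
        (use disj out_single in auto)[1])+
    then show "nbh E v \<inter> (T1 \<union> T2) \<inter> (nbh E v \<inter> T3) = {}"
      using l unfolding T1 T2 T3 terms by blast
  qed (use fin_T in auto)
  also have "cnt E v (T1 \<union> T2) = cnt E v T1 + cnt E v T2"
  proof (rule cnt_disjoint)
    have "S1 \<inter> S2 = {}" "S1 \<inter> term_in j1 b = {}" "S2 \<inter> term_in i1 a = {}"
      by (rule disjoint_mono[OF sub(2,3)] disjoint_mono[OF sub(2) sub_terms] disjoint_mono[OF sub(3) sub_terms],
        (use disj out_single in auto)[1])+
    moreover have "nbh E v \<inter> term_in i1 a \<inter> term_in j1 b = {}"
      using nab nbh_commute[of v E a] by (auto simp: term_in_def)
    ultimately show "nbh E v \<inter> T1 \<inter> (nbh E v \<inter> T2) = {}"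
      using l unfolding T1 T2 terms by blast
  qed (use fin_T in auto)
  finally show ?thesis .
qed

text \<open>A vertex inside a piece sees only this piece and its two attachment vertices, so its
  count is the same in the merged solution. Only \<open>v\<close>, \<open>a\<close> and
  \<open>c\<close> collect contributions from several pieces, and there the counts add up.\<close>

lemma psol_join:
  assumes cl: "closes p q u"
  assumes "psol E D0 a c i1 j1 S0" "psol E D1 v a p i2 S1" "psol E D2 v b q j2 S2" "psol E D3 v z u 0 S3"
  shows "psol E D a c (join i1 i2) (join j1 j2) S"
proof -
  note P = assms(2-5)[unfolded psol_def Let_def, folded T0 T1 T2 T3]
  have 1: "cnt E d T = 1 \<or> cnt E d T = 2" if dS: "d \<in> D - S" for d
  proof -
    consider "d \<in> D0 - S0" | "d \<in> D1 - S1" | "d \<in> D2 - S2" | "d \<in> D3 - S3" | "d = v" "p \<noteq> 3"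
      using dS unfolding D_def S_eq by (cases "p = 3") (auto simp: term_in_def)
    then show ?thesis
    proof cases
      case 5
      then show ?thesis using cl P cnt_v by (auto simp: closes_def has_state_def)
    qed (use P nbh_D0[of d] nbh_D1[of d] nbh_D2[of d] nbh_D3[of d] in \<open>auto simp: cnt_def\<close>)
  qed
  have "S \<subseteq> D" using sub by (auto simp: S_eq D_def term_in_def)
  moreover have "has_state E a (join i1 i2) T" using P cnt_a c1 by (auto simp: has_state_def join_def compat_def)
  moreover have "has_state E c (join j1 j2) T" using P cnt_c c2 by (auto simp: has_state_def join_def compat_def)
  ultimately show ?thesis unfolding psol_def Let_def T_eq[symmetric] using 1 by blast
qed

end

lemma psol_glue:
  assumes "compat i1 i2" "compat j1 j2" "closes p q u"
    "psol E D0 a c i1 j1 S0" "psol E D1 v a p i2 S1" "psol E D2 v b q j2 S2" "psol E D3 v z u 0 S3"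
  shows "psol E D a c (join i1 i2) (join j1 j2) (S0 \<union> S1 \<union> S2 \<union> S3 \<union> term_in p v)"
proof -
  have "S0 \<subseteq> D0" "S1 \<subseteq> D1" "S2 \<subseteq> D2" "S3 \<subseteq> D3" using assms(4-7) by (simp_all add: psol_def)
  then show ?thesis
    using closes_less[OF assms(3)] assms by (intro psol_join[OF _ _ _ _ _ _ _ _ refl refl refl refl refl refl]) auto
qed

lemma card_glue:
  assumes "S0 \<subseteq> D0" "S1 \<subseteq> D1" "S2 \<subseteq> D2" "S3 \<subseteq> D3"
  shows "card (S0 \<union> S1 \<union> S2 \<union> S3 \<union> term_in p v) =
    card S0 + card S1 + card S2 + card S3 + (if p = 3 then 1 else 0)"
proof -
  note f = finite_subset[OF assms(1) fin(1)] finite_subset[OF assms(2) fin(2)]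
    finite_subset[OF assms(3) fin(3)] finite_subset[OF assms(4) fin(4)]
  have "card (S0 \<union> S1 \<union> S2 \<union> S3 \<union> term_in p v) = card (S0 \<union> S1 \<union> S2 \<union> S3) + card (term_in p v)"
    by (rule card_Un_disjoint) (use f assms out in \<open>auto simp: term_in_def\<close>)
  moreover have "card (S0 \<union> S1 \<union> S2 \<union> S3) = card (S0 \<union> S1 \<union> S2) + card S3"
    by (rule card_Un_disjoint) (use f assms disj in auto)
  moreover have "card (S0 \<union> S1 \<union> S2) = card (S0 \<union> S1) + card S2"
    by (rule card_Un_disjoint) (use f assms disj in auto)
  moreover have "card (S0 \<union> S1) = card S0 + card S1"
    by (rule card_Un_disjoint) (use f assms disj in auto)
  ultimately show ?thesis by (simp add: term_in_def)
qed

text \<open>Completeness of the combination: restricted to the four pieces, a partial solution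
  yields partial solutions for the states dictated by its own counts. With additive cardinalities,
  nothing cheaper than the best combination can exist.\<close>

lemma psol_split:
  assumes "psol E D a c i j S" "i < 4" "j < 4"
  obtains i1 i2 j1 j2 p q u S0 S1 S2 S3 where
    "compat i1 i2" "compat j1 j2" "closes p q u" "i = join i1 i2" "j = join j1 j2"
    "psol E D0 a c i1 j1 S0" "psol E D1 v a p i2 S1" "psol E D2 v b q j2 S2" "psol E D3 v z u 0 S3"
    "S = S0 \<union> S1 \<union> S2 \<union> S3 \<union> term_in p v"
proof -
  define S0 S1 S2 S3 where Ss: "S0 = S \<inter> D0" "S1 = S \<inter> D1" "S2 = S \<inter> D2" "S3 = S \<inter> D3"
  define m :: "nat \<Rightarrow> nat" where "m = (\<lambda>x. if v \<in> S then 3 else x)"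
  define T0 T1 T2 T3 where Ts: "T0 = S0 \<union> term_in i a \<union> term_in j c" "T1 = S1 \<union> term_in (m 0) v \<union> term_in i a"
    "T2 = S2 \<union> term_in (m 0) v \<union> term_in j b" "T3 = S3 \<union> term_in (m 0) v"
  define T where "T = S \<union> term_in i a \<union> term_in j c"
  define i1 where "i1 = (if i = 3 then 3 else cnt E a T0)"
  define i2 where "i2 = (if i = 3 then 3 else cnt E a T1)"
  define j1 where "j1 = (if j = 3 then 3 else cnt E c T0)"
  define j2 where "j2 = (if j = 3 then 3 else cnt E b T2)"
  \<comment> \<open>The true states are counts not yet known to be compatible. The provisional
    states 0 and 3, and \<open>m 0\<close> at \<open>v\<close>, describe the same selected sets and
    satisfy the hypotheses of the counting lemmas at once.\<close>
  define i1' where "i1' = (if i = 3 then 3 else (0::nat))"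
  define j1' where "j1' = (if j = 3 then 3 else (0::nat))"
  define p q u where pqu: "p = m (cnt E v T1)" "q = m (cnt E v T2)" "u = m (cnt E v T3)"
  have P: "S \<subseteq> D" "\<And>d. d \<in> D - S \<Longrightarrow> cnt E d T = 1 \<or> cnt E d T = 2" "has_state E a i T" "has_state E c j T"
    using assms(1) unfolding psol_def Let_def T_def by blast+
  have sub: "S0 \<subseteq> D0" "S1 \<subseteq> D1" "S2 \<subseteq> D2" "S3 \<subseteq> D3" by (auto simp: Ss)
  have S: "S = S0 \<union> S1 \<union> S2 \<union> S3 \<union> term_in (m 0) v"
    using P(1) by (auto simp: D_def Ss m_def term_in_def)
  have comp: "compat i1' i1'" "compat j1' j1'" by (auto simp: i1'_def j1'_def compat_def)
  have tt: "T = S \<union> term_in (join i1' i1') a \<union> term_in (join j1' j1') c"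
    "T0 = S0 \<union> term_in i1' a \<union> term_in j1' c" "T1 = S1 \<union> term_in (m 0) v \<union> term_in i1' a"
    "T2 = S2 \<union> term_in (m 0) v \<union> term_in j1' b" "T3 = S3 \<union> term_in (m 0) v \<union> term_in 0 z"
    by (auto simp: T_def Ts term_in_def i1'_def j1'_def join_def)
  note gen = comp refl refl sub S tt
  note nb = nbh_D0[OF gen] nbh_D1[OF gen] nbh_D2[OF gen] nbh_D3[OF gen]
  note sums = cnt_a[OF gen] cnt_c[OF gen] cnt_v[OF gen]
  have v: "v \<notin> S \<Longrightarrow> cnt E v T = 1 \<or> cnt E v T = 2" using P(2) by (simp add: D_def)
  have lt: "x < 4 \<Longrightarrow> x \<noteq> 3 \<Longrightarrow> x < 3" for x :: nat by simp
  have ci: "compat i1 i2" "i = join i1 i2"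
    using P(3) sums(1) assms(2) lt[of i]
    by (auto simp: i1_def i2_def compat_def join_def has_state_def)
  have cj: "compat j1 j2" "j = join j1 j2"
    using P(4) sums(2) assms(3) lt[of j]
    by (auto simp: j1_def j2_def compat_def join_def has_state_def)
  have cv: "closes p q u" using v sums(3) by (auto simp: pqu m_def closes_def)
  \<comment> \<open>A count of 3 would be mistaken for the mark of a selected vertex. Each total is
    at most 2 at an unselected vertex, so no summand reaches 3.\<close>
  have ne: "v \<notin> S \<Longrightarrow> cnt E v T1 \<noteq> 3" "v \<notin> S \<Longrightarrow> cnt E v T2 \<noteq> 3" "v \<notin> S \<Longrightarrow> cnt E v T3 \<noteq> 3"
    "i = 3 \<or> cnt E a T0 \<noteq> 3" "i = 3 \<or> cnt E a T1 \<noteq> 3" "j = 3 \<or> cnt E c T0 \<noteq> 3" "j = 3 \<or> cnt E b T2 \<noteq> 3"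
    using v sums P(3,4) assms(2,3) by (auto simp: has_state_def)
  have t: "term_in i1 a = term_in i a" "term_in i2 a = term_in i a" "term_in j1 c = term_in j c"
    "term_in j2 b = term_in j b" "term_in p v = term_in (m 0) v" "term_in q v = term_in (m 0) v"
    "term_in u v = term_in (m 0) v" "term_in 0 z = {}"
    using ne by (auto simp: term_in_def i1_def i2_def j1_def j2_def pqu m_def)
  have cnt_eq: "nbh E d \<inter> T = nbh E d \<inter> T' \<Longrightarrow> cnt E d T' = cnt E d T" for d T' by (simp add: cnt_def)
  have dead: "d \<in> D0 - S0 \<Longrightarrow> cnt E d T0 = 1 \<or> cnt E d T0 = 2" "d \<in> D1 - S1 \<Longrightarrow> cnt E d T1 = 1 \<or> cnt E d T1 = 2"
    "d \<in> D2 - S2 \<Longrightarrow> cnt E d T2 = 1 \<or> cnt E d T2 = 2" "d \<in> D3 - S3 \<Longrightarrow> cnt E d T3 = 1 \<or> cnt E d T3 = 2" for d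
    using P(2)[of d] cnt_eq[OF nb(1)] cnt_eq[OF nb(2)] cnt_eq[OF nb(3)] cnt_eq[OF nb(4)]
    by (auto simp: D_def Ss)
  have z: "cnt E z X = 0" for X using nz by (simp add: cnt_def)
  show ?thesis
  proof (rule that[OF ci(1) cj(1) cv ci(2) cj(2)])
    show "psol E D0 a c i1 j1 S0" unfolding psol_def Let_def t Ts(1)[symmetric]
      using dead(1) sub(1) by (auto simp: has_state_def i1_def j1_def)
    show "psol E D1 v a p i2 S1" unfolding psol_def Let_def t Ts(2)[symmetric]
      using dead(2) sub(2) by (auto simp: has_state_def pqu i2_def m_def)
    show "psol E D2 v b q j2 S2" unfolding psol_def Let_def t Ts(3)[symmetric]
      using dead(3) sub(3) by (auto simp: has_state_def pqu j2_def m_def)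
    show "psol E D3 v z u 0 S3" unfolding psol_def Let_def t Un_empty_right Ts(4)[symmetric]
      using dead(4) sub(4) z by (auto simp: has_state_def pqu m_def)
    show "S = S0 \<union> S1 \<union> S2 \<union> S3 \<union> term_in p v" using S t by simp
  qed
qed

end

section \<open>Executions within a time bound\<close>

fun loop_free :: "cmd \<Rightarrow> bool" where
  "loop_free (Seq c1 c2) \<longleftrightarrow> loop_free c1 \<and> loop_free c2"
| "loop_free (Cond b c1 c2) \<longleftrightarrow> loop_free c1 \<and> loop_free c2"
| "loop_free (While b c) \<longleftrightarrow> False"
| "loop_free _ \<longleftrightarrow> True"

fun run :: "cmd \<Rightarrow> state \<Rightarrow> state" where
  "run (Assign x e) \<sigma> = \<sigma>\<lparr>scalar := (scalar \<sigma>)(x := eval \<sigma> e)\<rparr>"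
| "run (Write a i e) \<sigma> = \<sigma>\<lparr>cell := (cell \<sigma>)(a := (cell \<sigma> a)(eval \<sigma> i := eval \<sigma> e))\<rparr>"
| "run (Seq c1 c2) \<sigma> = run c2 (run c1 \<sigma>)"
| "run (Cond b c1 c2) \<sigma> = (if eval \<sigma> b \<noteq> 0 then run c1 \<sigma> else run c2 \<sigma>)"
| "run _ \<sigma> = \<sigma>"

fun stime :: "cmd \<Rightarrow> nat" where
  "stime Skip = 1"
| "stime (Assign x e) = cost e + 1"
| "stime (Write a i e) = cost i + cost e + 1"
| "stime (Seq c1 c2) = stime c1 + stime c2"
| "stime (Cond b c1 c2) = cost b + 1 + max (stime c1) (stime c2)"
| "stime (While b c) = 0"

text \<open>Only values that are stored have to stay below \<open>B\<close>. Indices and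
  intermediate results may be larger and are controlled by the shape of the expression.\<close>

fun small :: "nat \<Rightarrow> cmd \<Rightarrow> state \<Rightarrow> bool" where
  "small B (Assign x e) \<sigma> \<longleftrightarrow> eval \<sigma> e < B"
| "small B (Write a i e) \<sigma> \<longleftrightarrow> eval \<sigma> e < B"
| "small B (Seq c1 c2) \<sigma> \<longleftrightarrow> small B c1 \<sigma> \<and> small B c2 (run c1 \<sigma>)"
| "small B (Cond b c1 c2) \<sigma> \<longleftrightarrow> (if eval \<sigma> b \<noteq> 0 then small B c1 \<sigma> else small B c2 \<sigma>)"
| "small B _ \<sigma> \<longleftrightarrow> True"

text \<open>
  If all memory contents are below B, the value of an expression is below a power of B whose
  exponent can be read off the expression. The word bound is the eighth power of such a B.
\<close>

fun edeg :: "exp \<Rightarrow> nat" where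
  "edeg (Const k) = 1"
| "edeg (Var x) = 1"
| "edeg (Read a e) = edeg e"
| "edeg (Bin f e1 e2) =
    (case f of Plus \<Rightarrow> max (edeg e1) (edeg e2) + 1 | Times \<Rightarrow> edeg e1 + edeg e2 | _ \<Rightarrow> max (edeg e1) (edeg e2))"

fun emax :: "exp \<Rightarrow> nat" where
  "emax (Const k) = k"
| "emax (Var x) = 0"
| "emax (Read a e) = emax e"
| "emax (Bin f e1 e2) = max (emax e1) (emax e2)"

text \<open>8 is the exponent in the word bound \<open>B ^ 8\<close>. 20 covers the literals of the
  program, the largest being the block size 16, and has only to lie below \<open>B\<close>.\<close>

definition tame :: "exp \<Rightarrow> bool" where
  "tame e \<longleftrightarrow> edeg e \<le> 8 \<and> emax e \<le> 20"

fun ctame :: "cmd \<Rightarrow> bool" where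
  "ctame Skip \<longleftrightarrow> True"
| "ctame (Assign x e) \<longleftrightarrow> tame e"
| "ctame (Write a i e) \<longleftrightarrow> tame i \<and> tame e"
| "ctame (Seq c1 c2) \<longleftrightarrow> ctame c1 \<and> ctame c2"
| "ctame (Cond b c1 c2) \<longleftrightarrow> tame b \<and> ctame c1 \<and> ctame c2"
| "ctame (While b c) \<longleftrightarrow> tame b \<and> ctame c"

definition bounded_by :: "nat \<Rightarrow> state \<Rightarrow> bool" where
  "bounded_by B \<sigma> \<longleftrightarrow> (\<forall>x. scalar \<sigma> x < B) \<and> (\<forall>a i. cell \<sigma> a i < B)"

lemma edeg_pos: "0 < edeg e"
  by (induction e) (auto split: binop.split)

lemma eval_less:
  assumes "bounded_by B \<sigma>" "2 \<le> B" "emax e < B"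
  shows "eval \<sigma> e < B ^ edeg e"
  using assms
proof (induction e)
  case (Read a e)
  then have "cell \<sigma> a (eval \<sigma> e) < B ^ 1" by (simp add: bounded_by_def)
  also have "\<dots> \<le> B ^ edeg e" using Read.prems(2) edeg_pos[of e] by (intro power_increasing) auto
  finally show ?case by simp
next
  case (Bin f e1 e2)
  let ?x = "eval \<sigma> e1" and ?y = "eval \<sigma> e2" and ?m = "max (edeg e1) (edeg e2)"
  have xy: "?x < B ^ edeg e1" "?y < B ^ edeg e2" using Bin by auto
  have le: "B ^ edeg e1 \<le> B ^ ?m" "B ^ edeg e2 \<le> B ^ ?m"
    using Bin.prems(2) by (intro power_increasing; simp)+
  then have m: "?x < B ^ ?m" "?y < B ^ ?m" using xy by linarith+
  have "1 < B ^ ?m" using Bin.prems(2) edeg_pos[of e1] by (intro one_less_power) auto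
  moreover have "2 * B ^ ?m \<le> B ^ (?m + 1)" using Bin.prems(2) by simp
  moreover have "?x div ?y < B ^ ?m" "?x mod ?y < B ^ ?m" "?x - ?y < B ^ ?m"
    using m(1) by (meson le_less_trans div_le_dividend mod_less_eq_dividend diff_le_self)+
  moreover have "0 < B ^ ?m" using m(1) by linarith
  moreover have "?x * ?y < B ^ (edeg e1 + edeg e2)" using xy by (simp add: power_add mult_strict_mono')
  ultimately show ?case using m by (cases f) (auto simp del: power_Suc zero_less_power_eq)
qed (auto simp: bounded_by_def)

text \<open>\<open>fits\<close> constrains every subexpression. Neither \<open>edeg\<close> nor
  \<open>emax\<close> increases on the way to a subexpression, hence the induction with one fixed
  exponent \<open>d\<close>.\<close>

lemma fits_tame:
  assumes "bounded_by B \<sigma>" "20 < B" "tame e"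
  shows "fits (B ^ 8) \<sigma> e"
proof -
  have "fits (B ^ d) \<sigma> e" if "edeg e \<le> d" "emax e < B" for d
    using that
  proof (induction e)
    case (Const k)
    then have "B ^ 1 \<le> B ^ d" using assms(2) by (intro power_increasing) auto
    then show ?case using Const by simp
  next
    case (Var x)
    then have "B ^ 1 \<le> B ^ d" using assms(2) by (intro power_increasing) auto
    then show ?case using assms(1) by (auto simp: bounded_by_def intro: less_le_trans)
  next
    case (Read a e)
    then have "B ^ edeg (Read a e) \<le> B ^ d" using assms(2) by (intro power_increasing) auto
    then have "eval \<sigma> (Read a e) < B ^ d"
      using eval_less[OF assms(1), of "Read a e"] Read.prems assms(2) by linarith
    then show ?case using Read by simp
  next
    case (Bin f e1 e2)
    then have "B ^ edeg (Bin f e1 e2) \<le> B ^ d" using assms(2) by (intro power_increasing) auto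
    then have "eval \<sigma> (Bin f e1 e2) < B ^ d"
      using eval_less[OF assms(1), of "Bin f e1 e2"] Bin.prems assms(2) by linarith
    moreover have "edeg e1 \<le> d" "edeg e2 \<le> d" using Bin.prems(1) by (auto split: binop.splits)
    ultimately show ?case using Bin by simp
  qed
  then show ?thesis using assms by (simp add: tame_def)
qed

lemma run_bounded: "bounded_by B \<sigma> \<Longrightarrow> small B c \<sigma> \<Longrightarrow> bounded_by B (run c \<sigma>)"
  by (induction c arbitrary: \<sigma>) (auto simp: bounded_by_def split: if_splits)

lemma exec_run:
  assumes "loop_free c" "ctame c" "bounded_by B \<sigma>" "20 < B" "small B c \<sigma>"
  shows "\<exists>\<tau> \<le> stime c. exec (B ^ 8) c \<sigma> \<tau> (run c \<sigma>)"
  using assms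
proof (induction c arbitrary: \<sigma>)
  case (Seq c1 c2)
  then obtain \<tau>1 \<tau>2 where "\<tau>1 \<le> stime c1" "exec (B ^ 8) c1 \<sigma> \<tau>1 (run c1 \<sigma>)"
    "\<tau>2 \<le> stime c2" "exec (B ^ 8) c2 (run c1 \<sigma>) \<tau>2 (run c2 (run c1 \<sigma>))"
    using run_bounded by (metis ctame.simps(4) loop_free.simps(1) small.simps(3))
  then show ?case by (intro exI[of _ "\<tau>1 + \<tau>2"]) (auto intro: exec.Seq)
next
  case (Cond b c1 c2)
  have b: "fits (B ^ 8) \<sigma> b" using Cond.prems by (intro fits_tame) auto
  show ?case
  proof (cases "eval \<sigma> b = 0")
    case True
    then obtain \<tau> where "\<tau> \<le> stime c2" "exec (B ^ 8) c2 \<sigma> \<tau> (run c2 \<sigma>)" using Cond by fastforce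
    then show ?thesis using True b by (intro exI[of _ "cost b + 1 + \<tau>"]) (auto intro: exec.CondFalse[simplified])
  next
    case False
    then obtain \<tau> where "\<tau> \<le> stime c1" "exec (B ^ 8) c1 \<sigma> \<tau> (run c1 \<sigma>)" using Cond by fastforce
    then show ?thesis using False b by (intro exI[of _ "cost b + 1 + \<tau>"]) (auto intro: exec.CondTrue[simplified])
  qed
next
  case (Assign x e)
  then show ?case using exec.Assign[OF fits_tame] by auto
next
  case (Write a i e)
  then show ?case using exec.Write[OF fits_tame fits_tame] by auto
next
  case Skip
  then show ?case using exec.Skip[of "B ^ 8" \<sigma>] by auto
qed auto

definition tri :: "nat \<Rightarrow> cmd \<Rightarrow> state \<Rightarrow> nat \<Rightarrow> (state \<Rightarrow> bool) \<Rightarrow> bool" where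
  "tri W c \<sigma> t Q \<longleftrightarrow> (\<exists>\<tau> \<sigma>'. exec W c \<sigma> \<tau> \<sigma>' \<and> \<tau> \<le> t \<and> Q \<sigma>')"

lemma tri_mono: "tri W c \<sigma> t Q \<Longrightarrow> t \<le> t' \<Longrightarrow> (\<And>\<sigma>'. Q \<sigma>' \<Longrightarrow> Q' \<sigma>') \<Longrightarrow> tri W c \<sigma> t' Q'"
  unfolding tri_def by (meson le_trans)

lemma tri_Seq:
  assumes "tri W c1 \<sigma> t1 R" "\<And>\<sigma>'. R \<sigma>' \<Longrightarrow> tri W c2 \<sigma>' t2 Q"
  shows "tri W (Seq c1 c2) \<sigma> (t1 + t2) Q"
proof -
  obtain \<tau>1 \<sigma>1 where 1: "exec W c1 \<sigma> \<tau>1 \<sigma>1" "\<tau>1 \<le> t1" "R \<sigma>1" using assms(1) by (auto simp: tri_def)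
  then obtain \<tau>2 \<sigma>2 where 2: "exec W c2 \<sigma>1 \<tau>2 \<sigma>2" "\<tau>2 \<le> t2" "Q \<sigma>2" using assms(2) unfolding tri_def by blast
  show ?thesis unfolding tri_def using exec.Seq[OF 1(1) 2(1)] 1 2 by (meson add_mono)
qed

lemma tri_run:
  assumes "bounded_by B \<sigma>" "20 < B" "loop_free c" "ctame c" "small B c \<sigma>"
    and "bounded_by B (run c \<sigma>) \<Longrightarrow> Q (run c \<sigma>)"
  shows "tri (B ^ 8) c \<sigma> (stime c) Q"
  unfolding tri_def using exec_run[OF assms(3,4,1,2,5)] assms(6) run_bounded[OF assms(1,5)] by blast

lemma tri_Cond:
  assumes "fits W \<sigma> b" "eval \<sigma> b \<noteq> 0 \<Longrightarrow> tri W c1 \<sigma> t Q" "eval \<sigma> b = 0 \<Longrightarrow> tri W c2 \<sigma> t Q"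
  shows "tri W (Cond b c1 c2) \<sigma> (cost b + 1 + t) Q"
proof (cases "eval \<sigma> b = 0")
  case True
  then obtain \<tau> \<sigma>' where "exec W c2 \<sigma> \<tau> \<sigma>'" "\<tau> \<le> t" "Q \<sigma>'" using assms(3) by (auto simp: tri_def)
  then show ?thesis unfolding tri_def using exec.CondFalse[OF assms(1) True] by (meson add_left_mono)
next
  case False
  then obtain \<tau> \<sigma>' where "exec W c1 \<sigma> \<tau> \<sigma>'" "\<tau> \<le> t" "Q \<sigma>'" using assms(2) by (auto simp: tri_def)
  then show ?thesis unfolding tri_def using exec.CondTrue[OF assms(1) False] by (meson add_left_mono)
qed

text \<open>The invariant carries a budget r that pays for the iterations still to come.\<close>

lemma tri_While:
  assumes "I r \<sigma>"
    and fits: "\<And>r \<sigma>. I r \<sigma> \<Longrightarrow> fits W \<sigma> b"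
    and step: "\<And>r \<sigma>. I r \<sigma> \<Longrightarrow> eval \<sigma> b \<noteq> 0 \<Longrightarrow>
      \<exists>t r'. t + r' + cost b + 1 \<le> r \<and> tri W c \<sigma> t (I r')"
  shows "tri W (While b c) \<sigma> (r + cost b + 1) (\<lambda>\<sigma>'. (\<exists>r'. I r' \<sigma>') \<and> eval \<sigma>' b = 0)"
  using assms(1)
proof (induction r arbitrary: \<sigma> rule: less_induct)
  case (less r)
  show ?case
  proof (cases "eval \<sigma> b = 0")
    case True
    then show ?thesis unfolding tri_def
      using exec.WhileFalse[OF fits[OF less.prems] True] less.prems by (intro exI conjI) auto
  next
    case False
    obtain t r' where t: "t + r' + cost b + 1 \<le> r" "tri W c \<sigma> t (I r')"
      using step[OF less.prems False] by blast
    then obtain \<tau>1 \<sigma>1 where 1: "exec W c \<sigma> \<tau>1 \<sigma>1" "\<tau>1 \<le> t" "I r' \<sigma>1" by (auto simp: tri_def)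
    have "r' < r" using t(1) by simp
    from less.IH[OF this 1(3)] obtain \<tau>2 \<sigma>2 where 2: "exec W (While b c) \<sigma>1 \<tau>2 \<sigma>2"
      "\<tau>2 \<le> r' + cost b + 1" "(\<exists>r'. I r' \<sigma>2) \<and> eval \<sigma>2 b = 0" unfolding tri_def by blast
    show ?thesis unfolding tri_def
      using exec.WhileTrue[OF fits[OF less.prems] False 1(1) 2(1)] 1(2) 2(2,3) t(1)
      by (intro exI[of _ "cost b + 1 + \<tau>1 + \<tau>2"] exI[of _ \<sigma>2]) auto
  qed
qed

definition seqs :: "cmd list \<Rightarrow> cmd" where
  "seqs cs = foldr Seq cs Skip"

lemma seqs_simps [simp]: "seqs [] = Skip" "seqs (c # cs) = Seq c (seqs cs)"
  by (simp_all add: seqs_def)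

lemma loop_free_seqs: "loop_free (seqs cs) \<longleftrightarrow> (\<forall>c \<in> set cs. loop_free c)"
  by (induction cs) auto

lemma ctame_seqs: "ctame (seqs cs) \<longleftrightarrow> (\<forall>c \<in> set cs. ctame c)"
  by (induction cs) auto

text \<open>Unrolled blocks are treated like loops over a list, with an invariant indexed by the
  prefix already executed. The decomposition of \<open>xs\<close> in the premise keeps the
  membership of \<open>t\<close> and the length of the prefix available.\<close>

lemma run_seqs_invariant:
  assumes "I [] \<sigma>"
    and "\<And>ts t us \<sigma>. xs = ts @ t # us \<Longrightarrow> I ts \<sigma> \<Longrightarrow> small B (f t) \<sigma> \<and> I (ts @ [t]) (run (f t) \<sigma>)"
  shows "small B (seqs (map f xs)) \<sigma> \<and> I xs (run (seqs (map f xs)) \<sigma>)"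
proof -
  have "small B (seqs (map f us)) \<sigma> \<and> I (ts @ us) (run (seqs (map f us)) \<sigma>)"
    if "I ts \<sigma>" "xs = ts @ us" for ts us \<sigma>
    using that
  proof (induction us arbitrary: ts \<sigma>)
    case (Cons t us)
    have "small B (f t) \<sigma> \<and> I (ts @ [t]) (run (f t) \<sigma>)" using assms(2) Cons.prems by blast
    then show ?case using Cons.IH[of "ts @ [t]" "run (f t) \<sigma>"] Cons.prems by simp
  qed simp
  from this[of "[]"] show ?thesis using assms(1) by simp
qed

section \<open>The program: graph and tables\<close>

text \<open>
  Scalars: 0 and 1 hold n and the number of edges, 2 holds n + 2, 3 and 10 the head and the tail of the
  queue, 4 the vertex v to be eliminated, 5 and 6 its neighbours a and b, 7 the vertex c, 8 and 9
  are a loop counter and its current item, 11 and 12 the addresses of the tables at (a, c) and (c, a), 13 to 15 those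
  at (v, a), (v, b), (v, n + 1), 16 the number of nodes, 17 to 21 a candidate size and the four nodes
  it comes from, 22 and 23 the ends of an edge to be added.

  Arrays: 0 and 1 are the input and 2 the output, 3 is the adjacency matrix, 4 contains the tables, 5 the sizes of the nodes,
  6 to 9 their children, 10 their vertices increased by 1 (0 for none), 11 the marks of the final pass, 12 and 13 the numbers
  and lists of neighbours (the k-th neighbour of x has index k * (n + 2) + x), 14 the degrees, 15 flags
  of eliminated vertices, 16 is the queue, 17 the table under construction.
\<close>

lemma pair_index_inj: "y < N \<Longrightarrow> y' < N \<Longrightarrow> x * N + y = x' * N + y' \<longleftrightarrow> x = x' \<and> y = (y'::nat)"
proof
  assume y: "y < N" "y' < N" and eq: "x * N + y = x' * N + y'"
  have "(x * N + y) div N = x" "(x' * N + y') div N = x'" using y by simp_all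
  with eq show "x = x' \<and> y = y'" by simp
qed auto

abbreviation ix :: "exp \<Rightarrow> nat \<Rightarrow> exp" where
  "ix e y \<equiv> Bin Plus (Bin Times e (Var 2)) (Var y)"

abbreviation inc :: "exp \<Rightarrow> exp" where
  "inc e \<equiv> Bin Plus e (Const 1)"

definition add_edge :: cmd where
  "add_edge = seqs
    [Write 3 (ix (Var 22) 23) (Const 1), Write 3 (ix (Var 23) 22) (Const 1),
     Write 13 (ix (Read 12 (Var 22)) 22) (Var 23), Write 12 (Var 22) (inc (Read 12 (Var 22))),
     Write 13 (ix (Read 12 (Var 23)) 23) (Var 22), Write 12 (Var 23) (inc (Read 12 (Var 23))),
     Write 14 (Var 22) (inc (Read 14 (Var 22))), Write 14 (Var 23) (inc (Read 14 (Var 23)))]"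

text \<open>
  Entries of the adjacency matrix are never deleted: this relation also contains all former edges.
\<close>

definition hist :: "nat \<Rightarrow> state \<Rightarrow> nat \<Rightarrow> nat \<Rightarrow> bool" where
  "hist n \<sigma> x y \<longleftrightarrow> x < n \<and> y < n \<and> cell \<sigma> 3 (x * (n + 2) + y) \<noteq> 0"

definition nbs :: "nat \<Rightarrow> state \<Rightarrow> nat \<Rightarrow> nat list" where
  "nbs n \<sigma> x = map (\<lambda>k. cell \<sigma> 13 (k * (n + 2) + x)) [0..<cell \<sigma> 12 x]"

definition hist_ok :: "nat \<Rightarrow> state \<Rightarrow> bool" where
  "hist_ok n \<sigma> \<longleftrightarrow> (\<forall>x y. hist n \<sigma> x y \<longrightarrow> x \<noteq> y \<and> hist n \<sigma> y x) \<and>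
     (\<forall>x<n. distinct (nbs n \<sigma> x) \<and> set (nbs n \<sigma> x) = Collect (hist n \<sigma> x))"

lemma hist_ok_count: "hist_ok n \<sigma> \<Longrightarrow> x < n \<Longrightarrow> cell \<sigma> 12 x = card (Collect (hist n \<sigma> x))"
  by (metis hist_ok_def distinct_card length_map length_upt minus_nat.diff_0 nbs_def)

lemma finite_hist: "finite (Collect (hist n \<sigma> x))"
  by (rule finite_subset[of _ "{..<n}"]) (auto simp: hist_def)

lemma card_hist_le: "card (Collect (hist n \<sigma> x)) \<le> n"
proof -
  have "Collect (hist n \<sigma> x) \<subseteq> {..<n}" by (auto simp: hist_def)
  then show ?thesis using card_mono[of "{..<n}"] by fastforce
qed

lemma hist_cong: "cell \<sigma>' 3 = cell \<sigma> 3 \<Longrightarrow> hist n \<sigma>' = hist n \<sigma>"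
  by (simp add: hist_def fun_eq_iff)

lemma hist_ok_cong: "cell \<sigma>' 3 = cell \<sigma> 3 \<Longrightarrow> cell \<sigma>' 12 = cell \<sigma> 12 \<Longrightarrow> cell \<sigma>' 13 = cell \<sigma> 13 \<Longrightarrow> hist_ok n \<sigma>' = hist_ok n \<sigma>"
  by (simp only: hist_ok_def nbs_def hist_cong[of \<sigma>' \<sigma>])

lemma add_edge_static: "loop_free add_edge" "ctame add_edge"
  by (simp_all add: add_edge_def tame_def)

text \<open>Each endpoint is written just behind the current end of the other's list. By
  \<open>pair_index_inj\<close> these writes hit neither another list nor another matrix entry, and
  the lists stay distinct because the edge is new.\<close>

lemma add_edge_spec:
  assumes "scalar \<sigma> 2 = n + 2" "scalar \<sigma> 22 = u" "scalar \<sigma> 23 = w" "u < n" "w < n" "u \<noteq> w"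
    and ok: "hist_ok n \<sigma>" and new: "\<not> hist n \<sigma> u w"
    and "cell \<sigma> 14 u \<le> n" "cell \<sigma> 14 w \<le> n" "n + 2 < B"
  defines "\<sigma>' \<equiv> run add_edge \<sigma>"
  shows "small B add_edge \<sigma>" (is ?small)
    and "hist n \<sigma>' x y \<longleftrightarrow> hist n \<sigma> x y \<or> x = u \<and> y = w \<or> x = w \<and> y = u" (is ?hist)
    and "hist_ok n \<sigma>'" (is ?ok)
    and "cell \<sigma>' 14 = (cell \<sigma> 14)(u := cell \<sigma> 14 u + 1, w := cell \<sigma> 14 w + 1)" (is ?deg)
    and "scalar \<sigma>' = scalar \<sigma>" (is ?scalar)
    and "a \<notin> {3, 12, 13, 14} \<Longrightarrow> cell \<sigma>' a = cell \<sigma> a" (is "_ \<Longrightarrow> ?frame")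
proof -
  let ?N = "n + 2"
  let ?c = "cell \<sigma> 12"
  note h = assms(1-3)
  have le: "?c u \<le> n" "?c w \<le> n"
    using hist_ok_count[OF ok] card_hist_le assms(4,5) by metis+
  show ?small using le assms(4-6,9-11) by (simp add: add_edge_def h)
  have c3: "cell \<sigma>' 3 = (cell \<sigma> 3)(u * ?N + w := 1, w * ?N + u := 1)"
    and c12: "cell \<sigma>' 12 = ?c(u := ?c u + 1, w := ?c w + 1)"
    and c13: "cell \<sigma>' 13 = (cell \<sigma> 13)(?c u * ?N + u := w, ?c w * ?N + w := u)"
    using assms(6) by (simp_all add: \<sigma>'_def add_edge_def h)
  show ?deg ?scalar using assms(6) by (simp_all add: \<sigma>'_def add_edge_def h)
  show ?frame if "a \<notin> {3, 12, 13, 14}" using that by (simp add: \<sigma>'_def add_edge_def h)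
  have hist': "hist n \<sigma>' x y \<longleftrightarrow> hist n \<sigma> x y \<or> x = u \<and> y = w \<or> x = w \<and> y = u" for x y
    using assms(4,5) pair_index_inj[of y ?N w x u] pair_index_inj[of y ?N u x w]
    by (auto simp: hist_def c3)
  then show ?hist .
  have nw: "\<not> hist n \<sigma> w u" using ok new by (auto simp: hist_ok_def)
  have nbs': "nbs n \<sigma>' x = (if x = u then nbs n \<sigma> u @ [w] else if x = w then nbs n \<sigma> w @ [u] else nbs n \<sigma> x)"
    if "x < n" for x
  proof -
    define N where "N = n + 2"
    have "k * N + x = k' * N + y \<longleftrightarrow> k = k' \<and> x = y" if "y < n" for k k' y
      using pair_index_inj[of x N y k k'] \<open>x < n\<close> that by (simp add: N_def)
    moreover have "0 < N" by (simp add: N_def)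
    ultimately show ?thesis using assms(4-6) unfolding nbs_def c12 c13 N_def[symmetric] by auto
  qed
  show ?ok unfolding hist_ok_def
  proof (intro conjI allI impI)
    fix x assume x: "x < n"
    have "distinct (nbs n \<sigma> z)" "set (nbs n \<sigma> z) = Collect (hist n \<sigma> z)" if "z < n" for z
      using ok that unfolding hist_ok_def by blast+
    note this[OF x] this[OF assms(4)] this[OF assms(5)]
    moreover have "Collect (hist n \<sigma>' x) = Collect (hist n \<sigma> x) \<union> (if x = u then {w} else if x = w then {u} else {})"
      using assms(6) by (auto simp: hist')
    ultimately show "distinct (nbs n \<sigma>' x)" "set (nbs n \<sigma>' x) = Collect (hist n \<sigma>' x)"
      using new nw assms(6) unfolding nbs'[OF x] by simp_all
  next
    fix x y assume "hist n \<sigma>' x y"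
    moreover have "hist n \<sigma> x y \<Longrightarrow> x \<noteq> y \<and> hist n \<sigma> y x" using ok unfolding hist_ok_def by blast
    ultimately show "x \<noteq> y" "hist n \<sigma>' y x" using assms(6) unfolding hist' by blast+
  qed
qed

text \<open>
  Nodes 0 and 2 represent the empty set, node 1 stands for infeasibility. The offset makes the initial
  content 0 of the memory a correct table of an empty piece at two nonadjacent vertices:
  the empty set is a partial solution exactly if both states are 0 or 3.
\<close>

definition off :: "nat \<Rightarrow> nat \<Rightarrow> nat" where
  "off i j = (if (i = 0 \<or> i = 3) \<and> (j = 0 \<or> j = 3) then 0 else 1)"

definition entry :: "state \<Rightarrow> nat \<Rightarrow> nat \<Rightarrow> nat \<Rightarrow> nat" where
  "entry \<sigma> base i j = cell \<sigma> 4 (base + (4 * i + j)) + off i j"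

definition entry_exp :: "nat \<Rightarrow> nat \<Rightarrow> nat \<Rightarrow> exp" where
  "entry_exp x i j = Bin Plus (Read 4 (Bin Plus (Var x) (Const (4 * i + j)))) (Const (off i j))"

lemma eval_entry_exp [simp]: "eval \<sigma> (entry_exp x i j) = entry \<sigma> (scalar \<sigma> x) i j"
  by (simp add: entry_exp_def entry_def)

lemma entry_scalar [simp]: "entry (\<sigma>\<lparr>scalar := f\<rparr>) = entry \<sigma>"
  by (simp add: entry_def fun_eq_iff)

type_synonym tuple = "(nat \<times> nat) \<times> (nat \<times> nat) \<times> (nat \<times> nat \<times> nat)"

text \<open>
  The pairs and triples of states that satisfy compat and closes, listed explicitly since the program is
  unrolled over them.
\<close>

definition splits :: "(nat \<times> nat) list" where
  "splits = [(0,0), (0,1), (0,2), (1,0), (1,1), (2,0), (3,3)]"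

definition closings :: "(nat \<times> nat \<times> nat) list" where
  "closings = [(3,3,3), (0,0,1), (0,1,0), (1,0,0), (0,0,2), (0,2,0), (2,0,0), (0,1,1), (1,0,1), (1,1,0)]"

definition tuples :: "tuple list" where
  "tuples = List.product splits (List.product splits closings)"

lemma compat_iff_splits: "compat i j \<longleftrightarrow> (i, j) \<in> set splits"
proof
  assume "compat i j"
  then have "i = 3 \<and> j = 3 \<or> i = 0 \<and> (j = 0 \<or> j = 1 \<or> j = 2) \<or> i = 1 \<and> (j = 0 \<or> j = 1) \<or> i = 2 \<and> j = 0"
    unfolding compat_def by arith
  then show "(i, j) \<in> set splits" by (auto simp: splits_def)
qed (auto simp: compat_def splits_def)

lemma closes_iff_closings: "closes p q u \<longleftrightarrow> (p, q, u) \<in> set closings"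
proof
  assume "closes p q u"
  then consider "p = 3 \<and> q = 3 \<and> u = 3" | "p + q + u = 1" | "p + q + u = 2" by (auto simp: closes_def)
  then show "(p, q, u) \<in> set closings"
  proof cases
    case 2
    then have "p = 0 \<and> q = 0 \<and> u = 1 \<or> p = 0 \<and> q = 1 \<and> u = 0 \<or> p = 1 \<and> q = 0 \<and> u = 0" by arith
    then show ?thesis by (auto simp: closings_def)
  next
    case 3
    then have "p = 0 \<or> p = 1 \<or> p = 2" "q = 0 \<or> q = 1 \<or> q = 2" "u = 2 - p - q" by linarith+
    then show ?thesis using 3 by (elim disjE) (simp_all add: closings_def)
  qed (auto simp: closings_def)
qed (auto simp: closes_def closings_def)

lemma set_tuples: "((i1, i2), (j1, j2), (p, q, u)) \<in> set tuples \<longleftrightarrow> compat i1 i2 \<and> compat j1 j2 \<and> closes p q u"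
  by (simp add: tuples_def compat_iff_splits closes_iff_closings)

text \<open>7 * 7 * 10. This is also the number of nodes that one elimination may create.\<close>

lemma length_tuples: "length tuples = 490"
  by (simp add: tuples_def splits_def closings_def)

fun slot :: "tuple \<Rightarrow> nat" where
  "slot ((i1, i2), (j1, j2), (p, q, u)) = 4 * join i1 i2 + join j1 j2"

text \<open>As in shortest path algorithms, a candidate becomes a node only if it is strictly
  cheaper than the best one of its slot. Superseded nodes stay in memory; the constant number of
  tuples limits their number.\<close>

fun relax :: "tuple \<Rightarrow> cmd" where
  "relax ((i1, i2), (j1, j2), (p, q, u)) = seqs
    [Assign 18 (entry_exp 11 i1 j1), Assign 19 (entry_exp 13 p i2),
     Assign 20 (entry_exp 14 q j2), Assign 21 (entry_exp 15 u 0),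
     Assign 17 (Bin Plus (Bin Plus (Bin Plus (Bin Plus (Read 5 (Var 18)) (Read 5 (Var 19)))
       (Read 5 (Var 20))) (Read 5 (Var 21))) (Const (if p = 3 then 1 else 0))),
     Cond (Bin Less (Var 17) (Read 5 (Read 17 (Const (4 * join i1 i2 + join j1 j2)))))
       (seqs [Write 5 (Var 16) (Var 17), Write 6 (Var 16) (Var 18), Write 7 (Var 16) (Var 19),
         Write 8 (Var 16) (Var 20), Write 9 (Var 16) (Var 21),
         Write 10 (Var 16) (if p = 3 then inc (Var 4) else Const 0),
         Write 17 (Const (4 * join i1 i2 + join j1 j2)) (Var 16), Assign 16 (inc (Var 16))])
       Skip]"

fun children :: "state \<Rightarrow> tuple \<Rightarrow> nat \<times> nat \<times> nat \<times> nat" where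
  "children \<sigma> ((i1, i2), (j1, j2), (p, q, u)) =
    (entry \<sigma> (scalar \<sigma> 11) i1 j1, entry \<sigma> (scalar \<sigma> 13) p i2, entry \<sigma> (scalar \<sigma> 14) q j2, entry \<sigma> (scalar \<sigma> 15) u 0)"

fun takes :: "tuple \<Rightarrow> bool" where
  "takes ((i1, i2), (j1, j2), (p, q, u)) \<longleftrightarrow> p = 3"

definition price :: "state \<Rightarrow> tuple \<Rightarrow> nat" where
  "price \<sigma> t = (case children \<sigma> t of (x0, x1, x2, x3) \<Rightarrow>
     cell \<sigma> 5 x0 + cell \<sigma> 5 x1 + cell \<sigma> 5 x2 + cell \<sigma> 5 x3 + (if takes t then 1 else 0))"

definition gather :: "state \<Rightarrow> (nat \<Rightarrow> nat set) \<Rightarrow> tuple \<Rightarrow> nat set" where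
  "gather \<sigma> P t = (case children \<sigma> t of (x0, x1, x2, x3) \<Rightarrow>
     P x0 \<union> P x1 \<union> P x2 \<union> P x3 \<union> (if takes t then {scalar \<sigma> 4} else {}))"

text \<open>
  P maps nodes to the sets they represent. Size n + 1 of the infeasible node exceeds all
  sizes of feasible ones, so infeasible candidates are never taken.
\<close>

definition store_ok :: "nat \<Rightarrow> state \<Rightarrow> (nat \<Rightarrow> nat set) \<Rightarrow> bool" where
  "store_ok n \<sigma> P \<longleftrightarrow> 3 \<le> scalar \<sigma> 16 \<and> cell \<sigma> 5 0 = 0 \<and> cell \<sigma> 5 1 = n + 1 \<and> cell \<sigma> 5 2 = 0 \<and>
     P 0 = {} \<and> P 1 = {} \<and> P 2 = {} \<and> (\<forall>p < scalar \<sigma> 16. cell \<sigma> 5 p \<le> n + 1) \<and>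
     (\<forall>p. 3 \<le> p \<and> p < scalar \<sigma> 16 \<longrightarrow>
        cell \<sigma> 6 p < p \<and> cell \<sigma> 7 p < p \<and> cell \<sigma> 8 p < p \<and> cell \<sigma> 9 p < p \<and> cell \<sigma> 10 p \<le> n \<and>
        P p = P (cell \<sigma> 6 p) \<union> P (cell \<sigma> 7 p) \<union> P (cell \<sigma> 8 p) \<union> P (cell \<sigma> 9 p) \<union>
          (if cell \<sigma> 10 p = 0 then {} else {cell \<sigma> 10 p - 1}))"

text \<open>Prices and gathered sets always refer to the start state \<open>\<sigma>0\<close>, which
  makes sense since old nodes keep their sizes and their sets. \<open>Q k\<close> is the property
  required of a feasible set in slot \<open>k\<close>. Slot contents are positive, so that the
  offset can later be subtracted without truncation.\<close>

definition relaxed :: "nat \<Rightarrow> state \<Rightarrow> (nat \<Rightarrow> nat set) \<Rightarrow> (nat \<Rightarrow> nat set \<Rightarrow> bool) \<Rightarrow> tuple list \<Rightarrow> state \<Rightarrow> bool" where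
  "relaxed n \<sigma>0 P0 Q ts \<sigma> \<longleftrightarrow>
     (\<forall>a. a \<notin> {5, 6, 7, 8, 9, 10, 17} \<longrightarrow> cell \<sigma> a = cell \<sigma>0 a) \<and>
     (\<forall>x. x \<notin> {16, 17, 18, 19, 20, 21} \<longrightarrow> scalar \<sigma> x = scalar \<sigma>0 x) \<and>
     scalar \<sigma>0 16 \<le> scalar \<sigma> 16 \<and> scalar \<sigma> 16 \<le> scalar \<sigma>0 16 + length ts \<and>
     (\<exists>P. store_ok n \<sigma> P \<and> (\<forall>p < scalar \<sigma>0 16. P p = P0 p \<and> cell \<sigma> 5 p = cell \<sigma>0 5 p) \<and>
        (\<forall>k < 16. let p = cell \<sigma> 17 k in
           0 < p \<and> p < scalar \<sigma> 16 \<and> (cell \<sigma> 5 p \<le> n \<longrightarrow> Q k (P p) \<and> card (P p) = cell \<sigma> 5 p)) \<and>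
        (\<forall>t \<in> set ts. cell \<sigma> 5 (cell \<sigma> 17 (slot t)) \<le> price \<sigma>0 t))"

lemma slot_less: "t \<in> set tuples \<Longrightarrow> slot t < 16"
proof (cases t rule: slot.cases)
  case (1 i1 i2 j1 j2 p q u)
  assume "t \<in> set tuples"
  then have "join i1 i2 < 4" "join j1 j2 < 4" using compat_less by (auto simp: 1 set_tuples)
  then show ?thesis by (simp add: 1)
qed

lemma relax_run:
  assumes "children \<sigma> t = (x0, x1, x2, x3)"
  shows "run (relax t) \<sigma> =
    (let \<sigma>1 = \<sigma>\<lparr>scalar := (scalar \<sigma>)(18 := x0, 19 := x1, 20 := x2, 21 := x3, 17 := price \<sigma> t)\<rparr>
     in if price \<sigma> t < cell \<sigma> 5 (cell \<sigma> 17 (slot t))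
        then \<sigma>1\<lparr>scalar := (scalar \<sigma>1)(16 := scalar \<sigma> 16 + 1),
           cell := (cell \<sigma>)(5 := (cell \<sigma> 5)(scalar \<sigma> 16 := price \<sigma> t),
             6 := (cell \<sigma> 6)(scalar \<sigma> 16 := x0), 7 := (cell \<sigma> 7)(scalar \<sigma> 16 := x1),
             8 := (cell \<sigma> 8)(scalar \<sigma> 16 := x2), 9 := (cell \<sigma> 9)(scalar \<sigma> 16 := x3),
             10 := (cell \<sigma> 10)(scalar \<sigma> 16 := if takes t then scalar \<sigma> 4 + 1 else 0),
             17 := (cell \<sigma> 17)(slot t := scalar \<sigma> 16))\<rparr>
        else \<sigma>1)"
  using assms
  by (cases t rule: slot.cases)
    (auto simp: price_def Let_def)

lemma relax_small:
  assumes "children \<sigma> t = (x0, x1, x2, x3)" "x0 < B" "x1 < B" "x2 < B" "x3 < B" "price \<sigma> t < B"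
    "scalar \<sigma> 16 + 1 < B" "scalar \<sigma> 4 + 1 < B"
  shows "small B (relax t) \<sigma>"
  using assms
  by (cases t rule: slot.cases)
    (auto simp: price_def Let_def)

lemma relax_static: "t \<in> set tuples \<Longrightarrow> loop_free (relax t) \<and> ctame (relax t)"
proof (cases t rule: slot.cases)
  case (1 i1 i2 j1 j2 p q u)
  assume "t \<in> set tuples"
  then have "compat i1 i2" "compat j1 j2" "closes p q u" by (simp_all add: 1 set_tuples)
  note compat_less[OF this(1)] compat_less[OF this(2)] closes_less[OF this(3)]
  then show ?thesis by (simp add: 1 entry_exp_def tame_def off_def)
qed

lemma relax_step:
  assumes R: "relaxed n \<sigma>0 P0 Q ts \<sigma>" and t: "t \<in> set tuples" "set ts \<subseteq> set tuples"
    and ch: "children \<sigma>0 t = (x0, x1, x2, x3)"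
      "x0 < scalar \<sigma>0 16" "x1 < scalar \<sigma>0 16" "x2 < scalar \<sigma>0 16" "x3 < scalar \<sigma>0 16"
    and ok0: "\<And>p. p < scalar \<sigma>0 16 \<Longrightarrow> cell \<sigma>0 5 p \<le> n + 1"
    and B: "scalar \<sigma>0 16 + length ts + 1 < B" "4 * n + 5 < B" "scalar \<sigma>0 4 < n"
    and good: "price \<sigma>0 t \<le> n \<Longrightarrow> Q (slot t) (gather \<sigma>0 P0 t) \<and> card (gather \<sigma>0 P0 t) = price \<sigma>0 t"
  shows "small B (relax t) \<sigma>" "relaxed n \<sigma>0 P0 Q (ts @ [t]) (run (relax t) \<sigma>)"
proof -
  let ?np = "scalar \<sigma> 16" and ?m = "scalar \<sigma>0 16"
  obtain P where
    fr: "\<And>a. a \<notin> {5, 6, 7, 8, 9, 10, 17} \<Longrightarrow> cell \<sigma> a = cell \<sigma>0 a"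
      "\<And>x. x \<notin> {16, 17, 18, 19, 20, 21} \<Longrightarrow> scalar \<sigma> x = scalar \<sigma>0 x"
    and np: "?m \<le> ?np" "?np \<le> ?m + length ts"
    and st: "store_ok n \<sigma> P" and old: "\<And>p. p < ?m \<Longrightarrow> P p = P0 p \<and> cell \<sigma> 5 p = cell \<sigma>0 5 p"
    and tmp: "\<And>k. k < 16 \<Longrightarrow> 0 < cell \<sigma> 17 k \<and> cell \<sigma> 17 k < ?np \<and>
       (cell \<sigma> 5 (cell \<sigma> 17 k) \<le> n \<longrightarrow> Q k (P (cell \<sigma> 17 k)) \<and> card (P (cell \<sigma> 17 k)) = cell \<sigma> 5 (cell \<sigma> 17 k))"
    and best: "\<And>t. t \<in> set ts \<Longrightarrow> cell \<sigma> 5 (cell \<sigma> 17 (slot t)) \<le> price \<sigma>0 t"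
    using R unfolding relaxed_def Let_def by blast
  have ch': "children \<sigma> t = (x0, x1, x2, x3)"
    using ch(1) fr by (cases t rule: slot.cases) (simp add: entry_def)
  have price: "price \<sigma> t = price \<sigma>0 t"
    using ch ch' old by (simp add: price_def)
  \<comment> \<open>Four sizes of at most \<open>n + 1\<close> each, and 1 for the eliminated
    vertex.\<close>
  have price_le: "price \<sigma>0 t \<le> 4 * n + 5"
    using ok0[OF ch(2)] ok0[OF ch(3)] ok0[OF ch(4)] ok0[OF ch(5)] ch(1) by (simp add: price_def)
  have v: "scalar \<sigma> 4 = scalar \<sigma>0 4" using fr by simp
  show "small B (relax t) \<sigma>"
    by (rule relax_small[OF ch']) (use ch np B price price_le v in auto)
  let ?s = "slot t"
  have s: "?s < 16" using t(1) by (rule slot_less)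
  let ?\<sigma>' = "run (relax t) \<sigma>"
  have np3: "3 \<le> ?np" using st by (simp add: store_ok_def)
  show "relaxed n \<sigma>0 P0 Q (ts @ [t]) ?\<sigma>'"
  proof (cases "price \<sigma>0 t < cell \<sigma> 5 (cell \<sigma> 17 ?s)")
    case False
    then have r: "?\<sigma>' = \<sigma>\<lparr>scalar := (scalar \<sigma>)(18 := x0, 19 := x1, 20 := x2, 21 := x3, 17 := price \<sigma>0 t)\<rparr>"
      using relax_run[OF ch'] price by (simp add: Let_def)
    show ?thesis unfolding relaxed_def
    proof (intro conjI exI[of _ P])
      show "store_ok n ?\<sigma>' P" using st unfolding r by (simp add: store_ok_def)
      show "\<forall>k<16. let p = cell ?\<sigma>' 17 k in 0 < p \<and> p < scalar ?\<sigma>' 16 \<and>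
          (cell ?\<sigma>' 5 p \<le> n \<longrightarrow> Q k (P p) \<and> card (P p) = cell ?\<sigma>' 5 p)"
        using tmp unfolding r by (simp add: Let_def)
      show "\<forall>t\<in>set (ts @ [t]). cell ?\<sigma>' 5 (cell ?\<sigma>' 17 (slot t)) \<le> price \<sigma>0 t"
        using best False unfolding r by auto
    qed (use fr np old r in auto)
  next
    case True
    define P' where "P' = P(?np := gather \<sigma>0 P0 t)"
    have r: "scalar ?\<sigma>' = (scalar \<sigma>)(18 := x0, 19 := x1, 20 := x2, 21 := x3, 17 := price \<sigma>0 t, 16 := ?np + 1)"
      "cell ?\<sigma>' = (cell \<sigma>)(5 := (cell \<sigma> 5)(scalar \<sigma> 16 := price \<sigma>0 t),
             6 := (cell \<sigma> 6)(scalar \<sigma> 16 := x0), 7 := (cell \<sigma> 7)(scalar \<sigma> 16 := x1),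
             8 := (cell \<sigma> 8)(scalar \<sigma> 16 := x2), 9 := (cell \<sigma> 9)(scalar \<sigma> 16 := x3),
             10 := (cell \<sigma> 10)(scalar \<sigma> 16 := if takes t then scalar \<sigma>0 4 + 1 else 0),
             17 := (cell \<sigma> 17)(slot t := scalar \<sigma> 16))"
      using relax_run[OF ch'] price True v by (simp_all add: Let_def)
    \<comment> \<open>Even an infeasible slot has size only \<open>n + 1\<close>, so a strictly
      cheaper candidate costs at most \<open>n\<close> and \<open>good\<close> applies to
      it.\<close>
    have "cell \<sigma> 5 (cell \<sigma> 17 ?s) \<le> n + 1" using tmp[OF s] st by (simp add: store_ok_def)
    then have le: "price \<sigma>0 t \<le> n" using True by simp
    note Q = good[OF this]
    have g: "gather \<sigma>0 P0 t = P x0 \<union> P x1 \<union> P x2 \<union> P x3 \<union> (if takes t then {scalar \<sigma>0 4} else {})"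
      using old ch by (simp add: gather_def)
    have xs: "x0 < ?np" "x1 < ?np" "x2 < ?np" "x3 < ?np" using ch np by auto
    show ?thesis unfolding relaxed_def
    proof (intro conjI exI[of _ P'])
      show "store_ok n ?\<sigma>' P'"
        unfolding store_ok_def
      proof (intro conjI allI impI)
        fix p assume "3 \<le> p \<and> p < scalar ?\<sigma>' 16"
        then consider "p = ?np" | "3 \<le> p" "p < ?np" unfolding r by fastforce
        then have "cell ?\<sigma>' 6 p < p \<and> cell ?\<sigma>' 7 p < p \<and> cell ?\<sigma>' 8 p < p \<and> cell ?\<sigma>' 9 p < p \<and> cell ?\<sigma>' 10 p \<le> n \<and>
        P' p = P' (cell ?\<sigma>' 6 p) \<union> P' (cell ?\<sigma>' 7 p) \<union> P' (cell ?\<sigma>' 8 p) \<union> P' (cell ?\<sigma>' 9 p) \<union>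
          (if cell ?\<sigma>' 10 p = 0 then {} else {cell ?\<sigma>' 10 p - 1})"
        proof cases
          case 1
          then show ?thesis using xs B(3) g unfolding r P'_def by auto
        next
          case 2
          then have "cell \<sigma> 6 p < p \<and> cell \<sigma> 7 p < p \<and> cell \<sigma> 8 p < p \<and> cell \<sigma> 9 p < p \<and> cell \<sigma> 10 p \<le> n \<and>
          P p = P (cell \<sigma> 6 p) \<union> P (cell \<sigma> 7 p) \<union> P (cell \<sigma> 8 p) \<union> P (cell \<sigma> 9 p) \<union>
          (if cell \<sigma> 10 p = 0 then {} else {cell \<sigma> 10 p - 1})" using st by (simp add: store_ok_def)
          then show ?thesis using 2 unfolding r P'_def by auto
        qed
        then show "cell ?\<sigma>' 6 p < p" "cell ?\<sigma>' 7 p < p" "cell ?\<sigma>' 8 p < p" "cell ?\<sigma>' 9 p < p" "cell ?\<sigma>' 10 p \<le> n"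
          "P' p = P' (cell ?\<sigma>' 6 p) \<union> P' (cell ?\<sigma>' 7 p) \<union> P' (cell ?\<sigma>' 8 p) \<union> P' (cell ?\<sigma>' 9 p) \<union>
          (if cell ?\<sigma>' 10 p = 0 then {} else {cell ?\<sigma>' 10 p - 1})" by blast+
      qed (use st np3 le in \<open>auto simp: r P'_def store_ok_def\<close>)
      show "\<forall>k<16. let p = cell ?\<sigma>' 17 k in 0 < p \<and> p < scalar ?\<sigma>' 16 \<and>
          (cell ?\<sigma>' 5 p \<le> n \<longrightarrow> Q k (P' p) \<and> card (P' p) = cell ?\<sigma>' 5 p)"
      proof (intro allI impI)
        fix k :: nat assume k: "k < 16"
        show "let p = cell ?\<sigma>' 17 k in 0 < p \<and> p < scalar ?\<sigma>' 16 \<and>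
          (cell ?\<sigma>' 5 p \<le> n \<longrightarrow> Q k (P' p) \<and> card (P' p) = cell ?\<sigma>' 5 p)"
          using tmp[OF k] np3 Q unfolding r P'_def Let_def by auto
      qed
      show "\<forall>t\<in>set (ts @ [t]). cell ?\<sigma>' 5 (cell ?\<sigma>' 17 (slot t)) \<le> price \<sigma>0 t"
      proof
        fix t' assume "t' \<in> set (ts @ [t])"
        then consider "slot t' = slot t" "t' \<in> set ts" | "slot t' \<noteq> slot t" "t' \<in> set ts" | "t' = t" by auto
        then show "cell ?\<sigma>' 5 (cell ?\<sigma>' 17 (slot t')) \<le> price \<sigma>0 t'"
        proof cases
          case 2
          \<comment> \<open>The node in another slot is older than the new one, so its size is not
            overwritten.\<close>
          have "cell \<sigma> 17 (slot t') < ?np" using tmp slot_less 2(2) t(2) by blast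
          then show ?thesis using best[OF 2(2)] 2(1) unfolding r by auto
        qed (use best[of t'] True in \<open>auto simp: r\<close>)
      qed
    qed (use fr np old in \<open>auto simp: r P'_def\<close>)
  qed
qed

text \<open>Every slot starts at node 1, the infeasible one.\<close>

definition clear_best :: "nat \<Rightarrow> cmd" where
  "clear_best k = Write 17 (Const k) (Const 1)"

text \<open>Both orientations of the pair are stored, since a later elimination may meet either of
  its ends as the vertex to be deleted. The subtraction undoes the offset of
  \<open>entry\<close>.\<close>

fun store_back :: "nat \<times> nat \<Rightarrow> cmd" where
  "store_back (i, j) = seqs
    [Write 4 (Bin Plus (Var 11) (Const (4 * i + j))) (Bin Minus (Read 17 (Const (4 * i + j))) (Const (off i j))),
     Write 4 (Bin Plus (Var 12) (Const (4 * j + i))) (Bin Minus (Read 17 (Const (4 * i + j))) (Const (off i j)))]"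

definition slots :: "(nat \<times> nat) list" where
  "slots = List.product [0, 1, 2, 3] [0, 1, 2, 3]"

definition combine :: cmd where
  "combine = seqs [seqs (map clear_best [0..<16]), seqs (map relax tuples), seqs (map store_back slots)]"

lemma set_slots: "(i, j) \<in> set slots \<longleftrightarrow> i < 4 \<and> j < 4"
proof -
  have "k \<in> set [0, 1, 2, 3] \<longleftrightarrow> k < 4" for k :: nat
    unfolding list.set insert_iff empty_iff by presburger
  then show ?thesis by (simp only: slots_def set_product mem_Sigma_iff)
qed

lemma off_le: "off i j \<le> 1"
  by (simp add: off_def)

lemma off_commute: "off i j = off j i"
  by (auto simp: off_def)

lemma combine_static: "loop_free combine" "ctame combine"
proof -
  have "loop_free (store_back t) \<and> ctame (store_back t)" if "t \<in> set slots" for t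
  proof -
    obtain i j where t: "t = (i, j)" by fastforce
    then have "i < 4" "j < 4" using that set_slots[of i j] by simp_all
    then show ?thesis by (simp add: t tame_def off_def)
  qed
  then show "loop_free combine" "ctame combine"
    using relax_static by (auto simp: combine_def loop_free_seqs ctame_seqs clear_best_def tame_def)
qed

lemma clear_best_run:
  fixes \<sigma> :: state
  assumes "1 < B"
  defines "\<sigma>' \<equiv> run (seqs (map clear_best [0..<16])) \<sigma>"
  shows "small B (seqs (map clear_best [0..<16])) \<sigma>" "scalar \<sigma>' = scalar \<sigma>"
    "a \<noteq> 17 \<Longrightarrow> cell \<sigma>' a = cell \<sigma> a" "k < 16 \<Longrightarrow> cell \<sigma>' 17 k = 1"
proof -
  define I where "I ts \<rho> \<longleftrightarrow> scalar \<rho> = scalar \<sigma> \<and> (\<forall>a. a \<noteq> 17 \<longrightarrow> cell \<rho> a = cell \<sigma> a) \<and>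
    (\<forall>k \<in> set ts. cell \<rho> 17 k = 1)" for ts and \<rho> :: state
  have "small B (seqs (map clear_best [0..<16])) \<sigma> \<and> I [0..<16] \<sigma>'"
    unfolding \<sigma>'_def
    by (rule run_seqs_invariant[of I]) (use assms(1) in \<open>auto simp: I_def clear_best_def\<close>)
  then show "small B (seqs (map clear_best [0..<16])) \<sigma>" "scalar \<sigma>' = scalar \<sigma>"
    "a \<noteq> 17 \<Longrightarrow> cell \<sigma>' a = cell \<sigma> a" "k < 16 \<Longrightarrow> cell \<sigma>' 17 k = 1"
    by (auto simp: I_def)
qed

lemma slot_inj: "j < 4 \<Longrightarrow> j' < 4 \<Longrightarrow> 4 * i + j = 4 * i' + j' \<longleftrightarrow> i = i' \<and> j = (j'::nat)"
  using pair_index_inj[of j 4 j' i i'] by (simp add: mult.commute)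

lemma store_back_run:
  assumes apart: "scalar \<sigma> 11 + 16 \<le> scalar \<sigma> 12 \<or> scalar \<sigma> 12 + 16 \<le> scalar \<sigma> 11"
    and tmp': "\<forall>k < 16. 0 < cell \<sigma> 17 k \<and> cell \<sigma> 17 k < B"
  defines "\<sigma>' \<equiv> run (seqs (map store_back slots)) \<sigma>"
  shows "small B (seqs (map store_back slots)) \<sigma>" "scalar \<sigma>' = scalar \<sigma>"
    "a \<noteq> 4 \<Longrightarrow> cell \<sigma>' a = cell \<sigma> a"
    "i < 4 \<Longrightarrow> j < 4 \<Longrightarrow> entry \<sigma>' (scalar \<sigma> 11) i j = cell \<sigma> 17 (4 * i + j)"
    "i < 4 \<Longrightarrow> j < 4 \<Longrightarrow> entry \<sigma>' (scalar \<sigma> 12) j i = cell \<sigma> 17 (4 * i + j)"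
    "\<And>d. \<not> (scalar \<sigma> 11 \<le> d \<and> d < scalar \<sigma> 11 + 16) \<Longrightarrow> \<not> (scalar \<sigma> 12 \<le> d \<and> d < scalar \<sigma> 12 + 16) \<Longrightarrow>
      cell \<sigma>' 4 d = cell \<sigma> 4 d"
proof -
  let ?p = "scalar \<sigma> 11" and ?q = "scalar \<sigma> 12"
  have tmp: "0 < cell \<sigma> 17 k \<and> cell \<sigma> 17 k < B" if "k < 16" for k using tmp' that by blast
  define I where "I ts \<rho> \<longleftrightarrow> set ts \<subseteq> set slots \<and> scalar \<rho> = scalar \<sigma> \<and> (\<forall>a. a \<noteq> 4 \<longrightarrow> cell \<rho> a = cell \<sigma> a) \<and>
    (\<forall>i j. (i, j) \<in> set ts \<longrightarrow> cell \<rho> 4 (?p + (4 * i + j)) = cell \<sigma> 17 (4 * i + j) - off i j \<and>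
       cell \<rho> 4 (?q + (4 * j + i)) = cell \<sigma> 17 (4 * i + j) - off i j) \<and>
    (\<forall>d. \<not> (?p \<le> d \<and> d < ?p + 16) \<and> \<not> (?q \<le> d \<and> d < ?q + 16) \<longrightarrow> cell \<rho> 4 d = cell \<sigma> 4 d)" for ts and \<rho> :: state
  have *: "small B (seqs (map store_back slots)) \<sigma> \<and> I slots \<sigma>'"
    unfolding \<sigma>'_def
  proof (rule run_seqs_invariant[of I])
    show "I [] \<sigma>" by (simp add: I_def)
  next
    fix ts t us \<rho> assume sl: "slots = ts @ t # us" and I: "I ts \<rho>"
    obtain i j where t: "t = (i, j)" by (cases t)
    have in_slots: "set (ts @ [t]) \<subseteq> set slots" unfolding sl by auto
    then have ij: "i < 4" "j < 4" using t set_slots[of i j] by auto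
    define k where "k = 4 * i + j"
    define l where "l = 4 * j + i"
    define w where "w = cell \<sigma> 17 k - off i j"
    have kl: "k < 16" "l < 16" using ij by (simp_all add: k_def l_def)
    have h: "scalar \<rho> = scalar \<sigma>" "cell \<rho> 17 = cell \<sigma> 17" using I by (simp_all add: I_def)
    have r: "run (store_back t) \<rho> = \<rho>\<lparr>cell := (cell \<rho>)(4 := (cell \<rho> 4)(?p + k := w, ?q + l := w))\<rparr>"
      by (simp add: t h k_def l_def w_def)
    have "w < B" using tmp[OF kl(1)] by (simp add: w_def less_imp_diff_less)
    then have sm: "small B (store_back t) \<rho>" by (simp add: t h k_def l_def w_def)
    have ne: "?p + k \<noteq> ?q + l" using apart kl by auto
    have inside: "i' < 4 \<and> j' < 4" if "(i', j') \<in> set ts" for i' j' using that in_slots set_slots[of i' j'] by auto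
    have "I (ts @ [t]) (run (store_back t) \<rho>)"
      unfolding I_def
    proof (intro conjI allI impI)
      show "set (ts @ [t]) \<subseteq> set slots" by (fact in_slots)
      show "scalar (run (store_back t) \<rho>) = scalar \<sigma>" by (simp add: r h)
      fix a :: nat assume "a \<noteq> 4"
      then show "cell (run (store_back t) \<rho>) a = cell \<sigma> a" using I by (simp add: r I_def)
    next
      fix i' j' assume "(i', j') \<in> set (ts @ [t])"
      then consider "i' = i" "j' = j" | "(i', j') \<in> set ts" "(i', j') \<noteq> (i, j)" by (auto simp: t)
      then have "cell (run (store_back t) \<rho>) 4 (?p + (4 * i' + j')) = cell \<sigma> 17 (4 * i' + j') - off i' j' \<and>
        cell (run (store_back t) \<rho>) 4 (?q + (4 * j' + i')) = cell \<sigma> 17 (4 * i' + j') - off i' j'"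
      proof cases
        case 1
        then show ?thesis using ne by (simp add: r w_def k_def l_def)
      next
        case 2
        have i': "i' < 4" "j' < 4" using inside[OF 2(1)] by auto
        then have "4 * i' + j' \<noteq> k" "4 * j' + i' \<noteq> l"
          using 2(2) slot_inj[of j' j i' i] slot_inj[of i' i j' j] ij by (auto simp: k_def l_def)
        moreover have "?p + (4 * i' + j') \<noteq> ?q + l" "?q + (4 * j' + i') \<noteq> ?p + k" using apart kl i' by auto
        moreover have "cell \<rho> 4 (?p + (4 * i' + j')) = cell \<sigma> 17 (4 * i' + j') - off i' j'"
          "cell \<rho> 4 (?q + (4 * j' + i')) = cell \<sigma> 17 (4 * i' + j') - off i' j'"
          using I 2(1) by (auto simp: I_def)
        ultimately show ?thesis by (simp add: r)
      qed
      then show "cell (run (store_back t) \<rho>) 4 (?p + (4 * i' + j')) = cell \<sigma> 17 (4 * i' + j') - off i' j'"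
        "cell (run (store_back t) \<rho>) 4 (?q + (4 * j' + i')) = cell \<sigma> 17 (4 * i' + j') - off i' j'" by blast+
    next
      fix d assume d: "\<not> (?p \<le> d \<and> d < ?p + 16) \<and> \<not> (?q \<le> d \<and> d < ?q + 16)"
      then have "cell \<rho> 4 d = cell \<sigma> 4 d" using I by (simp add: I_def)
      moreover have "d \<noteq> ?p + k" "d \<noteq> ?q + l" using d kl by auto
      ultimately show "cell (run (store_back t) \<rho>) 4 d = cell \<sigma> 4 d" by (simp add: r)
    qed
    with sm show "small B (store_back t) \<rho> \<and> I (ts @ [t]) (run (store_back t) \<rho>)" by simp
  qed
  then show "small B (seqs (map store_back slots)) \<sigma>" "scalar \<sigma>' = scalar \<sigma>"
    "a \<noteq> 4 \<Longrightarrow> cell \<sigma>' a = cell \<sigma> a"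
    by (auto simp: I_def)
  show "cell \<sigma>' 4 d = cell \<sigma> 4 d" if "\<not> (?p \<le> d \<and> d < ?p + 16)" "\<not> (?q \<le> d \<and> d < ?q + 16)" for d
    using * that by (simp add: I_def)
  assume ij: "i < 4" "j < 4"
  have "off i j \<le> cell \<sigma> 17 (4 * i + j)" using tmp[of "4 * i + j"] ij off_le[of i j] by simp
  moreover have "cell \<sigma>' 4 (?p + (4 * i + j)) = cell \<sigma> 17 (4 * i + j) - off i j"
    "cell \<sigma>' 4 (?q + (4 * j + i)) = cell \<sigma> 17 (4 * i + j) - off i j"
    using * ij set_slots[of i j] by (auto simp: I_def)
  ultimately show "entry \<sigma>' ?p i j = cell \<sigma> 17 (4 * i + j)" "entry \<sigma>' ?q j i = cell \<sigma> 17 (4 * i + j)"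
    by (simp_all add: entry_def off_commute[of j i])
qed

definition valid :: "nat \<Rightarrow> state \<Rightarrow> (nat \<Rightarrow> nat set) \<Rightarrow> (nat set \<Rightarrow> bool) \<Rightarrow> nat \<Rightarrow> bool" where
  "valid n \<sigma> P Q p \<longleftrightarrow> p < scalar \<sigma> 16 \<and> (cell \<sigma> 5 p \<le> n \<longrightarrow> Q (P p) \<and> card (P p) = cell \<sigma> 5 p)"

text \<open>Pure minimisation: the meaning of a slot enters only through an arbitrary
  \<open>Q\<close>. The result says of each entry that it is legitimate and that no tuple of its
  slot is cheaper.\<close>

lemma combine_spec:
  assumes st: "store_ok n \<sigma> P"
    and ch': "\<forall>t \<in> set tuples. case children \<sigma> t of (x0, x1, x2, x3) \<Rightarrow>
      x0 < scalar \<sigma> 16 \<and> x1 < scalar \<sigma> 16 \<and> x2 < scalar \<sigma> 16 \<and> x3 < scalar \<sigma> 16"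
    and B: "scalar \<sigma> 16 + 491 < B" "4 * n + 5 < B" "scalar \<sigma> 4 < n"
    and apart: "scalar \<sigma> 11 + 16 \<le> scalar \<sigma> 12 \<or> scalar \<sigma> 12 + 16 \<le> scalar \<sigma> 11"
    and good': "\<forall>t \<in> set tuples. price \<sigma> t \<le> n \<longrightarrow> Q (slot t) (gather \<sigma> P t) \<and> card (gather \<sigma> P t) = price \<sigma> t"
  defines "\<sigma>' \<equiv> run combine \<sigma>"
  shows "small B combine \<sigma>"
    and "a \<notin> {4, 5, 6, 7, 8, 9, 10, 17} \<Longrightarrow> cell \<sigma>' a = cell \<sigma> a"
    and "x \<notin> {16, 17, 18, 19, 20, 21} \<Longrightarrow> scalar \<sigma>' x = scalar \<sigma> x"
    and "scalar \<sigma> 16 \<le> scalar \<sigma>' 16" "scalar \<sigma>' 16 \<le> scalar \<sigma> 16 + 490"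
    and "\<And>d. \<not> (scalar \<sigma> 11 \<le> d \<and> d < scalar \<sigma> 11 + 16) \<Longrightarrow> \<not> (scalar \<sigma> 12 \<le> d \<and> d < scalar \<sigma> 12 + 16) \<Longrightarrow>
      cell \<sigma>' 4 d = cell \<sigma> 4 d"
    and "\<exists>P'. store_ok n \<sigma>' P' \<and> (\<forall>p < scalar \<sigma> 16. P' p = P p \<and> cell \<sigma>' 5 p = cell \<sigma> 5 p) \<and>
      (\<forall>i < 4. \<forall>j < 4. entry \<sigma>' (scalar \<sigma> 12) j i = entry \<sigma>' (scalar \<sigma> 11) i j \<and>
         valid n \<sigma>' P' (Q (4 * i + j)) (entry \<sigma>' (scalar \<sigma> 11) i j) \<and>
         (\<forall>t \<in> set tuples. slot t = 4 * i + j \<longrightarrow> cell \<sigma>' 5 (entry \<sigma>' (scalar \<sigma> 11) i j) \<le> price \<sigma> t))"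
proof -
  have ch: "x0 < scalar \<sigma> 16 \<and> x1 < scalar \<sigma> 16 \<and> x2 < scalar \<sigma> 16 \<and> x3 < scalar \<sigma> 16"
    if "t \<in> set tuples" "children \<sigma> t = (x0, x1, x2, x3)" for t x0 x1 x2 x3
    using bspec[OF ch' that(1)] that(2) by simp
  have good: "Q (slot t) (gather \<sigma> P t) \<and> card (gather \<sigma> P t) = price \<sigma> t"
    if "t \<in> set tuples" "price \<sigma> t \<le> n" for t using good' that by blast
  define \<sigma>1 where "\<sigma>1 = run (seqs (map clear_best [0..<16])) \<sigma>"
  define \<sigma>2 where "\<sigma>2 = run (seqs (map relax tuples)) \<sigma>1"
  have B1: "1 < B" using B by simp
  note c1 = clear_best_run[OF B1, where \<sigma> = \<sigma>, folded \<sigma>1_def]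
  have eq1: "children \<sigma>1 t = children \<sigma> t" "price \<sigma>1 t = price \<sigma> t" "gather \<sigma>1 P t = gather \<sigma> P t" for t
  proof -
    show "children \<sigma>1 t = children \<sigma> t" by (cases t rule: slot.cases) (simp add: entry_def c1)
    then show "price \<sigma>1 t = price \<sigma> t" "gather \<sigma>1 P t = gather \<sigma> P t" by (simp_all add: price_def gather_def c1)
  qed
  have st1: "store_ok n \<sigma>1 P" using st unfolding store_ok_def by (simp add: c1)
  have sz: "p < scalar \<sigma>1 16 \<Longrightarrow> cell \<sigma>1 5 p \<le> n + 1" for p using st1 by (simp add: store_ok_def)
  have np3: "3 \<le> scalar \<sigma>1 16" "cell \<sigma>1 5 1 = n + 1" using st1 by (simp_all add: store_ok_def)
  define J where "J ts \<rho> \<longleftrightarrow> set ts \<subseteq> set tuples \<and> relaxed n \<sigma>1 P Q ts \<rho>" for ts \<rho>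
  have "small B (seqs (map relax tuples)) \<sigma>1 \<and> J tuples \<sigma>2"
    unfolding \<sigma>2_def
  proof (rule run_seqs_invariant[of J])
    show "J [] \<sigma>1"
      unfolding J_def relaxed_def using st1 np3 by (auto simp: c1 Let_def intro!: exI[of _ P])
  next
    fix ts t us \<rho> assume tup: "tuples = ts @ t # us" and I: "J ts \<rho>"
    have t: "t \<in> set tuples" unfolding tup by simp
    have "length ts + 1 \<le> 490" using arg_cong[OF tup, of length] by (simp add: length_tuples)
    then have l: "scalar \<sigma>1 16 + length ts + 1 < B" using B(1) by (simp add: c1)
    obtain x0 x1 x2 x3 where x: "children \<sigma>1 t = (x0, x1, x2, x3)" by (metis prod_cases4)
    have lt: "x0 < scalar \<sigma>1 16" "x1 < scalar \<sigma>1 16" "x2 < scalar \<sigma>1 16" "x3 < scalar \<sigma>1 16"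
      using ch[OF t, of x0 x1 x2 x3] x by (simp_all add: eq1 c1)
    have v: "scalar \<sigma>1 4 < n" using B(3) by (simp add: c1)
    have g: "price \<sigma>1 t \<le> n \<Longrightarrow> Q (slot t) (gather \<sigma>1 P t) \<and> card (gather \<sigma>1 P t) = price \<sigma>1 t"
      using good[OF t] by (simp add: eq1)
    have rel: "relaxed n \<sigma>1 P Q ts \<rho>" and sub: "set ts \<subseteq> set tuples" using I by (simp_all add: J_def)
    note relax_step[OF rel t sub x lt sz l B(2) v g]
    then show "small B (relax t) \<rho> \<and> J (ts @ [t]) (run (relax t) \<rho>)"
      using sub t by (simp add: J_def)
  qed
  then have R: "small B (seqs (map relax tuples)) \<sigma>1" "relaxed n \<sigma>1 P Q tuples \<sigma>2" by (simp_all add: J_def)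
  obtain P' where
    fr: "\<And>a. a \<notin> {5, 6, 7, 8, 9, 10, 17} \<Longrightarrow> cell \<sigma>2 a = cell \<sigma>1 a"
      "\<And>x. x \<notin> {16, 17, 18, 19, 20, 21} \<Longrightarrow> scalar \<sigma>2 x = scalar \<sigma>1 x"
    and np: "scalar \<sigma>1 16 \<le> scalar \<sigma>2 16" "scalar \<sigma>2 16 \<le> scalar \<sigma>1 16 + 490"
    and st2: "store_ok n \<sigma>2 P'" and old: "\<And>p. p < scalar \<sigma>1 16 \<Longrightarrow> P' p = P p \<and> cell \<sigma>2 5 p = cell \<sigma>1 5 p"
    and tmp: "\<And>k. k < 16 \<Longrightarrow> 0 < cell \<sigma>2 17 k \<and> cell \<sigma>2 17 k < scalar \<sigma>2 16 \<and>
       (cell \<sigma>2 5 (cell \<sigma>2 17 k) \<le> n \<longrightarrow> Q k (P' (cell \<sigma>2 17 k)) \<and> card (P' (cell \<sigma>2 17 k)) = cell \<sigma>2 5 (cell \<sigma>2 17 k))"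
    and best: "\<And>t. t \<in> set tuples \<Longrightarrow> cell \<sigma>2 5 (cell \<sigma>2 17 (slot t)) \<le> price \<sigma>1 t"
    using R(2) unfolding relaxed_def Let_def length_tuples by blast
  have sc: "scalar \<sigma>2 11 = scalar \<sigma> 11" "scalar \<sigma>2 12 = scalar \<sigma> 12" by (simp_all add: fr c1)
  have apart2: "scalar \<sigma>2 11 + 16 \<le> scalar \<sigma>2 12 \<or> scalar \<sigma>2 12 + 16 \<le> scalar \<sigma>2 11"
    using apart by (simp add: sc)
  have tmpB: "\<forall>k < 16. 0 < cell \<sigma>2 17 k \<and> cell \<sigma>2 17 k < B"
    using tmp np B(1) by (fastforce simp: c1)
  have \<sigma>': "\<sigma>' = run (seqs (map store_back slots)) \<sigma>2"
    by (simp add: \<sigma>'_def combine_def \<sigma>2_def \<sigma>1_def)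
  note c3 = store_back_run[OF apart2 tmpB, folded \<sigma>', unfolded sc]
  show "small B combine \<sigma>"
    using c1(1) R(1) c3(1) by (simp add: combine_def \<sigma>1_def \<sigma>2_def)
  show "cell \<sigma>' a = cell \<sigma> a" if "a \<notin> {4, 5, 6, 7, 8, 9, 10, 17}" for a
    using that c3(3)[of a] fr(1)[of a] c1(3)[of a] by simp
  show "scalar \<sigma>' x = scalar \<sigma> x" if "x \<notin> {16, 17, 18, 19, 20, 21}" for x
    using that c3(2) fr(2)[of x] c1(2) by simp
  show "scalar \<sigma> 16 \<le> scalar \<sigma>' 16" "scalar \<sigma>' 16 \<le> scalar \<sigma> 16 + 490"
    using np by (simp_all add: c3(2) c1(2))
  show "cell \<sigma>' 4 d = cell \<sigma> 4 d"
    if "\<not> (scalar \<sigma> 11 \<le> d \<and> d < scalar \<sigma> 11 + 16)" "\<not> (scalar \<sigma> 12 \<le> d \<and> d < scalar \<sigma> 12 + 16)" for d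
    using c3(6)[OF that] fr(1)[of 4] c1(3)[of 4] by simp
  show "\<exists>P'. store_ok n \<sigma>' P' \<and> (\<forall>p < scalar \<sigma> 16. P' p = P p \<and> cell \<sigma>' 5 p = cell \<sigma> 5 p) \<and>
      (\<forall>i < 4. \<forall>j < 4. entry \<sigma>' (scalar \<sigma> 12) j i = entry \<sigma>' (scalar \<sigma> 11) i j \<and>
         valid n \<sigma>' P' (Q (4 * i + j)) (entry \<sigma>' (scalar \<sigma> 11) i j) \<and>
         (\<forall>t \<in> set tuples. slot t = 4 * i + j \<longrightarrow> cell \<sigma>' 5 (entry \<sigma>' (scalar \<sigma> 11) i j) \<le> price \<sigma> t))"
  proof (intro exI[of _ P'] conjI allI impI ballI)
    show "store_ok n \<sigma>' P'" using st2 unfolding store_ok_def by (simp add: c3)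
    fix i j :: nat assume ij: "i < 4" "j < 4"
    then have k: "4 * i + j < 16" by simp
    show "entry \<sigma>' (scalar \<sigma> 12) j i = entry \<sigma>' (scalar \<sigma> 11) i j" using c3(4,5) ij by simp
    show "valid n \<sigma>' P' (Q (4 * i + j)) (entry \<sigma>' (scalar \<sigma> 11) i j)"
      using tmp[OF k] c3(2,3) c3(4)[OF ij] by (simp add: valid_def)
    fix t assume "t \<in> set tuples" "slot t = 4 * i + j"
    then show "cell \<sigma>' 5 (entry \<sigma>' (scalar \<sigma> 11) i j) \<le> price \<sigma> t"
      using best[of t] c3(3) c3(4)[OF ij] by (simp add: eq1)
  qed (use old c1 c3 in auto)
qed

section \<open>Ownership of eliminated vertices\<close>

text \<open>
  The function h assigns to each eliminated vertex the pair at which its piece is attached. The dummies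
  are n and n + 1: the pieces at a single vertex x are those of {x, n + 1}, a finished component belongs
  to {n, n + 1}, and no piece is attached at {x, n} for a vertex x.
\<close>

definition pieces :: "nat \<Rightarrow> nat set \<Rightarrow> (nat \<Rightarrow> nat set) \<Rightarrow> nat \<Rightarrow> nat \<Rightarrow> nat set" where
  "pieces n L h x y = {d. d < n \<and> d \<notin> L \<and> h d = {x, y}}"

definition edges_below :: "nat \<Rightarrow> nat set set \<Rightarrow> bool" where
  "edges_below n E \<longleftrightarrow> (\<forall>u w. {u, w} \<in> E \<longrightarrow> u < n \<and> w < n \<and> u \<noteq> w)"

text \<open>The clause on neighbours expresses separation: from an eliminated vertex, edges lead
  only into its own piece or to live vertices of its owner pair. The graph \<open>A\<close> contains
  the edges created by \<open>fill\<close>, which may serve as owner pairs although they need not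
  belong to \<open>E\<close>.\<close>

definition owners :: "nat \<Rightarrow> nat set set \<Rightarrow> nat set \<Rightarrow> (nat \<Rightarrow> nat \<Rightarrow> bool) \<Rightarrow> (nat \<Rightarrow> nat set) \<Rightarrow> bool" where
  "owners n E L A h \<longleftrightarrow> L \<subseteq> {..<n} \<and>
     (\<forall>d<n. d \<notin> L \<longrightarrow> (\<exists>x. x \<in> L \<union> {n} \<and> (h d = {x, n + 1} \<or> (\<exists>y. A x y \<and> h d = {x, y})))) \<and>
     (\<forall>d<n. d \<notin> L \<longrightarrow> (\<forall>w \<in> nbh E d. if w \<in> L then w \<in> h d else h w = h d)) \<and>
     (\<forall>x y. x \<in> L \<longrightarrow> y \<in> L \<longrightarrow> {x, y} \<in> E \<longrightarrow> A x y)"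

definition reown :: "(nat \<Rightarrow> nat set) \<Rightarrow> nat \<Rightarrow> nat set \<Rightarrow> nat \<Rightarrow> nat set" where
  "reown h v p d = (if d = v \<or> v \<in> h d then p else h d)"

context
  fixes n :: nat and E :: "nat set set" and L :: "nat set" and A h a b c v
  assumes E: "edges_below n E" and own: "owners n E L A h" and g: "graph_on L A"
    and v: "v \<in> L" and ab: "Collect (A v) = {a, b} - {n}" "a \<in> L \<union> {n}" "b \<in> L \<union> {n}"
      "a = b \<Longrightarrow> a = n" "a = n \<Longrightarrow> b = n"
    and c: "c = (if b = n then n + 1 else b)"
begin

lemma L_less: "x \<in> L \<Longrightarrow> x < n"
  using own by (auto simp: owners_def)

lemma owner_cases:
  assumes "d < n" "d \<notin> L"
  obtains x where "x \<in> L \<union> {n}" "h d = {x, n + 1}" | x y where "A x y" "h d = {x, y}" "x \<in> L" "y \<in> L" "x \<noteq> y"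
proof -
  have "\<exists>x. x \<in> L \<union> {n} \<and> (h d = {x, n + 1} \<or> (\<exists>y. A x y \<and> h d = {x, y}))"
    using own assms unfolding owners_def by blast
  then show ?thesis using that g unfolding graph_on_def by blast
qed

lemma closed:
  assumes "d < n" "d \<notin> L" "w \<in> nbh E d"
  shows "w \<in> L \<Longrightarrow> w \<in> h d" "w \<notin> L \<Longrightarrow> h w = h d" "w < n"
proof -
  have "if w \<in> L then w \<in> h d else h w = h d" using own assms unfolding owners_def by blast
  then show "w \<in> L \<Longrightarrow> w \<in> h d" "w \<notin> L \<Longrightarrow> h w = h d" by simp_all
  show "w < n" using assms(3) E unfolding edges_below_def nbh_def by blast
qed

lemma nbh_less: "w \<in> nbh E d \<Longrightarrow> w < n \<and> d < n \<and> w \<noteq> d"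
  using E unfolding edges_below_def nbh_def by blast

lemma v_less: "v < n" using L_less v .

lemma v_neq: "v \<noteq> a" "v \<noteq> b" "v \<noteq> c" "v \<noteq> n" "v \<noteq> n + 1"
proof -
  have "\<not> A v v" using g unfolding graph_on_def by blast
  then have "v \<notin> {a, b} - {n}" unfolding ab(1)[symmetric] by simp
  then show "v \<noteq> a" "v \<noteq> b" "v \<noteq> c" "v \<noteq> n" "v \<noteq> n + 1" using v_less c by (auto split: if_splits)
qed

lemma a_neq_c: "a \<noteq> c"
proof (cases "b = n")
  case True
  then show ?thesis using ab(2) L_less[of a] c by auto
next
  case False
  then show ?thesis using ab(4) c by auto
qed

lemma A_v: "A v x \<Longrightarrow> x = a \<or> x = b"
  using ab(1) by blast

lemma A_va: "a \<noteq> n \<Longrightarrow> A v a" and A_vb: "b \<noteq> n \<Longrightarrow> A v b"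
  using ab(1) by blast+

lemma A_sym: "A x y \<Longrightarrow> A y x"
  using g unfolding graph_on_def by blast

lemma v_owner:
  assumes "d < n" "d \<notin> L"
  shows "v \<in> h d \<longleftrightarrow> h d = {v, a} \<or> h d = {v, b} \<or> h d = {v, n + 1}"
proof
  assume vh: "v \<in> h d"
  from assms show "h d = {v, a} \<or> h d = {v, b} \<or> h d = {v, n + 1}"
  proof (cases rule: owner_cases)
    case (1 x)
    then have "v = x" using vh v_neq(5) by simp
    then show ?thesis using 1(2) by simp
  next
    case (2 x y)
    then consider "v = x" | "v = y" using vh by auto
    then show ?thesis
    proof cases
      case 1
      then have "y = a \<or> y = b" using 2(1) A_v by simp
      then show ?thesis using 1 2(2) by auto
    next
      case y: 2
      then have "x = a \<or> x = b" using A_sym[OF 2(1)] A_v by simp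
      then show ?thesis using y 2(2) by (auto simp: insert_commute)
    qed
  qed
qed auto

text \<open>If \<open>v\<close> has no neighbour left, then \<open>a = b = n\<close> and two of the
  four pieces of the elimination are attached at the same pair. They are disjoint only because this
  pair owns nothing.\<close>

lemma no_dummy_owner: "d < n \<Longrightarrow> d \<notin> L \<Longrightarrow> h d \<noteq> {v, n}"
proof
  assume d: "d < n" "d \<notin> L" and hd: "h d = {v, n}"
  from d show False
  proof (cases rule: owner_cases)
    case (1 x)
    then have "n + 1 \<in> {v, n}" using hd by auto
    then show False using v_less by simp
  next
    case (2 x y)
    then have "n \<in> {x, y}" using hd by auto
    then show False using L_less 2 by auto
  qed
qed

lemma pieces_closed: "d \<in> pieces n L h x y \<Longrightarrow> nbh E d \<subseteq> pieces n L h x y \<union> {x, y}"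
proof
  fix w assume d: "d \<in> pieces n L h x y" and w: "w \<in> nbh E d"
  then have d': "d < n" "d \<notin> L" "h d = {x, y}" by (auto simp: pieces_def)
  show "w \<in> pieces n L h x y \<union> {x, y}"
    using closed[OF d'(1,2) w] d'(3) by (cases "w \<in> L") (auto simp: pieces_def)
qed

lemma pieces_disjoint: "{x, y} \<noteq> {x', y'} \<Longrightarrow> pieces n L h x y \<inter> pieces n L h x' y' = {}"
  by (auto simp: pieces_def)

text \<open>With a single neighbour, \<open>b = n\<close> and \<open>c = n + 1\<close>, so the
  merged piece hangs at \<open>a\<close> alone; with none, it joins the finished components at
  \<open>{n, n + 1}\<close>. Taking \<open>n + 1\<close> for \<open>c\<close> also keeps
  \<open>a\<close> and \<open>c\<close> distinct in the latter case.\<close>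

lemma elimination_step:
  "elimination E (pieces n L h a c) (pieces n L h v a) (pieces n L h v b) (pieces n L h v (n + 1)) a b c v (n + 1)"
proof
  have fin: "finite (pieces n L h x y)" for x y
    by (rule finite_subset[of _ "{..<n}"]) (auto simp: pieces_def)
  show "finite (pieces n L h a c)" "finite (pieces n L h v a)" "finite (pieces n L h v b)" "finite (pieces n L h v (n + 1))"
    by (rule fin)+
  show "pieces n L h a c \<inter> pieces n L h v a = {}" "pieces n L h a c \<inter> pieces n L h v b = {}"
    "pieces n L h a c \<inter> pieces n L h v (n + 1) = {}"
    using v_neq by (intro pieces_disjoint; auto simp: doubleton_eq_iff)+
  have an: "a \<le> n" "b \<le> n" using ab(2,3) L_less by fastforce+
  show "pieces n L h v a \<inter> pieces n L h v (n + 1) = {}" "pieces n L h v b \<inter> pieces n L h v (n + 1) = {}"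
    using an by (intro pieces_disjoint; auto simp: doubleton_eq_iff)+
  show "pieces n L h v a \<inter> pieces n L h v b = {}"
  proof (cases "a = b")
    case True
    then have "a = n" "b = n" using ab(4) by auto
    then show ?thesis using no_dummy_owner by (auto simp: pieces_def)
  next
    case False
    then show ?thesis by (intro pieces_disjoint) (auto simp: doubleton_eq_iff)
  qed
  have "x \<in> L \<union> {n, n + 1} \<Longrightarrow> x \<notin> pieces n L h x' y'" for x x' y'
    by (auto simp: pieces_def)
  then have o: "x \<in> {a, b, c, v, n + 1} \<Longrightarrow> x \<notin> pieces n L h x' y'" for x x' y'
    using ab(2,3) v c by (auto split: if_splits)
  then show "{a, b, c, v, n + 1} \<inter> (pieces n L h a c \<union> pieces n L h v a \<union> pieces n L h v b \<union> pieces n L h v (n + 1)) = {}"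
    by blast
  show "v \<noteq> a" "v \<noteq> b" "v \<noteq> c" "v \<noteq> n + 1" "a \<noteq> c" using v_neq a_neq_c by auto
  show "x \<notin> nbh E x" for x using nbh_less by blast
  show "nbh E v \<subseteq> pieces n L h v a \<union> pieces n L h v b \<union> pieces n L h v (n + 1) \<union> {a, b}"
  proof
    fix w assume w: "w \<in> nbh E v"
    show "w \<in> pieces n L h v a \<union> pieces n L h v b \<union> pieces n L h v (n + 1) \<union> {a, b}"
    proof (cases "w \<in> L")
      case True
      then have "A w v" using own v w unfolding owners_def nbh_def by blast
      then have "A v w" using g unfolding graph_on_def by blast
      then show ?thesis using A_v by blast
    next
      case False
      have "v \<in> nbh E w" using w nbh_commute by metis
      then have "v \<in> h w" using closed(1)[of w v] v False nbh_less[OF w] by blast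
      then show ?thesis using v_owner[of w] False nbh_less[OF w] by (auto simp: pieces_def)
    qed
  qed
  have nz: "nbh E x = {}" if "n \<le> x" for x using nbh_less that by fastforce
  then show "nbh E (n + 1) = {}" by simp
  show "nbh E a = {}" if "a = b" using ab(4) that nz by simp
  show "b = c \<or> nbh E b = {} \<and> nbh E c = {}" using nz c by auto
qed (rule pieces_closed; assumption)+

lemma pieces_step:
  assumes "x \<in> L - {v} \<union> {n, n + 1}" "y \<in> L - {v} \<union> {n, n + 1}"
  shows "pieces n (L - {v}) (reown h v {a, c}) x y =
    (if {x, y} = {a, c} then elimination.D (pieces n L h a c) (pieces n L h v a) (pieces n L h v b) (pieces n L h v (n + 1)) v
     else pieces n L h x y)"
proof -
  have "v \<notin> {x, y}" using assms v_less by auto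
  moreover have "v \<notin> {a, c}" using v_neq by auto
  ultimately show ?thesis
    unfolding elimination.D_def[OF elimination_step] using v_owner v_less v
    by (auto simp: pieces_def reown_def)
qed

lemma owners_step: "owners n E (L - {v}) (fill v A) (reown h v {a, c})"
  unfolding owners_def
proof (intro conjI allI impI ballI)
  show "L - {v} \<subseteq> {..<n}" using L_less by auto
next
  fix d assume d: "d < n" "d \<notin> L - {v}"
  show "\<exists>x. x \<in> L - {v} \<union> {n} \<and> (reown h v {a, c} d = {x, n + 1} \<or> (\<exists>y. fill v A x y \<and> reown h v {a, c} d = {x, y}))"
  proof (cases "d = v \<or> v \<in> h d")
    case True
    then have r: "reown h v {a, c} d = {a, c}" by (simp add: reown_def)
    show ?thesis
    proof (cases "b = n")
      case False
      \<comment> \<open>Here \<open>c = b\<close>, and the edge from \<open>a\<close> to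
        \<open>b\<close> that the owner pair needs is present in \<open>fill v A\<close>.\<close>
      then have n: "a \<noteq> n" "a \<noteq> b" using ab(4,5) by auto
      then have "A a v" "A v b" using A_va A_vb False g unfolding graph_on_def by blast+
      then have "fill v A a c" using n v_neq False c by (simp add: fill_def)
      then show ?thesis unfolding r using ab(2) v_neq n by blast
    qed (use r c ab(2) v_neq in auto)
  next
    case False
    then have r: "reown h v {a, c} d = h d" "d \<notin> L" using d by (auto simp: reown_def)
    from d(1) r(2) show ?thesis
    proof (cases rule: owner_cases)
      case (1 x)
      then show ?thesis using False r by auto
    next
      case (2 x y)
      then have "fill v A x y" "x \<noteq> v" using False by (auto simp: fill_def)
      then show ?thesis using 2 r by blast
    qed
  qed
next
  fix d w assume d: "d < n" "d \<notin> L - {v}" and w: "w \<in> nbh E d"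
  show "if w \<in> L - {v} then w \<in> reown h v {a, c} d else reown h v {a, c} w = reown h v {a, c} d"
  proof (cases "d = v")
    case True
    have wn: "w \<noteq> v" "w < n" "v \<in> nbh E w" using w True nbh_less[of w d] nbh_commute[of w E d] by auto
    show ?thesis
    proof (cases "w \<in> L")
      case T: True
      then have "A w v" using own v w True unfolding owners_def nbh_def by blast
      then have "w \<in> {a, b} - {n}" using g ab(1) unfolding graph_on_def by blast
      then show ?thesis using True T c by (auto simp: reown_def)
    next
      case False
      have "v \<in> h w" by (rule closed(1)[OF wn(2) False wn(3) v])
      then show ?thesis using True False by (simp add: reown_def)
    qed
  next
    case False
    then have dL: "d \<notin> L" using d by auto
    note cl = closed[OF d(1) dL w]
    show ?thesis
    proof (cases "w \<in> L")
      case True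
      then have wh: "w \<in> h d" by (rule cl(1))
      show ?thesis
      proof (cases "v \<in> h d")
        case T: True
        then have "w = v \<or> w = a \<or> w = b \<or> w = n + 1" using v_owner[OF d(1) dL] wh by auto
        then show ?thesis using T True L_less[OF True] c by (auto simp: reown_def)
      next
        case F: False
        then have "w \<noteq> v" using wh by auto
        then show ?thesis using F True wh False by (simp add: reown_def)
      qed
    next
      case F: False
      then have "h w = h d" "w \<noteq> v" using cl(2) v by auto
      then show ?thesis using False F by (simp add: reown_def)
    qed
  qed
next
  fix x y assume "x \<in> L - {v}" "y \<in> L - {v}" "{x, y} \<in> E"
  then show "fill v A x y" using own unfolding owners_def fill_def by blast
qed

end

section \<open>Finding the live neighbours of a vertex\<close>

definition scan_body :: cmd where
  "scan_body = seqs [Assign 9 (Read 13 (ix (Var 8) 4)), Assign 8 (inc (Var 8)),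
     Cond (Read 15 (Var 9)) Skip (seqs [Assign 6 (Var 5), Assign 5 (Var 9)])]"

definition scan :: cmd where
  "scan = While (Bin Less (Var 8) (Read 12 (Var 4))) scan_body"

text \<open>A shift register of two places, newest item first, with default \<open>d\<close> for an
  empty place. It loses nothing as long as at most two items arrive, and the second place is empty
  whenever the first one is.\<close>

definition last2 :: "'a \<Rightarrow> 'a list \<Rightarrow> 'a \<times> 'a" where
  "last2 d xs = fold (\<lambda>x (a, b). (x, a)) xs (d, d)"

lemma last2_snoc: "last2 d (xs @ [x]) = (x, fst (last2 d xs))"
  by (simp add: last2_def case_prod_unfold)

lemma last2_le_2:
  assumes "length xs \<le> 2" "last2 d xs = (a, b)" "d \<notin> set xs" "distinct xs"
  shows "set xs = {a, b} - {d}" "a \<in> set xs \<union> {d}" "b \<in> set xs \<union> {d}" "a = b \<Longrightarrow> a = d" "a = d \<Longrightarrow> b = d"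
proof -
  consider "xs = []" | x where "xs = [x]" | x y where "xs = [x, y]"
    using assms(1) by (cases xs rule: list.exhaust; cases "tl xs" rule: list.exhaust; cases "tl (tl xs)" rule: list.exhaust) auto
  then show "set xs = {a, b} - {d}" "a \<in> set xs \<union> {d}" "b \<in> set xs \<union> {d}" "a = b \<Longrightarrow> a = d" "a = d \<Longrightarrow> b = d"
    using assms(2-4) by (cases; auto simp: last2_def)+
qed

definition live :: "nat \<Rightarrow> state \<Rightarrow> nat set" where
  "live n \<sigma> = {x. x < n \<and> cell \<sigma> 15 x = 0}"

definition scan_time :: nat where
  "scan_time = stime scan_body + cost (Bin Less (Var 8) (Read 12 (Var 4))) + 1"

text \<open>The time depends on the whole list of \<open>v\<close>, dead entries included.
  \<open>pot\<close> keeps this amount in reserve until \<open>v\<close> is eliminated.\<close>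

lemma scan_spec:
  assumes bd: "bounded_by B \<sigma>" "20 < B" "n + 2 < B"
    and sc: "scalar \<sigma> 2 = n + 2" "scalar \<sigma> 4 = v" "v < n" "scalar \<sigma> 5 = n" "scalar \<sigma> 6 = n" "scalar \<sigma> 8 = 0"
    and ok: "hist_ok n \<sigma>" and deg: "card (Collect (hist n \<sigma> v) \<inter> live n \<sigma>) \<le> 2"
  shows "tri (B ^ 8) scan \<sigma> (scan_time * cell \<sigma> 12 v + scan_time) (\<lambda>\<sigma>'. bounded_by B \<sigma>' \<and> cell \<sigma>' = cell \<sigma> \<and>
    (\<forall>x. x \<notin> {5, 6, 8, 9} \<longrightarrow> scalar \<sigma>' x = scalar \<sigma> x) \<and>
    (\<exists>a b. scalar \<sigma>' 5 = a \<and> scalar \<sigma>' 6 = b \<and> Collect (hist n \<sigma> v) \<inter> live n \<sigma> = {a, b} - {n} \<and>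
      a \<in> live n \<sigma> \<union> {n} \<and> b \<in> live n \<sigma> \<union> {n} \<and> (a = b \<longrightarrow> a = n) \<and> (a = n \<longrightarrow> b = n)))"
proof -
  let ?g = "Bin Less (Var 8) (Read 12 (Var 4))" and ?c = "cell \<sigma> 12 v"
  define I where "I r \<rho> \<longleftrightarrow> bounded_by B \<rho> \<and> cell \<rho> = cell \<sigma> \<and> (\<forall>x. x \<notin> {5, 6, 8, 9} \<longrightarrow> scalar \<rho> x = scalar \<sigma> x) \<and>
    scalar \<rho> 8 \<le> ?c \<and> r = scan_time * (?c - scalar \<rho> 8) \<and>
    (scalar \<rho> 5, scalar \<rho> 6) = last2 n (filter (\<lambda>x. cell \<sigma> 15 x = 0) (take (scalar \<rho> 8) (nbs n \<sigma> v)))"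
    for r and \<rho> :: state
  have len: "length (nbs n \<sigma> v) = ?c" by (simp add: nbs_def)
  have c_le: "?c \<le> n" using hist_ok_count[OF ok sc(3)] card_hist_le by simp
  have "tri (B ^ 8) (While ?g scan_body) \<sigma> (scan_time * ?c + cost ?g + 1) (\<lambda>\<sigma>'. (\<exists>r'. I r' \<sigma>') \<and> eval \<sigma>' ?g = 0)"
  proof (rule tri_While)
    show "I (scan_time * ?c) \<sigma>" using bd sc by (simp add: I_def last2_def)
  next
    fix r \<rho> assume "I r \<rho>"
    then show "fits (B ^ 8) \<rho> ?g" using bd(2) by (intro fits_tame) (simp_all add: I_def tame_def)
  next
    fix r \<rho> assume I: "I r \<rho>" and g: "eval \<rho> ?g \<noteq> 0"
    let ?k = "scalar \<rho> 8"
    have h: "cell \<rho> = cell \<sigma>" "scalar \<rho> 2 = n + 2" "scalar \<rho> 4 = v" "bounded_by B \<rho>" using I sc by (simp_all add: I_def)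
    have k: "?k < ?c" using g h by (simp split: if_splits)
    define x where "x = nbs n \<sigma> v ! ?k"
    have x: "cell \<sigma> 13 (?k * (n + 2) + v) = x" using k by (simp add: x_def nbs_def)
    have tk: "take (Suc ?k) (nbs n \<sigma> v) = take ?k (nbs n \<sigma> v) @ [x]"
      unfolding x_def by (rule take_Suc_conv_app_nth) (simp add: len k)
    have l2: "(scalar \<rho> 5, scalar \<rho> 6) = last2 n (filter (\<lambda>x. cell \<sigma> 15 x = 0) (take ?k (nbs n \<sigma> v)))" using I by (simp add: I_def)
    have "scalar \<rho> y < B" for y using h(4) by (simp add: bounded_by_def)
    moreover have "cell \<sigma> y z < B" for y z using bd by (simp add: bounded_by_def)
    ultimately have sm: "small B scan_body \<rho>" using k c_le bd(3) by (simp add: scan_body_def h)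
    have "tri (B ^ 8) scan_body \<rho> (stime scan_body) (I (scan_time * (?c - Suc ?k)))"
    proof (rule tri_run[OF h(4) bd(2) _ _ sm])
      assume bd': "bounded_by B (run scan_body \<rho>)"
      have xN: "cell \<sigma> 13 (scalar \<rho> 8 * (n + 2) + v) = x" by (fact x)
      have r: "run scan_body \<rho> = (if cell \<sigma> 15 x \<noteq> 0 then \<rho>\<lparr>scalar := (scalar \<rho>)(9 := x, 8 := Suc ?k)\<rparr>
        else \<rho>\<lparr>scalar := (scalar \<rho>)(9 := x, 8 := Suc ?k, 6 := scalar \<rho> 5, 5 := x)\<rparr>)"
        by (simp add: scan_body_def h xN[simplified])
      show "I (scan_time * (?c - Suc ?k)) (run scan_body \<rho>)"
        unfolding I_def using bd' I k by (auto simp: r I_def tk last2_snoc l2[symmetric] simp del: take_Suc)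
    qed (simp_all add: scan_body_def tame_def)
    then show "\<exists>t r'. t + r' + cost ?g + 1 \<le> r \<and> tri (B ^ 8) scan_body \<rho> t (I r')"
    proof (intro exI conjI)
      have "r = scan_time * (?c - ?k)" using I by (simp add: I_def)
      moreover have "?c - ?k = Suc (?c - Suc ?k)" using k by simp
      ultimately show "stime scan_body + scan_time * (?c - Suc ?k) + cost ?g + 1 \<le> r" by (simp add: scan_time_def)
    qed
  qed
  then show ?thesis unfolding scan_def
  proof (rule tri_mono)
    show "scan_time * ?c + cost ?g + 1 \<le> scan_time * ?c + scan_time" by (simp add: scan_time_def)
  next
    fix \<rho> assume "(\<exists>r'. I r' \<rho>) \<and> eval \<rho> ?g = 0"
    then obtain r' where I: "I r' \<rho>" and g: "eval \<rho> ?g = 0" by blast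
    have "scalar \<rho> 8 = ?c" using I g sc by (auto simp: I_def split: if_splits)
    then have l2: "last2 n (filter (\<lambda>x. cell \<sigma> 15 x = 0) (nbs n \<sigma> v)) = (scalar \<rho> 5, scalar \<rho> 6)"
      using I len by (simp add: I_def)
    have nb: "distinct (nbs n \<sigma> v)" "set (nbs n \<sigma> v) = Collect (hist n \<sigma> v)" using ok sc(3) by (auto simp: hist_ok_def)
    let ?xs = "filter (\<lambda>x. cell \<sigma> 15 x = 0) (nbs n \<sigma> v)"
    have xs: "set ?xs = Collect (hist n \<sigma> v) \<inter> live n \<sigma>" "distinct ?xs" "n \<notin> set ?xs"
      using nb by (auto simp: live_def hist_def)
    then have "length ?xs \<le> 2" using deg distinct_card[of ?xs] by simp
    note last2_le_2[OF this l2 xs(3,2), unfolded xs(1)]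
    then show "bounded_by B \<rho> \<and> cell \<rho> = cell \<sigma> \<and> (\<forall>x. x \<notin> {5, 6, 8, 9} \<longrightarrow> scalar \<rho> x = scalar \<sigma> x) \<and>
      (\<exists>a b. scalar \<rho> 5 = a \<and> scalar \<rho> 6 = b \<and> Collect (hist n \<sigma> v) \<inter> live n \<sigma> = {a, b} - {n} \<and>
      a \<in> live n \<sigma> \<union> {n} \<and> b \<in> live n \<sigma> \<union> {n} \<and> (a = b \<longrightarrow> a = n) \<and> (a = n \<longrightarrow> b = n))"
      using I unfolding I_def by blast
  qed
qed

section \<open>The elimination step\<close>

definition base :: "nat \<Rightarrow> nat \<Rightarrow> nat \<Rightarrow> nat" where
  "base n x y = (x * (n + 2) + y) * 16"

lemma base_apart:
  assumes "y < n + 2" "y' < n + 2" "(x, y) \<noteq> (x', y')"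
  shows "base n x y + 16 \<le> base n x' y' \<or> base n x' y' + 16 \<le> base n x y"
proof -
  have "x * (n + 2) + y \<noteq> x' * (n + 2) + y'" using pair_index_inj[of y "n + 2" y' x x'] assms by blast
  moreover have "k * 16 + 16 \<le> l * 16 \<or> l * 16 + 16 \<le> k * 16" if "k \<noteq> l" for k l :: nat
    using that by arith
  ultimately show ?thesis unfolding base_def by blast
qed

lemma base_less:
  assumes "x < n + 2" "y < n + 2"
  shows "base n x y + 16 \<le> 16 * ((n + 2) * (n + 2))"
proof -
  have "x * (n + 2) \<le> (n + 1) * (n + 2)" using assms(1) by (intro mult_right_mono) auto
  then have "x * (n + 2) + y + 1 \<le> (n + 1) * (n + 2) + (n + 2)" using assms(2) by linarith
  also have "\<dots> = (n + 2) * (n + 2)" by simp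
  finally have "16 * (x * (n + 2) + y + 1) \<le> 16 * ((n + 2) * (n + 2))" by (rule mult_le_mono2)
  then show ?thesis by (simp add: base_def)
qed

text \<open>Soundness and optimality of a table. For pieces, a partial solution has at most
  \<open>n\<close> elements; if one exists, the second clause therefore forces the entry to be
  feasible, and the first one makes it a minimum.\<close>

definition tab :: "nat \<Rightarrow> nat set set \<Rightarrow> state \<Rightarrow> (nat \<Rightarrow> nat set) \<Rightarrow> nat set \<Rightarrow> nat \<Rightarrow> nat \<Rightarrow> bool" where
  "tab n E \<sigma> P D x y \<longleftrightarrow> (\<forall>i<4. \<forall>j<4. valid n \<sigma> P (psol E D x y i j) (entry \<sigma> (base n x y) i j) \<and>
     (\<forall>S. psol E D x y i j S \<longrightarrow> cell \<sigma> 5 (entry \<sigma> (base n x y) i j) \<le> card S))"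

lemma tab_mono:
  assumes "tab n E \<sigma> P D x y" "\<And>i j. i < 4 \<Longrightarrow> j < 4 \<Longrightarrow> entry \<sigma>' (base n x y) i j = entry \<sigma> (base n x y) i j"
    "\<And>p. p < scalar \<sigma> 16 \<Longrightarrow> P' p = P p \<and> cell \<sigma>' 5 p = cell \<sigma> 5 p" "scalar \<sigma> 16 \<le> scalar \<sigma>' 16"
  shows "tab n E \<sigma>' P' D x y"
  unfolding tab_def
proof (intro allI impI)
  fix i j :: nat assume ij: "i < 4" "j < 4"
  have "valid n \<sigma> P (psol E D x y i j) (entry \<sigma> (base n x y) i j) \<and>
     (\<forall>S. psol E D x y i j S \<longrightarrow> cell \<sigma> 5 (entry \<sigma> (base n x y) i j) \<le> card S)"
    using assms(1) ij by (simp add: tab_def)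
  moreover from this have "entry \<sigma> (base n x y) i j < scalar \<sigma> 16" by (simp add: valid_def)
  ultimately show "valid n \<sigma>' P' (psol E D x y i j) (entry \<sigma>' (base n x y) i j) \<and>
     (\<forall>S. psol E D x y i j S \<longrightarrow> cell \<sigma>' 5 (entry \<sigma>' (base n x y) i j) \<le> card S)"
    using assms(3)[of "entry \<sigma> (base n x y) i j"] assms(4) unfolding assms(2)[OF ij] valid_def by auto
qed

lemma term_in_if: "term_in p v = (if p = 3 then {v} else {})"
  by (simp add: term_in_def)

text \<open>By \<open>psol_glue\<close> every feasible candidate is a partial solution of the merged
  piece; by \<open>psol_split\<close> every partial solution is at least as large as the price of
  some candidate. Tables at other pairs survive because their blocks of cells are disjoint.\<close>

lemma combine_tables:
  assumes el: "elimination E D0 D1 D2 D3 a b c v z"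
    and tabs: "tab n E \<sigma> P D0 a c" "tab n E \<sigma> P D1 v a" "tab n E \<sigma> P D2 v b" "tab n E \<sigma> P D3 v z"
    and st: "store_ok n \<sigma> P"
    and sc: "scalar \<sigma> 4 = v" "scalar \<sigma> 11 = base n a c" "scalar \<sigma> 12 = base n c a"
      "scalar \<sigma> 13 = base n v a" "scalar \<sigma> 14 = base n v b" "scalar \<sigma> 15 = base n v z"
    and B: "scalar \<sigma> 16 + 491 < B" "4 * n + 5 < B" "v < n" "a < n + 2" "c < n + 2"
  defines "\<sigma>' \<equiv> run combine \<sigma>"
  shows "small B combine \<sigma>"
    and "d \<notin> {4, 5, 6, 7, 8, 9, 10, 17} \<Longrightarrow> cell \<sigma>' d = cell \<sigma> d"
    and "x \<notin> {16, 17, 18, 19, 20, 21} \<Longrightarrow> scalar \<sigma>' x = scalar \<sigma> x"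
    and "scalar \<sigma> 16 \<le> scalar \<sigma>' 16" "scalar \<sigma>' 16 \<le> scalar \<sigma> 16 + 490"
    and "\<exists>P'. store_ok n \<sigma>' P' \<and>
      tab n E \<sigma>' P' (elimination.D D0 D1 D2 D3 v) a c \<and> tab n E \<sigma>' P' (elimination.D D0 D1 D2 D3 v) c a \<and>
      (\<forall>D x y. y < n + 2 \<longrightarrow> {x, y} \<noteq> {a, c} \<longrightarrow> tab n E \<sigma> P D x y \<longrightarrow> tab n E \<sigma>' P' D x y)"
proof -
  interpret elimination E D0 D1 D2 D3 a b c v z by fact
  \<comment> \<open>Slot \<open>4 * i + j\<close> is decoded into its pair of states.\<close>
  define Q where "Q k S \<longleftrightarrow> psol E D a c (k div 4) (k mod 4) S" for k S
  let ?e = "entry \<sigma>"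
  have T0: "valid n \<sigma> P (psol E D0 a c i j) (?e (base n a c) i j)"
    "psol E D0 a c i j S \<Longrightarrow> cell \<sigma> 5 (?e (base n a c) i j) \<le> card S" if "i < 4" "j < 4" for i j S
    using tabs(1) that by (auto simp: tab_def)
  have T1: "valid n \<sigma> P (psol E D1 v a i j) (?e (base n v a) i j)"
    "psol E D1 v a i j S \<Longrightarrow> cell \<sigma> 5 (?e (base n v a) i j) \<le> card S" if "i < 4" "j < 4" for i j S
    using tabs(2) that by (auto simp: tab_def)
  have T2: "valid n \<sigma> P (psol E D2 v b i j) (?e (base n v b) i j)"
    "psol E D2 v b i j S \<Longrightarrow> cell \<sigma> 5 (?e (base n v b) i j) \<le> card S" if "i < 4" "j < 4" for i j S
    using tabs(3) that by (auto simp: tab_def)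
  have T3: "valid n \<sigma> P (psol E D3 v z i j) (?e (base n v z) i j)"
    "psol E D3 v z i j S \<Longrightarrow> cell \<sigma> 5 (?e (base n v z) i j) \<le> card S" if "i < 4" "j < 4" for i j S
    using tabs(4) that by (auto simp: tab_def)
  have ch: "case children \<sigma> t of (x0, x1, x2, x3) \<Rightarrow>
      x0 < scalar \<sigma> 16 \<and> x1 < scalar \<sigma> 16 \<and> x2 < scalar \<sigma> 16 \<and> x3 < scalar \<sigma> 16"
    if t: "t \<in> set tuples" for t
  proof (cases t rule: slot.cases)
    case (1 i1 i2 j1 j2 p q u)
    have c: "compat i1 i2" "compat j1 j2" "closes p q u" using t by (simp_all add: 1 set_tuples)
    note l = compat_less[OF c(1)] compat_less[OF c(2)] closes_less[OF c(3)]
    show ?thesis using T0(1)[of i1 j1] T1(1)[of p i2] T2(1)[of q j2] T3(1)[of u 0] l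
      by (auto simp: 1 sc valid_def)
  qed
  have good: "Q (slot t) (gather \<sigma> P t) \<and> card (gather \<sigma> P t) = price \<sigma> t"
    if t: "t \<in> set tuples" "price \<sigma> t \<le> n" for t
  proof (cases t rule: slot.cases)
    case (1 i1 i2 j1 j2 p q u)
    have c: "compat i1 i2" "compat j1 j2" "closes p q u" using t(1) by (simp_all add: 1 set_tuples)
    note l = compat_less[OF c(1)] compat_less[OF c(2)] closes_less[OF c(3)]
    let ?x0 = "?e (base n a c) i1 j1" and ?x1 = "?e (base n v a) p i2" and ?x2 = "?e (base n v b) q j2"
      and ?x3 = "?e (base n v z) u 0"
    have pr: "price \<sigma> t = cell \<sigma> 5 ?x0 + cell \<sigma> 5 ?x1 + cell \<sigma> 5 ?x2 + cell \<sigma> 5 ?x3 + (if p = 3 then 1 else 0)"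
      by (simp add: 1 price_def sc)
    have ga: "gather \<sigma> P t = P ?x0 \<union> P ?x1 \<union> P ?x2 \<union> P ?x3 \<union> term_in p v"
      by (simp add: 1 gather_def sc term_in_if)
    have "cell \<sigma> 5 ?x0 \<le> n" "cell \<sigma> 5 ?x1 \<le> n" "cell \<sigma> 5 ?x2 \<le> n" "cell \<sigma> 5 ?x3 \<le> n" using t(2) pr by linarith+
    then have ps: "psol E D0 a c i1 j1 (P ?x0)" "psol E D1 v a p i2 (P ?x1)" "psol E D2 v b q j2 (P ?x2)"
      "psol E D3 v z u 0 (P ?x3)"
      and cs: "card (P ?x0) = cell \<sigma> 5 ?x0" "card (P ?x1) = cell \<sigma> 5 ?x1" "card (P ?x2) = cell \<sigma> 5 ?x2"
      "card (P ?x3) = cell \<sigma> 5 ?x3"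
      using T0(1)[of i1 j1] T1(1)[of p i2] T2(1)[of q j2] T3(1)[of u 0] l by (auto simp: valid_def)
    have "psol E D a c (join i1 i2) (join j1 j2) (gather \<sigma> P t)"
      unfolding ga by (rule psol_glue[OF c ps])
    moreover have "card (gather \<sigma> P t) = price \<sigma> t"
      unfolding ga pr by (subst card_glue) (use ps cs in \<open>auto simp: psol_def\<close>)
    moreover have "slot t div 4 = join i1 i2" "slot t mod 4 = join j1 j2" using l by (auto simp: 1)
    ultimately show ?thesis by (simp add: Q_def)
  qed
  have ch': "\<forall>t \<in> set tuples. case children \<sigma> t of (x0, x1, x2, x3) \<Rightarrow>
      x0 < scalar \<sigma> 16 \<and> x1 < scalar \<sigma> 16 \<and> x2 < scalar \<sigma> 16 \<and> x3 < scalar \<sigma> 16"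
    by (rule ballI) (rule ch)
  have good': "\<forall>t \<in> set tuples. price \<sigma> t \<le> n \<longrightarrow> Q (slot t) (gather \<sigma> P t) \<and> card (gather \<sigma> P t) = price \<sigma> t"
    by (intro ballI impI) (rule good)
  have Bs: "scalar \<sigma> 4 < n" using B sc by simp
  have apart: "scalar \<sigma> 11 + 16 \<le> scalar \<sigma> 12 \<or> scalar \<sigma> 12 + 16 \<le> scalar \<sigma> 11"
    unfolding sc using base_apart[OF B(5,4)] ac by blast
  note spec = combine_spec[where Q = Q, OF st ch' B(1,2) Bs apart good', folded \<sigma>'_def, unfolded sc]
  show "small B combine \<sigma>" "scalar \<sigma> 16 \<le> scalar \<sigma>' 16" "scalar \<sigma>' 16 \<le> scalar \<sigma> 16 + 490"
    by (rule spec)+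
  show "cell \<sigma>' d = cell \<sigma> d" if "d \<notin> {4, 5, 6, 7, 8, 9, 10, 17}" using spec(2) that .
  show "scalar \<sigma>' x = scalar \<sigma> x" if "x \<notin> {16, 17, 18, 19, 20, 21}" using spec(3) that .
  obtain P' where st': "store_ok n \<sigma>' P'" and old: "\<And>p. p < scalar \<sigma> 16 \<Longrightarrow> P' p = P p \<and> cell \<sigma>' 5 p = cell \<sigma> 5 p"
    and new: "\<And>i j. i < 4 \<Longrightarrow> j < 4 \<Longrightarrow> entry \<sigma>' (base n c a) j i = entry \<sigma>' (base n a c) i j \<and>
         valid n \<sigma>' P' (Q (4 * i + j)) (entry \<sigma>' (base n a c) i j) \<and>
         (\<forall>t \<in> set tuples. slot t = 4 * i + j \<longrightarrow> cell \<sigma>' 5 (entry \<sigma>' (base n a c) i j) \<le> price \<sigma> t)"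
    using spec(7) by blast
  have Q: "Q (4 * i + j) = psol E D a c i j" if "j < 4" for i j using that by (auto simp: Q_def fun_eq_iff)
  have comp: "cell \<sigma>' 5 (entry \<sigma>' (base n a c) i j) \<le> card S" if ij: "i < 4" "j < 4" and S: "psol E D a c i j S" for i j S
  proof (rule psol_split[OF S ij])
    fix i1 i2 j1 j2 p q u S0 S1 S2 S3
    assume c: "compat i1 i2" "compat j1 j2" "closes p q u" and e: "i = join i1 i2" "j = join j1 j2"
      and ps: "psol E D0 a c i1 j1 S0" "psol E D1 v a p i2 S1" "psol E D2 v b q j2 S2" "psol E D3 v z u 0 S3"
      and S': "S = S0 \<union> S1 \<union> S2 \<union> S3 \<union> term_in p v"
    let ?t = "((i1, i2), (j1, j2), (p, q, u))"
    note l = compat_less[OF c(1)] compat_less[OF c(2)] closes_less[OF c(3)]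
    have "?t \<in> set tuples" "slot ?t = 4 * i + j" using c e by (simp_all add: set_tuples)
    then have "cell \<sigma>' 5 (entry \<sigma>' (base n a c) i j) \<le> price \<sigma> ?t" using new[OF ij] by blast
    also have "\<dots> \<le> card S0 + card S1 + card S2 + card S3 + (if p = 3 then 1 else 0)"
      using T0(2)[OF _ _ ps(1)] T1(2)[OF _ _ ps(2)] T2(2)[OF _ _ ps(3)] T3(2)[OF _ _ ps(4)] l
      by (simp add: price_def sc add_mono)
    also have "\<dots> = card S" unfolding S' by (subst card_glue) (use ps in \<open>auto simp: psol_def\<close>)
    finally show ?thesis .
  qed
  have tab1: "tab n E \<sigma>' P' D a c" unfolding tab_def using new comp Q by simp
  have tab2: "tab n E \<sigma>' P' D c a" unfolding tab_def
  proof (intro allI impI)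
    fix i j :: nat assume ij: "i < 4" "j < 4"
    have e: "entry \<sigma>' (base n c a) i j = entry \<sigma>' (base n a c) j i" using new[OF ij(2,1)] by simp
    have ps: "psol E D c a i j = psol E D a c j i" by (intro ext psol_commute)
    show "valid n \<sigma>' P' (psol E D c a i j) (entry \<sigma>' (base n c a) i j) \<and>
       (\<forall>S. psol E D c a i j S \<longrightarrow> cell \<sigma>' 5 (entry \<sigma>' (base n c a) i j) \<le> card S)"
      unfolding e ps using new[OF ij(2,1)] comp[OF ij(2,1)] Q[OF ij(1)] by simp
  qed
  have other: "tab n E \<sigma>' P' D' x y" if y: "y < n + 2" "{x, y} \<noteq> {a, c}" and t: "tab n E \<sigma> P D' x y" for D' x y
  proof (rule tab_mono[OF t _ old spec(4)])
    fix i j :: nat assume ij: "i < 4" "j < 4"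
    have ne: "(x, y) \<noteq> (a, c)" "(x, y) \<noteq> (c, a)" using y(2) by auto
    have "cell \<sigma>' 4 (base n x y + (4 * i + j)) = cell \<sigma> 4 (base n x y + (4 * i + j))"
      using base_apart[OF y(1) B(5) ne(1)] base_apart[OF y(1) B(4) ne(2)] ij by (intro spec(6)) auto
    then show "entry \<sigma>' (base n x y) i j = entry \<sigma> (base n x y) i j" by (simp add: entry_def)
  qed
  show "\<exists>P'. store_ok n \<sigma>' P' \<and> tab n E \<sigma>' P' D a c \<and> tab n E \<sigma>' P' D c a \<and>
      (\<forall>D x y. y < n + 2 \<longrightarrow> {x, y} \<noteq> {a, c} \<longrightarrow> tab n E \<sigma> P D x y \<longrightarrow> tab n E \<sigma>' P' D x y)"
    using st' tab1 tab2 other by blast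
qed

text \<open>Beyond the question of a new edge, absent neighbours get no special treatment: the dummy
  \<open>n\<close> is queued like a vertex and later discarded because its elimination flag is set.
  Pushing two items every time ties the tail of the queue to the number of live vertices. The matrix
  also knows former edges, but between live vertices these are exactly the current ones.\<close>

definition fill_and_push :: cmd where
  "fill_and_push = seqs
    [Assign 22 (Var 5), Assign 23 (Var 6),
     Cond (Bin Plus (Bin Equal (Var 6) (Var 0)) (Read 3 (ix (Var 5) 6))) Skip add_edge,
     Write 14 (Var 5) (Bin Minus (Read 14 (Var 5)) (Const 1)), Write 14 (Var 6) (Bin Minus (Read 14 (Var 6)) (Const 1)),
     Write 16 (Var 10) (Var 5), Write 16 (inc (Var 10)) (Var 6), Assign 10 (Bin Plus (Var 10) (Const 2))]"

lemma fill_and_push_spec: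
  assumes bd: "bounded_by B \<sigma>" "n + 2 < B" "scalar \<sigma> 10 + 2 < B"
    and sc: "scalar \<sigma> 0 = n" "scalar \<sigma> 2 = n + 2" "scalar \<sigma> 5 = a" "scalar \<sigma> 6 = b"
    and ok: "hist_ok n \<sigma>" and ab0: "a \<le> n" "b \<le> n" "a = b \<longrightarrow> a = n" "a = n \<longrightarrow> b = n"
    and deg0: "a < n \<longrightarrow> cell \<sigma> 14 a \<le> n" "b < n \<longrightarrow> cell \<sigma> 14 b \<le> n"
  defines "\<sigma>' \<equiv> run fill_and_push \<sigma>" and "new \<equiv> b \<noteq> n \<and> \<not> hist n \<sigma> a b"
  shows "small B fill_and_push \<sigma>"
    and "hist_ok n \<sigma>'"
    and "\<And>x y. hist n \<sigma>' x y \<longleftrightarrow> hist n \<sigma> x y \<or> b \<noteq> n \<and> (x = a \<and> y = b \<or> x = b \<and> y = a)"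
    and "\<And>x. x < n \<Longrightarrow> cell \<sigma>' 14 x = (if x = a \<or> x = b then (if new then cell \<sigma> 14 x else cell \<sigma> 14 x - 1) else cell \<sigma> 14 x)"
    and "cell \<sigma>' 16 = (cell \<sigma> 16)(scalar \<sigma> 10 := a, scalar \<sigma> 10 + 1 := b)"
    and "scalar \<sigma>' 10 = scalar \<sigma> 10 + 2"
    and "\<And>x. x \<notin> {10, 22, 23} \<Longrightarrow> scalar \<sigma>' x = scalar \<sigma> x"
    and "\<And>d. d \<notin> {3, 12, 13, 14, 16} \<Longrightarrow> cell \<sigma>' d = cell \<sigma> d"
proof -
  note ab = ab0[rule_format] and deg = deg0[rule_format]
  define \<sigma>1 where "\<sigma>1 = \<sigma>\<lparr>scalar := (scalar \<sigma>)(22 := a, 23 := b)\<rparr>"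
  define \<sigma>2 where "\<sigma>2 = (if new then run add_edge \<sigma>1 else \<sigma>1)"
  have s1: "scalar \<sigma>1 2 = n + 2" "scalar \<sigma>1 22 = a" "scalar \<sigma>1 23 = b" "cell \<sigma>1 = cell \<sigma>"
    using sc by (simp_all add: \<sigma>1_def)
  have ok1: "hist_ok n \<sigma>1" using ok hist_ok_cong[of \<sigma>1 \<sigma>] by (simp add: s1)
  have h1: "hist n \<sigma>1 = hist n \<sigma>" by (rule hist_cong) (simp add: s1)
  have sp: "small B add_edge \<sigma>1"
     "\<And>x y. hist n \<sigma>2 x y \<longleftrightarrow> hist n \<sigma> x y \<or> x = a \<and> y = b \<or> x = b \<and> y = a"
     "hist_ok n \<sigma>2" "cell \<sigma>2 14 = (cell \<sigma> 14)(a := cell \<sigma> 14 a + 1, b := cell \<sigma> 14 b + 1)"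
     "scalar \<sigma>2 = scalar \<sigma>1" "\<And>d. d \<notin> {3, 12, 13, 14} \<Longrightarrow> cell \<sigma>2 d = cell \<sigma> d" if new
  proof -
    have ab': "a < n" "b < n" "a \<noteq> b" "\<not> hist n \<sigma>1 a b" using that ab h1 unfolding new_def by (metis le_neq_implies_less)+
    have dg: "cell \<sigma>1 14 a \<le> n" "cell \<sigma>1 14 b \<le> n" using deg ab' by (simp_all add: s1)
    note spec = add_edge_spec[OF s1(1-3) ab'(1,2,3) ok1 ab'(4) dg bd(2)]
    have 2: "\<sigma>2 = run add_edge \<sigma>1" using that by (simp add: \<sigma>2_def)
    show "small B add_edge \<sigma>1" by (fact spec(1))
    show "hist n \<sigma>2 x y \<longleftrightarrow> hist n \<sigma> x y \<or> x = a \<and> y = b \<or> x = b \<and> y = a" for x y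
      using spec(2) unfolding 2 h1 .
    show "hist_ok n \<sigma>2" "cell \<sigma>2 14 = (cell \<sigma> 14)(a := cell \<sigma> 14 a + 1, b := cell \<sigma> 14 b + 1)"
      "scalar \<sigma>2 = scalar \<sigma>1" "\<And>d. d \<notin> {3, 12, 13, 14} \<Longrightarrow> cell \<sigma>2 d = cell \<sigma> d"
      using spec(3-6) unfolding 2 s1(4) by blast+
  qed
  have sn: "\<not> new \<Longrightarrow> \<sigma>2 = \<sigma>1" by (simp add: \<sigma>2_def)
  have sc2: "scalar \<sigma>2 = scalar \<sigma>1" using sp(5) sn by (cases new) auto
  have fr2: "cell \<sigma>2 d = cell \<sigma> d" if "d \<notin> {3, 12, 13, 14}" for d using sp(6)[OF _ that] sn s1(4) by (cases new) auto
  have test: "b = n \<or> 0 < cell \<sigma> 3 (a * (n + 2) + b) \<longleftrightarrow> \<not> new"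
    using ab by (auto simp: new_def hist_def le_less)
  have test': "eval \<sigma>1 (Bin Plus (Bin Equal (Var 6) (Var 0)) (Read 3 (ix (Var 5) 6))) = 0 \<longleftrightarrow> new"
    using test sc by (auto simp: \<sigma>1_def)
  define rest where "rest = seqs [Write 14 (Var 5) (Bin Minus (Read 14 (Var 5)) (Const 1)), Write 14 (Var 6) (Bin Minus (Read 14 (Var 6)) (Const 1)),
     Write 16 (Var 10) (Var 5), Write 16 (inc (Var 10)) (Var 6), Assign 10 (Bin Plus (Var 10) (Const 2))]"
  have fp: "fill_and_push = Seq (Assign 22 (Var 5)) (Seq (Assign 23 (Var 6)) (Seq
    (Cond (Bin Plus (Bin Equal (Var 6) (Var 0)) (Read 3 (ix (Var 5) 6))) Skip add_edge) rest))"
    by (simp add: fill_and_push_def rest_def)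
  have e1: "run (Assign 23 (Var 6)) (run (Assign 22 (Var 5)) \<sigma>) = \<sigma>1" using sc by (simp add: \<sigma>1_def)
  have e2: "run (Cond (Bin Plus (Bin Equal (Var 6) (Var 0)) (Read 3 (ix (Var 5) 6))) Skip add_edge) \<sigma>1 = \<sigma>2"
    using test' by (simp only: run.simps \<sigma>2_def if_not_P if_P split: if_splits) auto
  have r: "\<sigma>' = run rest \<sigma>2" unfolding \<sigma>'_def fp by (simp only: run.simps(3) e1 e2)
  have B2: "scalar \<sigma>2 x < B" "cell \<sigma> d x < B" for d x
    using bd(1,2) ab unfolding sc2 \<sigma>1_def by (auto simp: bounded_by_def)
  have sc2': "scalar \<sigma>2 5 = a" "scalar \<sigma>2 6 = b" "scalar \<sigma>2 10 = scalar \<sigma> 10" using sc by (simp_all add: sc2 \<sigma>1_def)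
  define dg where "dg = (cell \<sigma>2 14)(a := cell \<sigma>2 14 a - 1)"
  have r14: "cell \<sigma>' 14 = dg(b := dg b - 1)"
    and r16: "cell \<sigma>' 16 = (cell \<sigma>2 16)(scalar \<sigma> 10 := a, scalar \<sigma> 10 + 1 := b)"
    and rs: "scalar \<sigma>' = (scalar \<sigma>2)(10 := scalar \<sigma> 10 + 2)"
    and ro: "\<And>d. d \<notin> {14, 16} \<Longrightarrow> cell \<sigma>' d = cell \<sigma>2 d"
    unfolding r rest_def dg_def by (simp_all add: sc2')
  have "cell \<sigma>2 14 x < B" for x
  proof (cases new)
    case True
    then have "a < n" "b < n" using ab unfolding new_def by (metis le_neq_implies_less)+
    then show ?thesis using True sp(4) deg B2(2)[of 14 x] bd(2) by auto
  qed (use sn s1(4) B2(2) in simp)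
  then have dgB: "dg x < B" "cell \<sigma>2 14 x < B" for x by (auto simp: dg_def less_imp_diff_less)
  have smr: "small B rest \<sigma>2"
    unfolding rest_def using B2(1)[of 5] B2(1)[of 6] B2(1)[of 10] bd(3) dgB
    by (simp add: sc2' less_imp_diff_less dg_def[symmetric])
  have smc: "small B (Cond (Bin Plus (Bin Equal (Var 6) (Var 0)) (Read 3 (ix (Var 5) 6))) Skip add_edge) \<sigma>1"
    using test' sp(1) by (simp only: small.simps split: if_splits) auto
  have "scalar \<sigma> 5 < B" "scalar \<sigma> 6 < B" using bd by (simp_all add: bounded_by_def)
  then show "small B fill_and_push \<sigma>"
    unfolding fp using smc smr by (simp only: small.simps(3) e1 e2) simp
  have c3: "cell \<sigma>' 3 = cell \<sigma>2 3" "cell \<sigma>' 12 = cell \<sigma>2 12" "cell \<sigma>' 13 = cell \<sigma>2 13" by (simp_all add: ro)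
  show "hist_ok n \<sigma>'" using hist_ok_cong[OF c3] sp(3) sn ok1 by (cases new) auto
  have "hist n \<sigma>2 x y \<longleftrightarrow> hist n \<sigma> x y \<or> b \<noteq> n \<and> (x = a \<and> y = b \<or> x = b \<and> y = a)" for x y
  proof (cases new)
    case True
    then show ?thesis using sp(2) by (simp add: new_def)
  next
    case False
    have "hist n \<sigma> b a" if "hist n \<sigma> a b" using ok that unfolding hist_ok_def by blast
    then show ?thesis using False sn h1 unfolding new_def by auto
  qed
  then show "hist n \<sigma>' x y \<longleftrightarrow> hist n \<sigma> x y \<or> b \<noteq> n \<and> (x = a \<and> y = b \<or> x = b \<and> y = a)" for x y
    unfolding hist_cong[OF c3(1)] .
  show "cell \<sigma>' 14 x = (if x = a \<or> x = b then (if new then cell \<sigma> 14 x else cell \<sigma> 14 x - 1) else cell \<sigma> 14 x)" if "x < n" for x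
  proof (cases new)
    case True
    then have "a \<noteq> b" using ab by (auto simp: new_def)
    then show ?thesis using True sp(4) by (auto simp: r14 dg_def)
  next
    case False
    then show ?thesis using sn s1(4) that ab(3) by (auto simp: r14 dg_def)
  qed
  show "cell \<sigma>' 16 = (cell \<sigma> 16)(scalar \<sigma> 10 := a, scalar \<sigma> 10 + 1 := b)" by (simp add: r16 fr2)
  show "scalar \<sigma>' 10 = scalar \<sigma> 10 + 2" by (simp add: rs)
  show "scalar \<sigma>' x = scalar \<sigma> x" if "x \<notin> {10, 22, 23}" for x using that by (simp add: rs sc2 \<sigma>1_def)
  show "cell \<sigma>' d = cell \<sigma> d" if "d \<notin> {3, 12, 13, 14, 16}" for d using that by (simp add: ro fr2)
qed

text \<open>The counterpart of the degree update in \<open>fill_and_push\<close>: the loss of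
  \<open>v\<close> is balanced exactly if the edge from \<open>a\<close> to \<open>b\<close> is
  new.\<close>

lemma fill_degree:
  assumes g: "graph_on L A" and ab: "Collect (A v) = {a, b} - {n}" "a = b \<Longrightarrow> a = n" "a = n \<Longrightarrow> b = n"
    and x: "x \<noteq> v" "x \<noteq> n"
  shows "card (Collect (fill v A x)) =
    (if x = a \<or> x = b then (if b \<noteq> n \<and> \<not> A a b then card (Collect (A x)) else card (Collect (A x)) - 1)
     else card (Collect (A x)))"
proof -
  have sym: "A x y \<longleftrightarrow> A y x" "\<not> A x x" for x y using g unfolding graph_on_def by blast+
  have fin: "finite (Collect (A x))" using g by (rule graph_on_finite_nbrs)
  have Av: "A v y \<longleftrightarrow> (y = a \<or> y = b) \<and> y \<noteq> n" for y using ab(1) by blast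
  show ?thesis
  proof (cases "x = a \<or> x = b")
    case False
    then have "\<not> A x v" using Av sym by blast
    then have "Collect (fill v A x) = Collect (A x)" using x by (auto simp: fill_def)
    then show ?thesis using False by simp
  next
    case True
    then have xv: "A x v" using Av sym x by blast
    then have c1: "card (Collect (A x) - {v}) = card (Collect (A x)) - 1" "0 < card (Collect (A x))"
      using fin by (auto simp: card_Diff_singleton card_gt_0_iff)
    show ?thesis
    proof (cases "b = n")
      case b: True
      then have "x = a" using True x by simp
      then have "Collect (fill v A x) = Collect (A x) - {v}" using Av b x sym by (auto simp: fill_def)
      then show ?thesis using True b c1 by simp
    next
      case b: False
      then have n: "a \<noteq> n" "a \<noteq> b" using ab by auto
      define y where "y = (if x = a then b else a)"
      have y: "x \<noteq> y" "{x, y} = {a, b}" using n True by (auto simp: y_def)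
      have Avy: "A v z \<longleftrightarrow> z = x \<or> z = y" for z using Av y(2) b n by blast
      have vy: "y \<noteq> v" using Avy sym by blast
      have N: "Collect (fill v A x) = insert y (Collect (A x) - {v})"
        using Avy xv vy y(1) x(1) by (auto simp: fill_def)
      have xy: "A x y \<longleftrightarrow> A a b" using True sym by (auto simp: y_def)
      show ?thesis
      proof (cases "A x y")
        case T: True
        then have "Collect (fill v A x) = Collect (A x) - {v}" using N vy by auto
        then show ?thesis using T True xy c1 by simp
      next
        case F: False
        then have "card (Collect (fill v A x)) = Suc (card (Collect (A x) - {v}))" using N fin by simp
        then show ?thesis using F True xy c1 b by simp
      qed
    qed
  qed
qed

text \<open>Deleting a vertex amounts to setting its flag. No list or matrix entry has to be
  removed, since \<open>fill\<close> never deletes an edge between two survivors.\<close>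

definition nbr :: "nat \<Rightarrow> state \<Rightarrow> nat \<Rightarrow> nat \<Rightarrow> bool" where
  "nbr n \<sigma> x y \<longleftrightarrow> x \<in> live n \<sigma> \<and> y \<in> live n \<sigma> \<and> hist n \<sigma> x y"

lemma graph_on_nbr: "hist_ok n \<sigma> \<Longrightarrow> graph_on (live n \<sigma>) (nbr n \<sigma>)"
  unfolding graph_on_def nbr_def hist_ok_def by (auto simp: live_def)

text \<open>The summand \<open>490 * card L\<close> reserves node numbers for the eliminations to
  come, so that the total remains linear. The dummies are among the pairs because missing neighbours
  are served by tables of empty pieces.\<close>

definition tables :: "nat \<Rightarrow> nat set set \<Rightarrow> nat set \<Rightarrow> (nat \<Rightarrow> nat \<Rightarrow> bool) \<Rightarrow> (nat \<Rightarrow> nat set) \<Rightarrow> (nat \<Rightarrow> nat set) \<Rightarrow> state \<Rightarrow> bool" where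
  "tables n E L A h P \<sigma> \<longleftrightarrow> owners n E L A h \<and> store_ok n \<sigma> P \<and> scalar \<sigma> 16 + 490 * card L \<le> 3 + 490 * n \<and>
     (\<forall>x \<in> L \<union> {n, n + 1}. \<forall>y \<in> L \<union> {n, n + 1}. x \<noteq> y \<longrightarrow> tab n E \<sigma> P (pieces n L h x y) x y)"

definition elim_head :: cmd where
  "elim_head = seqs [Assign 5 (Var 0), Assign 6 (Var 0), Assign 8 (Const 0)]"

text \<open>\<open>inc (ix (Var 4) 0)\<close> addresses the pair of \<open>v\<close> and
  \<open>n + 1\<close>: one past the pair of \<open>v\<close> and \<open>n\<close>.\<close>

definition elim_mid :: cmd where
  "elim_mid = seqs [Write 15 (Var 4) (Const 1),
     Cond (Bin Equal (Var 6) (Var 0)) (Assign 7 (inc (Var 0))) (Assign 7 (Var 6)),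
     Assign 11 (Bin Times (ix (Var 5) 7) (Const 16)), Assign 12 (Bin Times (ix (Var 7) 5) (Const 16)),
     Assign 13 (Bin Times (ix (Var 4) 5) (Const 16)), Assign 14 (Bin Times (ix (Var 4) 6) (Const 16)),
     Assign 15 (Bin Times (inc (ix (Var 4) 0)) (Const 16))]"

definition elim_rest :: cmd where
  "elim_rest = Seq elim_mid (Seq combine fill_and_push)"

definition eliminate :: cmd where
  "eliminate = Seq elim_head (Seq scan elim_rest)"

definition pop :: cmd where
  "pop = seqs [Assign 4 (Read 16 (Var 3)), Assign 3 (inc (Var 3))]"

text \<open>Dropping a vertex of high degree from the queue is safe: \<open>fill_and_push\<close>
  queues the neighbours of each eliminated vertex, the only ones whose degree can fall.\<close>

definition skip_test :: exp where
  "skip_test = Bin Plus (Read 15 (Var 4)) (Bin Less (Const 2) (Read 14 (Var 4)))"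

definition main_guard :: exp where
  "main_guard = Bin Less (Var 3) (Var 10)"

definition main_loop :: cmd where
  "main_loop = While main_guard (Seq pop (Cond skip_test Skip eliminate))"

text \<open>The 3 pays for the step of \<open>Cond\<close>, for \<open>Skip\<close> and for the step
  of the loop test.\<close>

definition pop_time :: nat where
  "pop_time = stime pop + cost skip_test + cost main_guard + 3"

text \<open>Two queue items are pushed. Of the three units of \<open>scan_time\<close>, two pay for
  list entries caused by a new edge and one for the exit from the scan.\<close>

definition elim_time :: nat where
  "elim_time = 2 * pop_time + 3 * scan_time + stime elim_head + stime elim_rest"

text \<open>
  A vertex is scanned only when it is eliminated, so its neighbour list is paid for once. An elimination
  adds two items to the queue and lengthens the lists by at most two items, which its own share pays for.
\<close>

definition pot :: "nat \<Rightarrow> state \<Rightarrow> nat" where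
  "pot n \<sigma> = pop_time * (scalar \<sigma> 10 - scalar \<sigma> 3) + elim_time * card (live n \<sigma>) +
     scan_time * (\<Sum>x \<in> live n \<sigma>. cell \<sigma> 12 x)"

text \<open>The vertices in X need not be waiting in the queue.\<close>

definition minv :: "nat \<Rightarrow> nat set set \<Rightarrow> nat \<Rightarrow> nat set \<Rightarrow> state \<Rightarrow> bool" where
  "minv n E B X \<sigma> \<longleftrightarrow> bounded_by B \<sigma> \<and> scalar \<sigma> 0 = n \<and> scalar \<sigma> 2 = n + 2 \<and> cell \<sigma> 15 n \<noteq> 0 \<and>
     cell \<sigma> 2 = (\<lambda>_. 0) \<and> cell \<sigma> 11 = (\<lambda>_. 0) \<and> hist_ok n \<sigma> \<and>
     (\<forall>x \<in> live n \<sigma>. cell \<sigma> 14 x = card (Collect (nbr n \<sigma> x))) \<and> reducible (live n \<sigma>) (nbr n \<sigma>) \<and>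
     scalar \<sigma> 3 \<le> scalar \<sigma> 10 \<and> scalar \<sigma> 10 + 2 * card (live n \<sigma>) = 3 * n \<and>
     (\<forall>j < scalar \<sigma> 10. cell \<sigma> 16 j \<le> n) \<and>
     (\<forall>x \<in> live n \<sigma> - X. cell \<sigma> 14 x \<le> 2 \<longrightarrow> (\<exists>j. scalar \<sigma> 3 \<le> j \<and> j < scalar \<sigma> 10 \<and> cell \<sigma> 16 j = x)) \<and>
     (\<exists>h P. tables n E (live n \<sigma>) (nbr n \<sigma>) h P \<sigma>)"

text \<open>The square dominates the table addresses, which lie below 16 * (n + 2) ^ 2; the factor
  1000 leaves room for the node numbers, of the order of 490 * n.\<close>

definition big :: "nat \<Rightarrow> nat \<Rightarrow> bool" where
  "big n B \<longleftrightarrow> 1000 * ((n + 2) * (n + 2)) \<le> B"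

lemma bigD:
  assumes "big n B"
  shows "1000 * n + 2000 \<le> B" "16 * ((n + 2) * (n + 2)) < B"
proof -
  define k where "k = (n + 2) * (n + 2)"
  have k: "n + 2 \<le> k" by (simp add: k_def)
  have B: "1000 * k \<le> B" using assms by (simp only: big_def k_def)
  have "1000 * n + 2000 \<le> B" using k B by simp
  moreover have "16 * k < B" using k B by simp
  ultimately show "1000 * n + 2000 \<le> B" "16 * ((n + 2) * (n + 2)) < B" by (simp_all only: k_def)
qed

lemma live_finite: "finite (live n \<sigma>)" and live_card: "card (live n \<sigma>) \<le> n"
proof -
  have s: "live n \<sigma> \<subseteq> {..<n}" by (auto simp: live_def)
  then show "finite (live n \<sigma>)" by (rule finite_subset) simp
  show "card (live n \<sigma>) \<le> n" using card_mono[OF _ s] by simp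
qed

text \<open>\<open>v\<close> has left the queue but is still live, hence the exception
  \<open>{v}\<close> in the hypothesis. The drop of the potential also pays for
  \<open>elim_head\<close> and \<open>scan\<close>, which run before and leave the potential
  unchanged.\<close>

lemma elim_rest_spec:
  assumes inv: "minv n E B {v} \<sigma>" and B: "big n B" and E: "edges_below n E"
    and sc: "scalar \<sigma> 4 = v" "scalar \<sigma> 5 = a" "scalar \<sigma> 6 = b"
    and v: "v \<in> live n \<sigma>" "cell \<sigma> 14 v \<le> 2"
    and ab: "Collect (hist n \<sigma> v) \<inter> live n \<sigma> = {a, b} - {n}" "a \<in> live n \<sigma> \<union> {n}" "b \<in> live n \<sigma> \<union> {n}"
      "a = b \<longrightarrow> a = n" "a = n \<longrightarrow> b = n"
  shows "small B elim_rest \<sigma>"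
    and "minv n E B {} (run elim_rest \<sigma>)"
    and "pot n (run elim_rest \<sigma>) + scan_time * cell \<sigma> 12 v + scan_time + stime elim_head + stime elim_rest \<le> pot n \<sigma>"
proof -
  let ?L = "live n \<sigma>" and ?A = "nbr n \<sigma>"
  define c where "c = (if b = n then n + 1 else b)"
  have ab': "a = b \<Longrightarrow> a = n" "a = n \<Longrightarrow> b = n" using ab(4,5) by blast+
  note i = inv[unfolded minv_def]
  have bd: "bounded_by B \<sigma>" using i by (elim conjE)
  have "scalar \<sigma> 0 = n" using i by (elim conjE)
  moreover have "scalar \<sigma> 2 = n + 2" using i by (elim conjE)
  ultimately have s0: "scalar \<sigma> 0 = n" "scalar \<sigma> 2 = n + 2" .
  have ok: "hist_ok n \<sigma>" using i by (elim conjE)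
  have deg: "\<And>x. x \<in> ?L \<Longrightarrow> cell \<sigma> 14 x = card (Collect (?A x))" using i by (elim conjE) blast
  have red: "reducible ?L ?A" using i by (elim conjE)
  have "scalar \<sigma> 3 \<le> scalar \<sigma> 10" using i by (elim conjE)
  moreover have "scalar \<sigma> 10 + 2 * card ?L = 3 * n" using i by (elim conjE)
  ultimately have tl: "scalar \<sigma> 3 \<le> scalar \<sigma> 10" "scalar \<sigma> 10 + 2 * card ?L = 3 * n" .
  have qu: "\<And>j. j < scalar \<sigma> 10 \<Longrightarrow> cell \<sigma> 16 j \<le> n" using i by (elim conjE) blast
  have wait: "\<exists>j. scalar \<sigma> 3 \<le> j \<and> j < scalar \<sigma> 10 \<and> cell \<sigma> 16 j = x"
    if "x \<in> ?L" "x \<noteq> v" "cell \<sigma> 14 x \<le> 2" for x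
  proof -
    have "\<forall>x \<in> live n \<sigma> - {v}. cell \<sigma> 14 x \<le> 2 \<longrightarrow> (\<exists>j. scalar \<sigma> 3 \<le> j \<and> j < scalar \<sigma> 10 \<and> cell \<sigma> 16 j = x)"
      using i by (elim conjE)
    then show ?thesis using that by blast
  qed
  have "\<exists>h P. tables n E ?L ?A h P \<sigma>" using i by (elim conjE)
  then obtain h P where tbl: "tables n E ?L ?A h P \<sigma>" by blast
  then have own: "owners n E ?L ?A h" and st: "store_ok n \<sigma> P" and np: "scalar \<sigma> 16 + 490 * card ?L \<le> 3 + 490 * n"
    and tabs: "\<And>x y. x \<in> ?L \<union> {n, n + 1} \<Longrightarrow> y \<in> ?L \<union> {n, n + 1} \<Longrightarrow> x \<noteq> y \<Longrightarrow> tab n E \<sigma> P (pieces n ?L h x y) x y"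
    unfolding tables_def by blast+
  have g: "graph_on ?L ?A" using ok by (rule graph_on_nbr)
  have "Collect (?A v) = Collect (hist n \<sigma> v) \<inter> ?L" using v(1) unfolding nbr_def by blast
  then have Nv: "Collect (?A v) = {a, b} - {n}" using ab(1) by simp
  note ctx = E own g v(1) Nv ab(2,3) ab' c_def
  note big = bigD[OF B]
  have vn: "v < n" using v(1) by (simp add: live_def)
  have an: "a \<le> n" "b \<le> n" "c < n + 2" using ab(2,3) unfolding live_def c_def by auto
  have cL: "1 \<le> card ?L" using v(1) live_finite[of n \<sigma>] by (simp add: Suc_le_eq card_gt_0_iff) blast

  define \<sigma>m where "\<sigma>m = run elim_mid \<sigma>"
  define \<sigma>c where "\<sigma>c = run combine \<sigma>m"
  define \<sigma>t where "\<sigma>t = run fill_and_push \<sigma>c"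
  have rt: "run elim_rest \<sigma> = \<sigma>t" by (simp add: elim_rest_def \<sigma>t_def \<sigma>c_def \<sigma>m_def)

  have mid: "scalar \<sigma>m = (scalar \<sigma>)(7 := c, 11 := base n a c, 12 := base n c a, 13 := base n v a, 14 := base n v b,
      15 := base n v (n + 1))" "cell \<sigma>m = (cell \<sigma>)(15 := (cell \<sigma> 15)(v := 1))"
    using sc s0 by (auto simp: \<sigma>m_def elim_mid_def base_def c_def algebra_simps)
  have "16 * ((x * (n + 2)) + y) < B" if "x < n + 2" "y < n + 2" for x y
    using base_less[OF that] big(2) by (simp add: base_def)
  then have bs: "base n x y < B" if "x < n + 2" "y < n + 2" for x y
    using base_less[OF that] big(2) by linarith
  have smm: "small B elim_mid \<sigma>"
    using sc s0 bs[of a c] bs[of c a] bs[of v a] bs[of v b] bs[of v "n + 1"] an vn big(1)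
    by (auto simp: elim_mid_def base_def c_def algebra_simps)
  have bdm: "bounded_by B \<sigma>m" unfolding \<sigma>m_def using bd smm by (rule run_bounded)
  have tm: "tab n E \<sigma>m P D x y" if "tab n E \<sigma> P D x y" for D x y
    by (rule tab_mono[OF that]) (simp_all add: mid entry_def)
  have stm: "store_ok n \<sigma>m P" using st unfolding store_ok_def by (simp add: mid)
  have scm: "scalar \<sigma>m 4 = v" "scalar \<sigma>m 11 = base n a c" "scalar \<sigma>m 12 = base n c a"
      "scalar \<sigma>m 13 = base n v a" "scalar \<sigma>m 14 = base n v b" "scalar \<sigma>m 15 = base n v (n + 1)"
      "scalar \<sigma>m 16 = scalar \<sigma> 16" "scalar \<sigma>m 5 = a" "scalar \<sigma>m 6 = b" "scalar \<sigma>m 0 = n" "scalar \<sigma>m 2 = n + 2"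
      "scalar \<sigma>m 10 = scalar \<sigma> 10" "scalar \<sigma>m 3 = scalar \<sigma> 3"
    using sc s0 by (simp_all add: mid)
  have npm: "scalar \<sigma>m 16 + 491 < B" "4 * n + 5 < B" "a < n + 2" using scm(7) np big(1) an by simp_all
  note el = elimination_step[OF ctx]
  note nq = v_neq[OF ctx] a_neq_c[OF ctx]
  have memb: "a \<in> ?L \<union> {n, n + 1}" "b \<in> ?L \<union> {n, n + 1}" "c \<in> ?L \<union> {n, n + 1}" "v \<in> ?L \<union> {n, n + 1}"
    using ab(2,3) v(1) by (auto simp: c_def)
  note comb = combine_tables[OF el tm[OF tabs[OF memb(1,3) nq(6)]] tm[OF tabs[OF memb(4,1) nq(1)]]
    tm[OF tabs[OF memb(4,2) nq(2)]] tm[OF tabs[OF memb(4) _ nq(5)]] stm scm(1-6) npm(1,2) vn npm(3) an(3), folded \<sigma>c_def, simplified]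
  obtain P' where stc: "store_ok n \<sigma>c P'"
    and new: "tab n E \<sigma>c P' (elimination.D (pieces n ?L h a c) (pieces n ?L h v a) (pieces n ?L h v b) (pieces n ?L h v (n + 1)) v) a c"
      "tab n E \<sigma>c P' (elimination.D (pieces n ?L h a c) (pieces n ?L h v a) (pieces n ?L h v b) (pieces n ?L h v (n + 1)) v) c a"
    and old: "\<And>D x y. y < n + 2 \<Longrightarrow> {x, y} \<noteq> {a, c} \<Longrightarrow> tab n E \<sigma>m P D x y \<Longrightarrow> tab n E \<sigma>c P' D x y"
    using comb(6) by auto
  have bdc: "bounded_by B \<sigma>c" unfolding \<sigma>c_def using bdm comb(1) by (rule run_bounded)
  have frc: "cell \<sigma>c d = cell \<sigma>m d" if "d \<notin> {4, 5, 6, 7, 8, 9, 10, 17}" for d using comb(2) that by simp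
  have scc: "scalar \<sigma>c x = scalar \<sigma>m x" if "x \<notin> {16, 17, 18, 19, 20, 21}" for x using comb(3) that by simp
  have cc: "cell \<sigma>c 2 = cell \<sigma> 2" "cell \<sigma>c 3 = cell \<sigma> 3" "cell \<sigma>c 11 = cell \<sigma> 11" "cell \<sigma>c 12 = cell \<sigma> 12" "cell \<sigma>c 13 = cell \<sigma> 13"
    "cell \<sigma>c 14 = cell \<sigma> 14" "cell \<sigma>c 15 = (cell \<sigma> 15)(v := 1)" "cell \<sigma>c 16 = cell \<sigma> 16"
    by (simp_all add: frc mid)
  have sc': "scalar \<sigma>c 0 = n" "scalar \<sigma>c 2 = n + 2" "scalar \<sigma>c 5 = a" "scalar \<sigma>c 6 = b" "scalar \<sigma>c 10 = scalar \<sigma> 10"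
    "scalar \<sigma>c 3 = scalar \<sigma> 3"
    by (simp_all add: scc scm)
  have okc: "hist_ok n \<sigma>c" using ok hist_ok_cong[of \<sigma>c \<sigma>] cc by simp
  have hc: "hist n \<sigma>c = hist n \<sigma>" by (rule hist_cong) (simp add: cc)
  have B2: "n + 2 < B" "scalar \<sigma>c 10 + 2 < B" using big(1) tl(2) sc'(5) by simp_all
  have dle: "x \<in> ?L \<Longrightarrow> cell \<sigma> 14 x \<le> n" for x
  proof -
    assume "x \<in> ?L"
    then have "cell \<sigma> 14 x = card (Collect (?A x))" by (rule deg)
    also have "\<dots> \<le> card (Collect (hist n \<sigma> x))" by (rule card_mono[OF finite_hist]) (auto simp: nbr_def)
    finally show ?thesis using card_hist_le le_trans by blast
  qed
  have dc: "a < n \<longrightarrow> cell \<sigma>c 14 a \<le> n" "b < n \<longrightarrow> cell \<sigma>c 14 b \<le> n" using dle ab(2,3) cc by auto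
  note push = fill_and_push_spec[OF bdc B2 sc'(1-4) okc an(1,2) ab(4,5) dc, folded \<sigma>t_def, unfolded hc cc sc']
  show sm: "small B elim_rest \<sigma>"
    using smm comb(1) push(1) by (simp add: elim_rest_def \<sigma>t_def \<sigma>c_def \<sigma>m_def)

  have live_t: "live n \<sigma>t = ?L - {v}" using push(8)[of 15] cc(7) by (auto simp: live_def)
  have AvD: "?A v y \<longleftrightarrow> (y = a \<or> y = b) \<and> y \<noteq> n" for y using Nv by blast
  have symA: "?A x y \<longleftrightarrow> ?A y x" for x y using g unfolding graph_on_def by blast
  have nbr_t: "nbr n \<sigma>t = fill v ?A"
  proof (intro ext)
    fix x y
    have "?A x v \<longleftrightarrow> (x = a \<or> x = b) \<and> x \<noteq> n" using symA[of x v] AvD[of x] by simp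
    note A_iff = this AvD[of y]
    have "x \<noteq> y \<and> ?A x v \<and> ?A v y \<longleftrightarrow> b \<noteq> n \<and> (x = a \<and> y = b \<or> x = b \<and> y = a)"
    proof (cases "b = n")
      case True
      then show ?thesis unfolding A_iff by blast
    next
      case False
      then have "a \<noteq> n" "a \<noteq> b" using ab' by blast+
      then show ?thesis using False unfolding A_iff by blast
    qed
    then have f: "fill v ?A x y \<longleftrightarrow> x \<noteq> v \<and> y \<noteq> v \<and> (?A x y \<or> b \<noteq> n \<and> (x = a \<and> y = b \<or> x = b \<and> y = a))"
      unfolding fill_def by blast
    have e: "nbr n \<sigma>t x y \<longleftrightarrow> x \<in> ?L - {v} \<and> y \<in> ?L - {v} \<and>
      (hist n \<sigma> x y \<or> b \<noteq> n \<and> (x = a \<and> y = b \<or> x = b \<and> y = a))"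
      unfolding nbr_def[of n \<sigma>t] live_t push(3) ..
    have abL: "a \<in> ?L - {v} \<and> b \<in> ?L - {v}" if "b \<noteq> n"
      using that ab(2,3) ab'(2) nq(1,2) by auto
    show "nbr n \<sigma>t x y = fill v ?A x y"
    proof (cases "b \<noteq> n \<and> (x = a \<and> y = b \<or> x = b \<and> y = a)")
      case True
      then show ?thesis unfolding e f using abL by blast
    next
      case False
      then show ?thesis unfolding e f by (simp add: nbr_def) blast
    qed
  qed
  \<comment> \<open>Without a missing neighbour both ends are live, so the historical matrix agrees
    with the current graph at this pair.\<close>
  have hA: "hist n \<sigma> a b \<longleftrightarrow> ?A a b" if "b \<noteq> n" using that ab(2,3) ab'(2) unfolding nbr_def by blast
  have deg_t: "cell \<sigma>t 14 x = card (Collect (fill v ?A x))" if "x \<in> ?L - {v}" for x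
  proof -
    have x: "x < n" "x \<in> ?L" "x \<noteq> v" using that by (auto simp: live_def)
    show ?thesis
      using push(4)[OF x(1)] fill_degree[OF g Nv ab' x(3)] x(1) deg[OF x(2)] hA by (auto split: if_splits)
  qed
  have tab_t: "tab n E \<sigma>t P' (pieces n (?L - {v}) (reown h v {a, c}) x y) x y"
    if xy: "x \<in> ?L - {v} \<union> {n, n + 1}" "y \<in> ?L - {v} \<union> {n, n + 1}" "x \<noteq> y" for x y
  proof -
    have "tab n E \<sigma>c P' (pieces n (?L - {v}) (reown h v {a, c}) x y) x y"
    proof (cases "{x, y} = {a, c}")
      case True
      then consider "x = a" "y = c" | "x = c" "y = a" by (auto simp: doubleton_eq_iff)
      then show ?thesis using new pieces_step[OF ctx xy(1,2)] True by cases auto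
    next
      case False
      have "y < n + 2" using xy(2) by (auto simp: live_def)
      moreover have "tab n E \<sigma>m P (pieces n ?L h x y) x y" using xy by (intro tm tabs) auto
      ultimately show ?thesis using old False pieces_step[OF ctx xy(1,2)] by simp
    qed
    then show ?thesis by (rule tab_mono) (simp_all add: push(7,8) entry_def)
  qed
  have npc: "scalar \<sigma>t 16 + 490 * card (?L - {v}) \<le> 3 + 490 * n"
  proof -
    have "card ?L = Suc (card (?L - {v}))" using card.remove[OF live_finite v(1)] .
    then show ?thesis using comb(5) np scm(7) push(7)[of 16] by simp
  qed
  have tbl_t: "tables n E (live n \<sigma>t) (nbr n \<sigma>t) (reown h v {a, c}) P' \<sigma>t"
    unfolding tables_def live_t nbr_t
  proof (intro conjI ballI impI)
    show "owners n E (?L - {v}) (fill v ?A) (reown h v {a, c})" by (rule owners_step[OF ctx])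
    show "store_ok n \<sigma>t P'" using stc unfolding store_ok_def by (simp add: push(7,8))
  qed (use npc tab_t in auto)
  have cardL: "card ?L = Suc (card (?L - {v}))" using card.remove[OF live_finite v(1)] .
  have bdt: "bounded_by B \<sigma>t" unfolding \<sigma>t_def using bdc push(1) by (rule run_bounded)
  have red_t: "reducible (?L - {v}) (fill v ?A)"
    using reducible_fill[OF red g v(1)] v(2) deg[OF v(1)] by simp
  show "minv n E B {} (run elim_rest \<sigma>)"
    unfolding minv_def rt live_t nbr_t
  proof (intro conjI ballI allI impI)
    show "bounded_by B \<sigma>t" by (fact bdt)
    show "scalar \<sigma>t 0 = n" "scalar \<sigma>t 2 = n + 2" using sc' by (simp_all add: push(7))
    show "cell \<sigma>t 15 n \<noteq> 0" "cell \<sigma>t 2 = (\<lambda>_. 0)" "cell \<sigma>t 11 = (\<lambda>_. 0)"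
      using inv vn by (simp_all add: push(8) cc minv_def)
    show "hist_ok n \<sigma>t" by (fact push(2))
    show "reducible (?L - {v}) (fill v ?A)" by (fact red_t)
    show "scalar \<sigma>t 3 \<le> scalar \<sigma>t 10" using tl(1) by (simp add: push(6,7) sc')
    show "scalar \<sigma>t 10 + 2 * card (?L - {v}) = 3 * n" using tl(2) cardL by (simp add: push(6))
    show "\<exists>h P. tables n E (?L - {v}) (fill v ?A) h P \<sigma>t" using tbl_t unfolding live_t nbr_t by blast
  next
    fix x assume "x \<in> ?L - {v}"
    then show "cell \<sigma>t 14 x = card (Collect (fill v ?A x))" by (rule deg_t)
  next
    fix j assume "j < scalar \<sigma>t 10"
    then have "j < scalar \<sigma> 10 \<or> j = scalar \<sigma> 10 \<or> j = scalar \<sigma> 10 + 1" by (auto simp: push(6))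
    then show "cell \<sigma>t 16 j \<le> n" using qu an by (auto simp: push(5))
  next
    \<comment> \<open>Degrees change only at \<open>a\<close> and \<open>b\<close>, and both have
      just been appended to the queue. Any other vertex of low degree had low degree before and
      keeps its place.\<close>
    fix x assume x: "x \<in> ?L - {v} - {}" and dx: "cell \<sigma>t 14 x \<le> 2"
    show "\<exists>j\<ge>scalar \<sigma>t 3. j < scalar \<sigma>t 10 \<and> cell \<sigma>t 16 j = x"
    proof (cases "x = a \<or> x = b")
      case True
      then show ?thesis
      proof
        assume "x = a"
        then show ?thesis using tl(1) by (intro exI[of _ "scalar \<sigma> 10"]) (simp add: push(5-7) sc')
      next
        assume "x = b"
        then show ?thesis using tl(1) by (intro exI[of _ "scalar \<sigma> 10 + 1"]) (simp add: push(5-7) sc')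
      qed
    next
      case False
      then have "cell \<sigma> 14 x \<le> 2" using dx x push(4)[of x] by (auto simp: live_def)
      then obtain j where "scalar \<sigma> 3 \<le> j" "j < scalar \<sigma> 10" "cell \<sigma> 16 j = x" using wait[of x] x by blast
      then show ?thesis by (intro exI[of _ j]) (simp add: push(5-7) sc')
    qed
  qed
  \<comment> \<open>Lists grow only at the ends of a new edge, by one entry each; the two units of
    \<open>scan_time\<close> in \<open>elim_time\<close> cover this growth.\<close>
  have cnt_t: "cell \<sigma>t 12 x \<le> cell \<sigma> 12 x + (if x = a \<or> x = b then 1 else 0)" if "x < n" for x
  proof -
    define y where "y = (if x = a then b else a)"
    have "Collect (hist n \<sigma>t x) \<subseteq> Collect (hist n \<sigma> x) \<union> (if x = a \<or> x = b then {y} else {})"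
      unfolding push(3) by (auto simp: y_def)
    then have "card (Collect (hist n \<sigma>t x)) \<le> card (Collect (hist n \<sigma> x) \<union> (if x = a \<or> x = b then {y} else {}))"
      by (rule card_mono[rotated]) (simp add: finite_hist)
    also have "\<dots> \<le> card (Collect (hist n \<sigma> x)) + card (if x = a \<or> x = b then {y} else {})" by (rule card_Un_le)
    also have "\<dots> = card (Collect (hist n \<sigma> x)) + (if x = a \<or> x = b then 1 else 0)" by simp
    finally show ?thesis using hist_ok_count[OF push(2) that] hist_ok_count[OF ok that] by simp
  qed
  have "(\<Sum>x \<in> ?L - {v}. cell \<sigma>t 12 x) \<le> (\<Sum>x \<in> ?L - {v}. cell \<sigma> 12 x + (if x = a \<or> x = b then 1 else 0))"
    by (rule sum_mono) (use cnt_t in \<open>auto simp: live_def\<close>)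
  also have "\<dots> = (\<Sum>x \<in> ?L - {v}. cell \<sigma> 12 x) + card ((?L - {v}) \<inter> {a, b})"
  proof -
    have "(\<Sum>x \<in> ?L - {v}. if x = a \<or> x = b then 1 else 0) = card ((?L - {v}) \<inter> {a, b})"
      using live_finite[of n \<sigma>] by (simp add: sum.If_cases Int_def disj_commute)
    then show ?thesis by (simp add: sum.distrib)
  qed
  also have "card ((?L - {v}) \<inter> {a, b}) \<le> card {a, b}" by (rule card_mono) auto
  also have "card {a, b} \<le> 2" by (simp add: card_insert_if)
  also have "(\<Sum>x \<in> ?L - {v}. cell \<sigma> 12 x) = (\<Sum>x \<in> ?L. cell \<sigma> 12 x) - cell \<sigma> 12 v"
    using live_finite[of n \<sigma>] v(1) by (simp add: sum_diff1_nat)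
  finally have "(\<Sum>x \<in> ?L - {v}. cell \<sigma>t 12 x) \<le> (\<Sum>x \<in> ?L. cell \<sigma> 12 x) - cell \<sigma> 12 v + 2" by simp
  moreover have "cell \<sigma> 12 v \<le> (\<Sum>x \<in> ?L. cell \<sigma> 12 x)" using v(1) live_finite by (intro member_le_sum) auto
  ultimately have sums: "(\<Sum>x \<in> ?L - {v}. cell \<sigma>t 12 x) + cell \<sigma> 12 v \<le> (\<Sum>x \<in> ?L. cell \<sigma> 12 x) + 2" by linarith
  have "scan_time * (\<Sum>x \<in> ?L - {v}. cell \<sigma>t 12 x) + scan_time * cell \<sigma> 12 v \<le> scan_time * (\<Sum>x \<in> ?L. cell \<sigma> 12 x) + 2 * scan_time"
    using mult_le_mono2[OF sums, of scan_time] by (simp add: algebra_simps)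
  moreover have "pop_time * (scalar \<sigma>t 10 - scalar \<sigma>t 3) = pop_time * (scalar \<sigma> 10 - scalar \<sigma> 3) + 2 * pop_time"
    using tl(1) by (simp add: push(6,7) sc' Suc_diff_le)
  moreover have "elim_time * card ?L = elim_time * card (?L - {v}) + elim_time" by (simp add: cardL)
  ultimately show "pot n (run elim_rest \<sigma>) + scan_time * cell \<sigma> 12 v + scan_time + stime elim_head + stime elim_rest \<le> pot n \<sigma>"
    unfolding rt pot_def live_t by (simp add: elim_time_def)
qed

section \<open>The main loop and the output\<close>

text \<open>A frame rule for steps that change scalars only. Moving the head of the queue has to be
  justified anew, possibly with a different set of exceptions.\<close>

lemma minv_change:
  assumes inv: "minv n E B X \<sigma>" and cell: "cell \<sigma>' = cell \<sigma>" and bd: "bounded_by B \<sigma>'"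
    and sc: "scalar \<sigma>' 0 = scalar \<sigma> 0" "scalar \<sigma>' 2 = scalar \<sigma> 2" "scalar \<sigma>' 10 = scalar \<sigma> 10" "scalar \<sigma>' 16 = scalar \<sigma> 16"
    and le: "scalar \<sigma>' 3 \<le> scalar \<sigma> 10"
    and wait: "\<forall>x \<in> live n \<sigma> - X'. cell \<sigma> 14 x \<le> 2 \<longrightarrow>
      (\<exists>j. scalar \<sigma>' 3 \<le> j \<and> j < scalar \<sigma> 10 \<and> cell \<sigma> 16 j = x)"
  shows "minv n E B X' \<sigma>'"
proof -
  have eq: "live n \<sigma>' = live n \<sigma>" "nbr n \<sigma>' = nbr n \<sigma>" "hist_ok n \<sigma>' = hist_ok n \<sigma>"
    using hist_cong[of \<sigma>' \<sigma> n] hist_ok_cong[of \<sigma>' \<sigma> n] cell by (auto simp: live_def nbr_def fun_eq_iff)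
  have "tables n E L A h P \<sigma>'" if "tables n E L A h P \<sigma>" for L A h P
  proof -
    have "tab n E \<sigma>' P D x y" if "tab n E \<sigma> P D x y" for D x y
      by (rule tab_mono[OF that]) (simp_all add: cell sc entry_def)
    moreover have "store_ok n \<sigma>' P = store_ok n \<sigma> P" by (simp add: store_ok_def cell sc)
    ultimately show ?thesis using that unfolding tables_def sc by blast
  qed
  then show ?thesis using inv bd le wait unfolding minv_def eq cell sc by blast
qed

lemma main_static:
  "loop_free pop" "ctame pop" "tame skip_test" "tame main_guard" "loop_free elim_head" "ctame elim_head"
  "loop_free elim_rest" "ctame elim_rest"
  using combine_static add_edge_static
  by (simp_all add: pop_def skip_test_def main_guard_def elim_head_def elim_rest_def elim_mid_def fill_and_push_def tame_def)

lemma eliminate_spec: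
  assumes inv: "minv n E B {v} \<sigma>" and B: "big n B" and E: "edges_below n E"
    and sc: "scalar \<sigma> 4 = v" and v: "v \<in> live n \<sigma>" "cell \<sigma> 14 v \<le> 2"
  defines "t \<equiv> stime elim_head + (scan_time * cell \<sigma> 12 v + scan_time + stime elim_rest)"
  shows "tri (B ^ 8) eliminate \<sigma> t (\<lambda>\<sigma>'. minv n E B {} \<sigma>' \<and> pot n \<sigma>' + t \<le> pot n \<sigma>)"
proof -
  have bd: "bounded_by B \<sigma>" and s2: "scalar \<sigma> 2 = n + 2" and s0: "scalar \<sigma> 0 = n" and ok: "hist_ok n \<sigma>"
    and deg: "cell \<sigma> 14 v = card (Collect (nbr n \<sigma> v))"
    using inv v(1) by (simp_all add: minv_def)
  have b: "20 < B" "n + 2 < B" using bigD(1)[OF B] by simp_all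
  have vn: "v < n" using v(1) by (simp add: live_def)
  define \<sigma>1 where "\<sigma>1 = run elim_head \<sigma>"
  have r1: "cell \<sigma>1 = cell \<sigma>" "scalar \<sigma>1 = (scalar \<sigma>)(5 := n, 6 := n, 8 := 0)"
    by (simp_all add: \<sigma>1_def elim_head_def s0)
  have sm: "small B elim_head \<sigma>" using b by (simp add: elim_head_def s0)
  have bd1: "bounded_by B \<sigma>1" unfolding \<sigma>1_def using bd sm by (rule run_bounded)
  have "Collect (nbr n \<sigma> v) = Collect (hist n \<sigma> v) \<inter> live n \<sigma>" using v(1) unfolding nbr_def by blast
  moreover have h1: "hist n \<sigma>1 = hist n \<sigma>" "live n \<sigma>1 = live n \<sigma>" using hist_cong[of \<sigma>1 \<sigma> n] r1 by (simp_all add: live_def)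
  ultimately have d2: "card (Collect (hist n \<sigma>1 v) \<inter> live n \<sigma>1) \<le> 2" using deg v(2) by simp
  have ok1: "hist_ok n \<sigma>1" using ok hist_ok_cong[of \<sigma>1 \<sigma> n] r1(1) by simp
  have sc1: "scalar \<sigma>1 2 = n + 2" "scalar \<sigma>1 4 = v" "scalar \<sigma>1 5 = n" "scalar \<sigma>1 6 = n" "scalar \<sigma>1 8 = 0"
    using s2 sc by (simp_all add: r1)
  note scan = scan_spec[OF bd1 b sc1(1,2) vn sc1(3-5) ok1 d2]
  show ?thesis unfolding eliminate_def t_def
  proof (rule tri_Seq)
    show "tri (B ^ 8) elim_head \<sigma> (stime elim_head) (\<lambda>\<sigma>'. \<sigma>' = \<sigma>1)"
      by (rule tri_run[OF bd b(1) main_static(5,6) sm]) (simp add: \<sigma>1_def)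
  next
    fix \<sigma>' assume "\<sigma>' = \<sigma>1"
    show "tri (B ^ 8) (Seq scan elim_rest) \<sigma>' (scan_time * cell \<sigma> 12 v + scan_time + stime elim_rest)
      (\<lambda>\<sigma>'. minv n E B {} \<sigma>' \<and> pot n \<sigma>' + (stime elim_head + (scan_time * cell \<sigma> 12 v + scan_time + stime elim_rest)) \<le> pot n \<sigma>)"
      unfolding \<open>\<sigma>' = \<sigma>1\<close>
    proof (rule tri_Seq[OF scan[unfolded r1(1)]])
      fix \<rho>
      assume R: "bounded_by B \<rho> \<and> cell \<rho> = cell \<sigma> \<and> (\<forall>x. x \<notin> {5, 6, 8, 9} \<longrightarrow> scalar \<rho> x = scalar \<sigma>1 x) \<and>
        (\<exists>a b. scalar \<rho> 5 = a \<and> scalar \<rho> 6 = b \<and> Collect (hist n \<sigma>1 v) \<inter> live n \<sigma>1 = {a, b} - {n} \<and>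
        a \<in> live n \<sigma>1 \<union> {n} \<and> b \<in> live n \<sigma>1 \<union> {n} \<and> (a = b \<longrightarrow> a = n) \<and> (a = n \<longrightarrow> b = n))"
      then obtain a b where bd2: "bounded_by B \<rho>" and cell: "cell \<rho> = cell \<sigma>"
        and fr: "\<And>x. x \<notin> {5, 6, 8, 9} \<Longrightarrow> scalar \<rho> x = scalar \<sigma>1 x" and ab: "scalar \<rho> 5 = a" "scalar \<rho> 6 = b"
          "Collect (hist n \<sigma>1 v) \<inter> live n \<sigma>1 = {a, b} - {n}" "a \<in> live n \<sigma>1 \<union> {n}" "b \<in> live n \<sigma>1 \<union> {n}"
          "a = b \<longrightarrow> a = n" "a = n \<longrightarrow> b = n" by blast
      have sc2: "scalar \<rho> x = scalar \<sigma> x" if "x \<notin> {5, 6, 8, 9}" for x using fr[OF that] that by (simp add: r1)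
      have h2: "hist n \<rho> = hist n \<sigma>1" "live n \<rho> = live n \<sigma>1" using hist_cong[of \<rho> \<sigma>1 n] r1 cell by (simp_all add: live_def)
      have inv2: "minv n E B {v} \<rho>"
        by (rule minv_change[OF inv cell bd2]) (use inv in \<open>simp_all add: sc2 minv_def\<close>)
      have v2: "scalar \<rho> 4 = v" "v \<in> live n \<rho>" "cell \<rho> 14 v \<le> 2" using sc v h1 h2 cell by (simp_all add: sc2)
      note rest = elim_rest_spec[OF inv2 B E v2(1) ab(1,2) v2(2,3) ab(3-7)[folded h2]]
      have "pot n \<rho> = pot n \<sigma>" unfolding pot_def h2 h1 by (simp add: sc2 cell)
      then show "tri (B ^ 8) elim_rest \<rho> (stime elim_rest)
        (\<lambda>\<sigma>'. minv n E B {} \<sigma>' \<and> pot n \<sigma>' + (stime elim_head + (scan_time * cell \<sigma> 12 v + scan_time + stime elim_rest)) \<le> pot n \<sigma>)"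
        using rest(2,3) by (intro tri_run[OF bd2 b(1) main_static(7,8) rest(1)]) (simp add: cell)
    qed
  qed
qed

lemma main_loop_spec:
  assumes inv0: "minv n E B {} \<sigma>" and B: "big n B" and E: "edges_below n E"
  shows "tri (B ^ 8) main_loop \<sigma> (pot n \<sigma> + cost main_guard + 1) (\<lambda>\<sigma>'. minv n E B {} \<sigma>' \<and> live n \<sigma>' = {})"
proof -
  have b: "20 < B" "n + 2 < B" "3 * n + 2 < B" using bigD(1)[OF B] by simp_all
  define I where "I r \<rho> \<longleftrightarrow> minv n E B {} \<rho> \<and> pot n \<rho> \<le> r" for r \<rho>
  have bdI: "bounded_by B \<rho>" if "minv n E B X \<rho>" for X \<rho> using that by (simp add: minv_def)
  have "tri (B ^ 8) main_loop \<sigma> (pot n \<sigma> + cost main_guard + 1) (\<lambda>\<sigma>'. (\<exists>r'. I r' \<sigma>') \<and> eval \<sigma>' main_guard = 0)"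
    unfolding main_loop_def
  proof (rule tri_While)
    show "I (pot n \<sigma>) \<sigma>" using inv0 by (simp add: I_def)
  next
    fix r \<rho> assume "I r \<rho>"
    then show "fits (B ^ 8) \<rho> main_guard" using bdI b main_static by (intro fits_tame) (auto simp: I_def)
  next
    fix r \<rho> assume I: "I r \<rho>" and g: "eval \<rho> main_guard \<noteq> 0"
    have inv: "minv n E B {} \<rho>" and pr: "pot n \<rho> \<le> r" using I by (simp_all add: I_def)
    have g: "scalar \<rho> 3 < scalar \<rho> 10" using g by (simp add: main_guard_def split: if_splits)
    define v where "v = cell \<rho> 16 (scalar \<rho> 3)"
    define \<sigma>1 where "\<sigma>1 = run pop \<rho>"
    have r1: "cell \<sigma>1 = cell \<rho>" "scalar \<sigma>1 = (scalar \<rho>)(4 := v, 3 := scalar \<rho> 3 + 1)"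
      by (simp_all add: \<sigma>1_def pop_def v_def)
    have i: "\<forall>j<scalar \<rho> 10. cell \<rho> 16 j \<le> n" "scalar \<rho> 10 + 2 * card (live n \<rho>) = 3 * n" "cell \<rho> 15 n \<noteq> 0"
      "\<forall>x \<in> live n \<rho> - {}. cell \<rho> 14 x \<le> 2 \<longrightarrow> (\<exists>j. scalar \<rho> 3 \<le> j \<and> j < scalar \<rho> 10 \<and> cell \<rho> 16 j = x)"
      using inv by (simp_all add: minv_def)
    have vn: "v \<le> n" using i(1) g by (simp add: v_def)
    have sm: "small B pop \<rho>" using vn b i(2) g by (simp add: pop_def v_def)
    have bd: "bounded_by B \<rho>" by (rule bdI[OF inv])
    have bd1: "bounded_by B \<sigma>1" unfolding \<sigma>1_def using bd sm by (rule run_bounded)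
    have wait1: "\<forall>x \<in> live n \<rho> - {v}. cell \<rho> 14 x \<le> 2 \<longrightarrow> (\<exists>j. scalar \<sigma>1 3 \<le> j \<and> j < scalar \<rho> 10 \<and> cell \<rho> 16 j = x)"
    proof (intro ballI impI)
      fix x assume x: "x \<in> live n \<rho> - {v}" "cell \<rho> 14 x \<le> 2"
      then obtain j where j: "scalar \<rho> 3 \<le> j" "j < scalar \<rho> 10" "cell \<rho> 16 j = x" using i(4) by blast
      then have "j \<noteq> scalar \<rho> 3" using x by (auto simp: v_def)
      then show "\<exists>j. scalar \<sigma>1 3 \<le> j \<and> j < scalar \<rho> 10 \<and> cell \<rho> 16 j = x" using j by (intro exI[of _ j]) (simp add: r1)
    qed
    have inv1: "minv n E B {v} \<sigma>1"
      by (rule minv_change[OF inv r1(1) bd1 _ _ _ _ _ wait1]) (use g in \<open>simp_all add: r1\<close>)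
    have live1: "live n \<sigma>1 = live n \<rho>" by (simp add: live_def r1)
    have "scalar \<rho> 10 - scalar \<rho> 3 = Suc (scalar \<rho> 10 - (scalar \<rho> 3 + 1))" using g by simp
    then have pot1: "pot n \<rho> = pot n \<sigma>1 + pop_time" by (simp add: pot_def live1 r1)
    have pop: "tri (B ^ 8) pop \<rho> (stime pop) (\<lambda>\<sigma>'. \<sigma>' = \<sigma>1)"
      by (rule tri_run[OF bd b(1) main_static(1,2) sm]) (simp add: \<sigma>1_def)
    have fit: "fits (B ^ 8) \<sigma>1 skip_test" by (rule fits_tame[OF bd1 b(1) main_static(3)])
    have test: "eval \<sigma>1 skip_test = 0 \<longleftrightarrow> cell \<rho> 15 v = 0 \<and> cell \<rho> 14 v \<le> 2" by (simp add: skip_test_def r1)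
    let ?body = "Seq pop (Cond skip_test Skip eliminate)"
    show "\<exists>t r'. t + r' + cost main_guard + 1 \<le> r \<and> tri (B ^ 8) ?body \<rho> t (I r')"
    proof (cases "eval \<sigma>1 skip_test = 0")
      case False
      then have n: "\<not> (cell \<rho> 15 v = 0 \<and> cell \<rho> 14 v \<le> 2)" using test by simp
      have "minv n E B {} \<sigma>1"
      proof (rule minv_change[OF inv1 refl bd1])
        have "x \<noteq> v" if "x \<in> live n \<rho>" "cell \<rho> 14 x \<le> 2" for x using that n by (auto simp: live_def)
        then show "\<forall>x \<in> live n \<sigma>1 - {}. cell \<sigma>1 14 x \<le> 2 \<longrightarrow>
          (\<exists>j. scalar \<sigma>1 3 \<le> j \<and> j < scalar \<sigma>1 10 \<and> cell \<sigma>1 16 j = x)"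
          using wait1 unfolding live1 by (simp add: r1)
        show "scalar \<sigma>1 3 \<le> scalar \<sigma>1 10" using g by (simp add: r1)
      qed simp_all
      then have "I (pot n \<sigma>1) \<sigma>1" by (simp add: I_def)
      then have "tri (B ^ 8) Skip \<sigma>1 (stime Skip) (I (pot n \<sigma>1))" by (intro tri_run[OF bd1 b(1)]) simp_all
      then have "tri (B ^ 8) (Cond skip_test Skip eliminate) \<sigma>1 (cost skip_test + 1 + stime Skip) (I (pot n \<sigma>1))"
        using False by (intro tri_Cond[OF fit]) simp_all
      then have "tri (B ^ 8) ?body \<rho> (stime pop + (cost skip_test + 1 + stime Skip)) (I (pot n \<sigma>1))"
        by (intro tri_Seq[OF pop]) simp
      moreover have "stime pop + (cost skip_test + 1 + stime Skip) + pot n \<sigma>1 + cost main_guard + 1 \<le> r"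
        using pot1 pr by (simp add: pop_time_def)
      ultimately show ?thesis by blast
    next
      case True
      then have t: "cell \<rho> 15 v = 0" "cell \<rho> 14 v \<le> 2" using test by simp_all
      then have "v \<noteq> n" using i(3) by auto
      then have v: "v \<in> live n \<sigma>1" "cell \<sigma>1 14 v \<le> 2" "scalar \<sigma>1 4 = v" using vn t by (auto simp: live_def r1)
      let ?t = "stime elim_head + (scan_time * cell \<sigma>1 12 v + scan_time + stime elim_rest)"
      note el = eliminate_spec[OF inv1 B E v(3,1,2)]
      have "I (pot n \<sigma>1 - ?t) \<rho>'" if "minv n E B {} \<rho>' \<and> pot n \<rho>' + ?t \<le> pot n \<sigma>1" for \<rho>'
        unfolding I_def using that add_le_imp_le_diff by blast
      then have "tri (B ^ 8) eliminate \<sigma>1 ?t (I (pot n \<sigma>1 - ?t))"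
        by (rule tri_mono[OF el le_refl])
      then have "tri (B ^ 8) (Cond skip_test Skip eliminate) \<sigma>1 (cost skip_test + 1 + ?t) (I (pot n \<sigma>1 - ?t))"
        using True by (intro tri_Cond[OF fit]) simp_all
      then have "tri (B ^ 8) ?body \<rho> (stime pop + (cost skip_test + 1 + ?t)) (I (pot n \<sigma>1 - ?t))"
        by (intro tri_Seq[OF pop]) simp
      \<comment> \<open>The new budget is a truncated difference. That nothing is cut off follows
        from the existence of a final state satisfying the postcondition of
        \<open>el\<close>.\<close>
      moreover have "?t \<le> pot n \<sigma>1"
        using el unfolding tri_def by auto
      then have "stime pop + (cost skip_test + 1 + ?t) + (pot n \<sigma>1 - ?t) + cost main_guard + 1 \<le> r"
        using pot1 pr by (simp add: pop_time_def)
      ultimately show ?thesis by blast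
    qed
  qed
  then show ?thesis
  proof (rule tri_mono[OF _ le_refl])
    fix \<rho> assume "(\<exists>r'. I r' \<rho>) \<and> eval \<rho> main_guard = 0"
    then have inv: "minv n E B {} \<rho>" and g: "\<not> scalar \<rho> 3 < scalar \<rho> 10"
      by (auto simp: I_def main_guard_def split: if_splits)
    have i: "reducible (live n \<rho>) (nbr n \<rho>)" "\<forall>x\<in>live n \<rho>. cell \<rho> 14 x = card (Collect (nbr n \<rho> x))"
      "\<forall>x \<in> live n \<rho> - {}. cell \<rho> 14 x \<le> 2 \<longrightarrow> (\<exists>j. scalar \<rho> 3 \<le> j \<and> j < scalar \<rho> 10 \<and> cell \<rho> 16 j = x)"
      using inv by (simp_all add: minv_def)
    \<comment> \<open>The remaining graph is reducible; if it were nonempty, it would have a vertex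
      of degree at most two, which would still be waiting in the empty queue.\<close>
    have "live n \<rho> = {}"
    proof (rule ccontr)
      assume "live n \<rho> \<noteq> {}"
      then obtain x where x: "x \<in> live n \<rho>" "card (Collect (nbr n \<rho> x)) \<le> 2"
        using reducible_low_degree[OF i(1)] by blast
      then obtain j where "scalar \<rho> 3 \<le> j" "j < scalar \<rho> 10" using i(2,3) by auto
      then show False using g by simp
    qed
    then show "minv n E B {} \<rho> \<and> live n \<rho> = {}" using inv by simp
  qed
qed

section \<open>Reading a solution off the node graph\<close>

definition mark_body :: cmd where
  "mark_body = seqs [Assign 8 (Bin Minus (Var 8) (Const 1)),
     Cond (Read 11 (Var 8)) (seqs
       [Write 11 (Read 6 (Var 8)) (Const 1), Write 11 (Read 7 (Var 8)) (Const 1),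
        Write 11 (Read 8 (Var 8)) (Const 1), Write 11 (Read 9 (Var 8)) (Const 1),
        Cond (Read 10 (Var 8)) (Write 2 (Bin Minus (Read 10 (Var 8)) (Const 1)) (Const 1)) Skip]) Skip]"

definition mark_guard :: exp where
  "mark_guard = Bin Less (Const 3) (Var 8)"

definition mark_time :: nat where
  "mark_time = stime mark_body + cost mark_guard + 1"

text \<open>What remains to be output: marked nodes not yet visited. The counter lies one above the
  next node, so the bound is strict; the pass may stop at 3 since nodes 0, 1 and 2 represent the
  empty set.\<close>

definition marked :: "state \<Rightarrow> (nat \<Rightarrow> nat set) \<Rightarrow> nat set" where
  "marked \<sigma> P = (\<Union>p \<in> {p. p < scalar \<sigma> 8 \<and> cell \<sigma> 11 p \<noteq> 0}. P p)"

lemma mark_spec: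
  assumes bd: "bounded_by B \<sigma>" "20 < B" and st: "store_ok n \<sigma> P" and k: "scalar \<sigma> 8 = scalar \<sigma> 16"
    and out: "cell \<sigma> 2 = (\<lambda>_. 0)"
  shows "tri (B ^ 8) (While mark_guard mark_body) \<sigma> (mark_time * scalar \<sigma> 16 + cost mark_guard + 1)
    (\<lambda>\<sigma>'. {v. cell \<sigma>' 2 v \<noteq> 0} = marked \<sigma> P)"
proof -
  let ?R = "marked \<sigma> P"
  define I where "I r \<rho> \<longleftrightarrow> bounded_by B \<rho> \<and> (\<forall>d. d \<notin> {2, 11} \<longrightarrow> cell \<rho> d = cell \<sigma> d) \<and>
    scalar \<rho> 8 \<le> scalar \<sigma> 16 \<and> mark_time * scalar \<rho> 8 \<le> r \<and>
    {v. cell \<rho> 2 v \<noteq> 0} \<union> marked \<rho> P = ?R" for r and \<rho> :: state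
  have node: "P p = P (cell \<sigma> 6 p) \<union> P (cell \<sigma> 7 p) \<union> P (cell \<sigma> 8 p) \<union> P (cell \<sigma> 9 p) \<union>
          (if cell \<sigma> 10 p = 0 then {} else {cell \<sigma> 10 p - 1})"
    "cell \<sigma> 6 p < p" "cell \<sigma> 7 p < p" "cell \<sigma> 8 p < p" "cell \<sigma> 9 p < p"
    if "3 \<le> p" "p < scalar \<sigma> 16" for p
    using st that unfolding store_ok_def by blast+
  have "tri (B ^ 8) (While mark_guard mark_body) \<sigma> (mark_time * scalar \<sigma> 16 + cost mark_guard + 1)
    (\<lambda>\<sigma>'. (\<exists>r'. I r' \<sigma>') \<and> eval \<sigma>' mark_guard = 0)"
  proof (rule tri_While)
    show "I (mark_time * scalar \<sigma> 16) \<sigma>" using bd k out by (simp add: I_def)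
  next
    fix r \<rho> assume "I r \<rho>"
    then show "fits (B ^ 8) \<rho> mark_guard" using bd by (intro fits_tame) (auto simp: I_def tame_def mark_guard_def)
  next
    fix r \<rho> assume I: "I r \<rho>" and g: "eval \<rho> mark_guard \<noteq> 0"
    define q where "q = scalar \<rho> 8 - 1"
    have q: "3 \<le> q" "scalar \<rho> 8 = Suc q" "q < scalar \<sigma> 16"
      using g I by (auto simp: mark_guard_def q_def I_def split: if_splits)
    have bd': "bounded_by B \<rho>" using I by (simp add: I_def)
    have fr: "cell \<rho> 6 = cell \<sigma> 6" "cell \<rho> 7 = cell \<sigma> 7" "cell \<rho> 8 = cell \<sigma> 8" "cell \<rho> 9 = cell \<sigma> 9" "cell \<rho> 10 = cell \<sigma> 10"
      using I by (simp_all add: I_def)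
    have "scalar \<rho> 8 < B" using bd' by (simp add: bounded_by_def)
    then have sm: "small B mark_body \<rho>" using bd(2) by (simp add: mark_body_def q(2))
    let ?\<rho> = "run mark_body \<rho>"
    have "I (mark_time * q) ?\<rho>" if bd'': "bounded_by B ?\<rho>"
    proof (cases "cell \<rho> 11 q = 0")
      case True
      then have r: "?\<rho> = \<rho>\<lparr>scalar := (scalar \<rho>)(8 := q)\<rparr>" by (simp add: mark_body_def q(2))
      have "{p. p < Suc q \<and> cell \<rho> 11 p \<noteq> 0} = {p. p < q \<and> cell \<rho> 11 p \<noteq> 0}"
        using True by (auto simp: less_Suc_eq)
      then have "marked ?\<rho> P = marked \<rho> P" unfolding marked_def r by (simp add: q(2))
      then show ?thesis using I bd'' q(3) unfolding I_def by (simp add: r)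
    next
      case False
      let ?M = "(cell \<rho> 11)(cell \<sigma> 6 q := 1, cell \<sigma> 7 q := 1, cell \<sigma> 8 q := 1, cell \<sigma> 9 q := 1)"
      have r: "scalar ?\<rho> = (scalar \<rho>)(8 := q)" "cell ?\<rho> 11 = ?M"
        "cell ?\<rho> 2 = (if cell \<sigma> 10 q = 0 then cell \<rho> 2 else (cell \<rho> 2)(cell \<sigma> 10 q - 1 := 1))"
        "\<And>d. d \<notin> {2, 11} \<Longrightarrow> cell ?\<rho> d = cell \<rho> d"
        using False by (auto simp: mark_body_def q(2) fr)
      have m1: "marked \<rho> P = marked_below \<union> P q" if "marked_below = (\<Union>p \<in> {p. p < q \<and> cell \<rho> 11 p \<noteq> 0}. P p)" for marked_below
        unfolding marked_def q(2) that using False by (auto simp: less_Suc_eq)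
      \<comment> \<open>Children have smaller numbers than their parent, so the marks set now are
        still ahead of the decreasing counter.\<close>
      have "{p. p < q \<and> ?M p \<noteq> 0} = {p. p < q \<and> cell \<rho> 11 p \<noteq> 0} \<union> {cell \<sigma> 6 q, cell \<sigma> 7 q, cell \<sigma> 8 q, cell \<sigma> 9 q}"
        using node(2-5)[OF q(1,3)] by auto
      then have "marked ?\<rho> P = (\<Union>p \<in> {p. p < q \<and> cell \<rho> 11 p \<noteq> 0}. P p) \<union>
          (P (cell \<sigma> 6 q) \<union> P (cell \<sigma> 7 q) \<union> P (cell \<sigma> 8 q) \<union> P (cell \<sigma> 9 q))"
        unfolding marked_def r by auto
      moreover have "{v. cell ?\<rho> 2 v \<noteq> 0} = {v. cell \<rho> 2 v \<noteq> 0} \<union> (if cell \<sigma> 10 q = 0 then {} else {cell \<sigma> 10 q - 1})"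
        unfolding r by auto
      ultimately have "{v. cell ?\<rho> 2 v \<noteq> 0} \<union> marked ?\<rho> P = {v. cell \<rho> 2 v \<noteq> 0} \<union> marked \<rho> P"
        unfolding m1[OF refl] node(1)[OF q(1,3)] by (simp add: Un_ac)
      then show ?thesis using I bd'' q(3) unfolding I_def by (simp add: r)
    qed
    then have "tri (B ^ 8) mark_body \<rho> (stime mark_body) (I (mark_time * q))"
      by (rule tri_run[OF bd' bd(2) _ _ sm, rotated 2]) (simp_all add: mark_body_def tame_def)
    moreover have "stime mark_body + mark_time * q + cost mark_guard + 1 \<le> r"
      using I by (simp add: I_def q(2) mark_time_def)
    ultimately show "\<exists>t r'. t + r' + cost mark_guard + 1 \<le> r \<and> tri (B ^ 8) mark_body \<rho> t (I r')" by blast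
  qed
  then show ?thesis
  proof (rule tri_mono[OF _ le_refl])
    fix \<rho> assume "(\<exists>r'. I r' \<rho>) \<and> eval \<rho> mark_guard = 0"
    then obtain r' where I: "I r' \<rho>" and g: "scalar \<rho> 8 \<le> 3" by (auto simp: mark_guard_def split: if_splits)
    have "P p = {}" if "p < 3" for p
    proof -
      have "p = 0 \<or> p = 1 \<or> p = 2" using that by arith
      then show ?thesis using st by (auto simp: store_ok_def)
    qed
    then have "marked \<rho> P = {}" using g by (auto simp: marked_def)
    then show "{v. cell \<rho> 2 v \<noteq> 0} = ?R" using I by (simp add: I_def)
  qed
qed

section \<open>The input phase\<close>

text \<open>With nothing inside the piece, the only possible contribution to a state is the edge
  between \<open>x\<close> and \<open>y\<close>, and it counts for one end when the other is
  selected.\<close>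

lemma psol_empty:
  assumes "x \<noteq> y" "x \<notin> nbh E x" "y \<notin> nbh E y"
  shows "psol E {} x y i j S \<longleftrightarrow> S = {} \<and> (i = 3 \<or> i = (if j = 3 \<and> {x, y} \<in> E then 1 else 0)) \<and>
    (j = 3 \<or> j = (if i = 3 \<and> {x, y} \<in> E then 1 else 0))"
proof -
  have "nbh E x \<inter> (term_in i x \<union> term_in j y) = (if j = 3 \<and> {x, y} \<in> E then {y} else {})"
    using assms by (auto simp: term_in_def nbh_def insert_commute)
  then have x: "cnt E x (term_in i x \<union> term_in j y) = (if j = 3 \<and> {x, y} \<in> E then 1 else 0)"
    by (simp add: cnt_def)
  have "nbh E y \<inter> (term_in i x \<union> term_in j y) = (if i = 3 \<and> {x, y} \<in> E then {x} else {})"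
    using assms by (auto simp: term_in_def nbh_def insert_commute)
  then have y: "cnt E y (term_in i x \<union> term_in j y) = (if i = 3 \<and> {x, y} \<in> E then 1 else 0)"
    by (simp add: cnt_def)
  show ?thesis unfolding psol_def Let_def has_state_def using x y by auto
qed

lemma nbh_empty: "edges_below n E \<Longrightarrow> n \<le> x \<Longrightarrow> nbh E x = {}"
  unfolding edges_below_def nbh_def by fastforce

text \<open>The dummies are isolated, hence state 0 at both of them selects nothing and imposes
  nothing.\<close>

lemma psol_whole_iff:
  assumes "edges_below n E"
  shows "psol E {..<n} n (n + 1) 0 0 S \<longleftrightarrow> set12 {..<n} E S"
proof -
  have "nbh E n = {}" "nbh E (n + 1) = {}" using nbh_empty[OF assms] by simp_all
  moreover have "x = 1 \<or> x = 2 \<longleftrightarrow> 1 \<le> x \<and> x \<le> 2" for x :: nat by arith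
  ultimately show ?thesis by (simp add: psol_def set12_def term_in_def has_state_def cnt_def)
qed

lemma gamma12_set_of_tab:
  assumes "edges_below n E" "tab n E \<sigma> P {..<n} n (n + 1)"
  defines "p \<equiv> entry \<sigma> (base n n (n + 1)) 0 0"
  shows "gamma12_set {..<n} E (P p)" "p < scalar \<sigma> 16"
proof -
  have v: "valid n \<sigma> P (psol E {..<n} n (n + 1) 0 0) p"
    and le: "\<And>S. psol E {..<n} n (n + 1) 0 0 S \<Longrightarrow> cell \<sigma> 5 p \<le> card S"
    using assms(2) unfolding tab_def p_def by simp_all
  note iff = psol_whole_iff[OF assms(1)]
  \<comment> \<open>The whole vertex set qualifies trivially, so the entry is feasible and a minimum
    exists.\<close>
  have all: "set12 {..<n} E {..<n}" by (simp add: set12_def)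
  have "cell \<sigma> 5 p \<le> n" using le[unfolded iff, OF all] by simp
  then have P: "set12 {..<n} E (P p)" "card (P p) = cell \<sigma> 5 p" using v iff by (auto simp: valid_def)
  have "finite {S. set12 {..<n} E S}" by (rule finite_subset[of _ "Pow {..<n}"]) (auto simp: set12_def)
  then have "gamma12 {..<n} E = cell \<sigma> 5 p"
    unfolding gamma12_def using P le[unfolded iff] by (intro Min_eqI) (auto simp: image_iff)
  then show "gamma12_set {..<n} E (P p)" using P by (simp add: gamma12_set_def)
  show "p < scalar \<sigma> 16" using v by (simp add: valid_def)
qed

text \<open>The cell read is entry (0, 0) at the pair of the dummies \<open>n\<close> and
  \<open>n + 1\<close>. Its offset is 0, so the raw content is already the node number.\<close>

definition final_head :: cmd where
  "final_head = seqs [Assign 9 (Read 4 (Bin Times (inc (ix (Var 0) 0)) (Const 16))),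
     Write 11 (Var 9) (Const 1), Assign 8 (Var 16)]"

definition final :: cmd where
  "final = Seq final_head (While mark_guard mark_body)"

definition final_time :: "nat \<Rightarrow> nat" where
  "final_time n = stime final_head + (mark_time * (3 + 490 * n) + cost mark_guard + 1)"

lemma final_spec:
  assumes inv: "minv n E B {} \<sigma>" and L: "live n \<sigma> = {}" and B: "big n B" and E: "edges_below n E"
  shows "tri (B ^ 8) final \<sigma> (final_time n) (\<lambda>\<sigma>'. gamma12_set {..<n} E (set_output n \<sigma>'))"
proof -
  have b: "20 < B" using bigD(1)[OF B] by simp
  have i: "bounded_by B \<sigma>" "scalar \<sigma> 0 = n" "scalar \<sigma> 2 = n + 2" "cell \<sigma> 2 = (\<lambda>_. 0)" "cell \<sigma> 11 = (\<lambda>_. 0)"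
    using inv by (simp_all add: minv_def)
  obtain h P where "tables n E (live n \<sigma>) (nbr n \<sigma>) h P \<sigma>" using inv unfolding minv_def by blast
  then have own: "owners n E {} (nbr n \<sigma>) h" and st: "store_ok n \<sigma> P" and np: "scalar \<sigma> 16 \<le> 3 + 490 * n"
    and tab: "tab n E \<sigma> P (pieces n {} h n (n + 1)) n (n + 1)"
    unfolding tables_def L by simp_all
  have "\<not> nbr n \<sigma> x y" for x y using L by (simp add: nbr_def)
  then have "h d = {n, n + 1}" if "d < n" for d using own that by (auto simp: owners_def)
  then have "pieces n {} h n (n + 1) = {..<n}" by (auto simp: pieces_def)
  then have tab: "tab n E \<sigma> P {..<n} n (n + 1)" using tab by simp
  define p where "p = entry \<sigma> (base n n (n + 1)) 0 0"
  note p = gamma12_set_of_tab[OF E tab, folded p_def]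
  define \<sigma>1 where "\<sigma>1 = run final_head \<sigma>"
  have c: "cell \<sigma> 4 ((n * (n + 2) + n + 1) * 16) = p" by (simp add: p_def entry_def off_def base_def add.assoc)
  have "p < B" using i(1) unfolding c[symmetric] bounded_by_def by blast
  with c have r: "scalar \<sigma>1 = (scalar \<sigma>)(9 := p, 8 := scalar \<sigma> 16)" "cell \<sigma>1 = (cell \<sigma>)(11 := (\<lambda>_. 0)(p := 1))"
    and sm: "small B final_head \<sigma>"
    using i(1) b unfolding bounded_by_def by (simp_all add: \<sigma>1_def final_head_def i(2-5) fun_eq_iff)
  have bd1: "bounded_by B \<sigma>1" unfolding \<sigma>1_def using i(1) sm by (rule run_bounded)
  have st1: "store_ok n \<sigma>1 P" using st by (simp add: store_ok_def r)
  have "{q. q < scalar \<sigma>1 8 \<and> cell \<sigma>1 11 q \<noteq> 0} = {p}" using p(2) by (auto simp: r)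
  then have m: "marked \<sigma>1 P = P p" by (simp add: marked_def)
  have k1: "scalar \<sigma>1 8 = scalar \<sigma>1 16" "cell \<sigma>1 2 = (\<lambda>_. 0)" by (simp_all add: r i)
  have "P p \<subseteq> {..<n}" using p(1) by (simp add: gamma12_set_def set12_def)
  then have out: "set_output n \<sigma>' = P p" if "{v. cell \<sigma>' 2 v \<noteq> 0} = marked \<sigma>1 P" for \<sigma>'
    using that unfolding m set_output_def by blast
  show ?thesis unfolding final_def final_time_def
  proof (rule tri_Seq)
    show "tri (B ^ 8) final_head \<sigma> (stime final_head) (\<lambda>\<sigma>'. \<sigma>' = \<sigma>1)"
      by (rule tri_run[OF i(1) b _ _ sm]) (simp_all add: \<sigma>1_def final_head_def tame_def)
  next
    fix \<rho> assume \<rho>: "\<rho> = \<sigma>1"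
    have "mark_time * scalar \<sigma>1 16 + cost mark_guard + 1 \<le> mark_time * (3 + 490 * n) + cost mark_guard + 1"
      using mult_le_mono2[OF np, of mark_time] by (simp add: r)
    then show "tri (B ^ 8) (While mark_guard mark_body) \<rho> (mark_time * (3 + 490 * n) + cost mark_guard + 1)
      (\<lambda>\<sigma>'. gamma12_set {..<n} E (set_output n \<sigma>'))"
      unfolding \<rho> using p(1) out by (intro tri_mono[OF mark_spec[OF bd1 b st1 k1]]) simp_all
  qed
qed

text \<open>The flag at position \<open>n\<close> marks the dummy as eliminated before it can be
  queued. Sizes of nodes 0 and 2 are left at their initial value 0.\<close>

definition init_head :: cmd where
  "init_head = seqs [Assign 2 (Bin Plus (Var 0) (Const 2)), Assign 16 (Const 3), Write 5 (Const 1) (inc (Var 0)),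
     Write 15 (Var 0) (Const 1), Assign 10 (Var 0)]"

definition queue_guard :: exp where
  "queue_guard = Bin Less (Var 8) (Var 0)"

definition queue_body :: cmd where
  "queue_body = seqs [Write 16 (Var 8) (Var 8), Assign 8 (inc (Var 8))]"

definition queue_time :: nat where
  "queue_time = stime queue_body + cost queue_guard + 1"

lemma queue_spec:
  assumes bd: "bounded_by B \<sigma>" "20 < B" "n + 1 < B" and sc: "scalar \<sigma> 0 = n" "scalar \<sigma> 8 = 0"
  shows "tri (B ^ 8) (While queue_guard queue_body) \<sigma> (queue_time * n + cost queue_guard + 1)
    (\<lambda>\<sigma>'. bounded_by B \<sigma>' \<and> (\<forall>x. x \<noteq> 8 \<longrightarrow> scalar \<sigma>' x = scalar \<sigma> x) \<and>
      (\<forall>d. d \<noteq> 16 \<longrightarrow> cell \<sigma>' d = cell \<sigma> d) \<and> (\<forall>j < n. cell \<sigma>' 16 j = j))"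
proof -
  define I where "I r \<rho> \<longleftrightarrow> bounded_by B \<rho> \<and> (\<forall>x. x \<noteq> 8 \<longrightarrow> scalar \<rho> x = scalar \<sigma> x) \<and>
      (\<forall>d. d \<noteq> 16 \<longrightarrow> cell \<rho> d = cell \<sigma> d) \<and> scalar \<rho> 8 \<le> n \<and> (\<forall>j < scalar \<rho> 8. cell \<rho> 16 j = j) \<and>
      r = queue_time * (n - scalar \<rho> 8)" for r and \<rho> :: state
  have "tri (B ^ 8) (While queue_guard queue_body) \<sigma> (queue_time * n + cost queue_guard + 1)
    (\<lambda>\<sigma>'. (\<exists>r'. I r' \<sigma>') \<and> eval \<sigma>' queue_guard = 0)"
  proof (rule tri_While)
    show "I (queue_time * n) \<sigma>" using bd sc by (simp add: I_def)
  next
    fix r \<rho> assume "I r \<rho>"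
    then show "fits (B ^ 8) \<rho> queue_guard" using bd by (intro fits_tame) (auto simp: I_def tame_def queue_guard_def)
  next
    fix r \<rho> assume I: "I r \<rho>" and g: "eval \<rho> queue_guard \<noteq> 0"
    have k: "scalar \<rho> 8 < n" using g I sc by (simp add: queue_guard_def I_def split: if_splits)
    have bd': "bounded_by B \<rho>" using I by (simp add: I_def)
    have sm: "small B queue_body \<rho>" using k bd(3) by (simp add: queue_body_def)
    have "I (queue_time * (n - Suc (scalar \<rho> 8))) (run queue_body \<rho>)" if "bounded_by B (run queue_body \<rho>)"
      using that I k unfolding I_def queue_body_def by (auto simp: less_Suc_eq)
    then have "tri (B ^ 8) queue_body \<rho> (stime queue_body) (I (queue_time * (n - Suc (scalar \<rho> 8))))"
      by (rule tri_run[OF bd' bd(2) _ _ sm, rotated 2]) (simp_all add: queue_body_def tame_def)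
    moreover have "n - scalar \<rho> 8 = Suc (n - Suc (scalar \<rho> 8))" using k by simp
    then have "stime queue_body + queue_time * (n - Suc (scalar \<rho> 8)) + cost queue_guard + 1 \<le> r"
      using I by (simp add: I_def queue_time_def)
    ultimately show "\<exists>t r'. t + r' + cost queue_guard + 1 \<le> r \<and> tri (B ^ 8) queue_body \<rho> t (I r')" by blast
  qed
  then show ?thesis
  proof (rule tri_mono[OF _ le_refl])
    fix \<rho> assume "(\<exists>r'. I r' \<rho>) \<and> eval \<rho> queue_guard = 0"
    then obtain r' where I: "I r' \<rho>" and g: "eval \<rho> queue_guard = 0" by blast
    have "scalar \<rho> 0 = n" "scalar \<rho> 8 \<le> n" using I sc by (simp_all add: I_def)
    then have "scalar \<rho> 8 = n" using g by (simp add: queue_guard_def split: if_splits)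
    then show "bounded_by B \<rho> \<and> (\<forall>x. x \<noteq> 8 \<longrightarrow> scalar \<rho> x = scalar \<sigma> x) \<and>
      (\<forall>d. d \<noteq> 16 \<longrightarrow> cell \<rho> d = cell \<sigma> d) \<and> (\<forall>j < n. cell \<rho> 16 j = j)" using I by (simp add: I_def)
  qed
qed

text \<open>Raising the raw content by 1 moves the states (0, 3) and (3, 0) from node 0 to the
  infeasible node 1, and (1, 3) and (3, 1) from node 1 to node 2. The second node for the empty set
  exists for this purpose.\<close>

fun mark_edge :: "nat \<Rightarrow> cmd" where
  "mark_edge k = seqs [Write 4 (Bin Plus (Var 11) (Const k)) (Const 1), Write 4 (Bin Plus (Var 12) (Const k)) (Const 1)]"

definition edge_rest :: cmd where
  "edge_rest = seqs [Assign 11 (Bin Times (ix (Var 22) 23) (Const 16)), Assign 12 (Bin Times (ix (Var 23) 22) (Const 16)),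
     mark_edge 3, mark_edge 7, mark_edge 12, mark_edge 13, Assign 8 (inc (Var 8))]"

definition edge_body :: cmd where
  "edge_body = Seq (seqs [Assign 22 (Read 0 (Var 8)), Assign 23 (Read 1 (Var 8))]) (Seq add_edge edge_rest)"

definition edge_guard :: exp where
  "edge_guard = Bin Less (Var 8) (Var 1)"

definition edge_time :: nat where
  "edge_time = stime edge_body + cost edge_guard + 1"

text \<open>
  The entries (0, 3), (1, 3), (3, 0), (3, 1) in which the table of a single edge differs from that of an empty piece.
\<close>

definition edge_slots :: "nat set" where
  "edge_slots = {3, 7, 12, 13}"

lemma base_inj:
  assumes "y < n + 2" "y' < n + 2" "l < 16" "l' < 16"
  shows "base n x y + l = base n x' y' + l' \<longleftrightarrow> x = x' \<and> y = y' \<and> l = l'"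
  using base_apart[OF assms(1,2), of x x'] assms(3,4) by fastforce

lemma edge_body_spec:
  assumes bd: "bounded_by B \<sigma>" and B: "big n B" and sc: "scalar \<sigma> 2 = n + 2"
    and k: "scalar \<sigma> 8 + 1 < B" "cell \<sigma> 0 (scalar \<sigma> 8) = u" "cell \<sigma> 1 (scalar \<sigma> 8) = w" "u < n" "w < n" "u \<noteq> w"
    and ok: "hist_ok n \<sigma>" and new: "\<not> hist n \<sigma> u w"
    and deg: "\<forall>x < n. cell \<sigma> 14 x = card (Collect (hist n \<sigma> x))"
    and tb: "\<forall>x < n + 2. \<forall>y < n + 2. \<forall>l < 16.
      cell \<sigma> 4 (base n x y + l) = (if hist n \<sigma> x y \<and> l \<in> edge_slots then 1 else 0)"
  defines "\<sigma>' \<equiv> run edge_body \<sigma>"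
  shows "small B edge_body \<sigma>"
    and "\<And>x y. hist n \<sigma>' x y \<longleftrightarrow> hist n \<sigma> x y \<or> x = u \<and> y = w \<or> x = w \<and> y = u"
    and "hist_ok n \<sigma>'"
    and "\<forall>x < n. cell \<sigma>' 14 x = card (Collect (hist n \<sigma>' x))"
    and "\<forall>x < n + 2. \<forall>y < n + 2. \<forall>l < 16.
      cell \<sigma>' 4 (base n x y + l) = (if hist n \<sigma>' x y \<and> l \<in> edge_slots then 1 else 0)"
    and "\<And>x. x \<notin> {8, 11, 12, 22, 23} \<Longrightarrow> scalar \<sigma>' x = scalar \<sigma> x" "scalar \<sigma>' 8 = scalar \<sigma> 8 + 1"
    and "\<And>d. d \<notin> {3, 4, 12, 13, 14} \<Longrightarrow> cell \<sigma>' d = cell \<sigma> d"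
proof -
  define \<sigma>1 where "\<sigma>1 = \<sigma>\<lparr>scalar := (scalar \<sigma>)(22 := u, 23 := w)\<rparr>"
  define \<sigma>2 where "\<sigma>2 = run add_edge \<sigma>1"
  have s1: "scalar \<sigma>1 2 = n + 2" "scalar \<sigma>1 22 = u" "scalar \<sigma>1 23 = w" "cell \<sigma>1 = cell \<sigma>"
    using sc by (simp_all add: \<sigma>1_def)
  have e1: "run (seqs [Assign 22 (Read 0 (Var 8)), Assign 23 (Read 1 (Var 8))]) \<sigma> = \<sigma>1"
    using k(2,3) by (simp add: \<sigma>1_def)
  have h1: "hist n \<sigma>1 = hist n \<sigma>" by (rule hist_cong) (simp add: s1)
  have ok1: "hist_ok n \<sigma>1" using ok hist_ok_cong[of \<sigma>1 \<sigma>] by (simp add: s1)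
  have new1: "\<not> hist n \<sigma>1 u w" using new h1 by simp
  have deg1: "cell \<sigma>1 14 u \<le> n" "cell \<sigma>1 14 w \<le> n" using deg k(4,5) card_hist_le by (simp_all add: s1)
  have B2: "n + 2 < B" using bigD(1)[OF B] by simp
  note add = add_edge_spec[OF s1(1-3) k(4-6) ok1 new1 deg1 B2, folded \<sigma>2_def, unfolded s1(4)]
  have sc2: "scalar \<sigma>2 = scalar \<sigma>1" by (fact add(5))
  have hist2: "hist n \<sigma>2 x y \<longleftrightarrow> hist n \<sigma> x y \<or> x = u \<and> y = w \<or> x = w \<and> y = u" for x y
    using add(2) unfolding h1 .
  have r': "\<sigma>' = run edge_rest \<sigma>2" unfolding \<sigma>'_def edge_body_def by (simp only: run.simps(3) e1 \<sigma>2_def)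
  let ?p = "base n u w" and ?q = "base n w u"
  have r: "scalar \<sigma>' = (scalar \<sigma>2)(11 := ?p, 12 := ?q, 8 := scalar \<sigma> 8 + 1)"
    "cell \<sigma>' = (cell \<sigma>2)(4 := (cell \<sigma>2 4)(?p + 3 := 1, ?q + 3 := 1, ?p + 7 := 1, ?q + 7 := 1,
      ?p + 12 := 1, ?q + 12 := 1, ?p + 13 := 1, ?q + 13 := 1))"
    unfolding r' edge_rest_def using sc by (simp_all add: sc2 \<sigma>1_def base_def)
  have pq: "?p < B" "?q < B" using base_less[of u n w] base_less[of w n u] k(4,5) bigD(2)[OF B] by linarith+
  have smr: "small B edge_rest \<sigma>2"
    unfolding edge_rest_def using pq k(1) B2 sc by (simp add: sc2 \<sigma>1_def base_def)
  show "small B edge_body \<sigma>" unfolding edge_body_def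
    using add(1) smr k B2 by (simp only: small.simps(3) e1 \<sigma>2_def[symmetric]) simp
  have h': "hist n \<sigma>' = hist n \<sigma>2" by (rule hist_cong) (simp add: r)
  show hist': "hist n \<sigma>' x y \<longleftrightarrow> hist n \<sigma> x y \<or> x = u \<and> y = w \<or> x = w \<and> y = u" for x y
    unfolding h' by (rule hist2)
  show "hist_ok n \<sigma>'" using add(3) hist_ok_cong[of \<sigma>' \<sigma>2] by (simp add: r)
  show "scalar \<sigma>' x = scalar \<sigma> x" if "x \<notin> {8, 11, 12, 22, 23}" for x using that by (simp add: r sc2 \<sigma>1_def)
  show "scalar \<sigma>' 8 = scalar \<sigma> 8 + 1" by (simp add: r)
  show "cell \<sigma>' d = cell \<sigma> d" if "d \<notin> {3, 4, 12, 13, 14}" for d using that add(6)[of d] by (simp add: r)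
  have nw: "\<not> hist n \<sigma> w u" using ok new unfolding hist_ok_def by blast
  show "\<forall>x < n. cell \<sigma>' 14 x = card (Collect (hist n \<sigma>' x))"
  proof (intro allI impI)
    fix x assume x: "x < n"
    have "Collect (hist n \<sigma>' x) = Collect (hist n \<sigma> x) \<union> (if x = u then {w} else if x = w then {u} else {})"
      using k(6) by (auto simp: hist')
    then have "card (Collect (hist n \<sigma>' x)) = card (Collect (hist n \<sigma> x)) + (if x = u \<or> x = w then 1 else 0)"
      using new nw finite_hist k(6) by auto
    then show "cell \<sigma>' 14 x = card (Collect (hist n \<sigma>' x))" using add(4) deg x k(6) by (simp add: r)
  qed
  show "\<forall>x < n + 2. \<forall>y < n + 2. \<forall>l < 16.
      cell \<sigma>' 4 (base n x y + l) = (if hist n \<sigma>' x y \<and> l \<in> edge_slots then 1 else 0)"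
  proof (intro allI impI)
    fix x y l assume xy: "x < n + 2" "y < n + 2" and l: "l < (16::nat)"
    have "w < n + 2" "u < n + 2" using k by auto
    then have eq: "base n x y + l = base n u w + l' \<longleftrightarrow> x = u \<and> y = w \<and> l = l'"
      "base n x y + l = base n w u + l' \<longleftrightarrow> x = w \<and> y = u \<and> l = l'" if "l' < 16" for l'
      using base_inj[OF xy(2) _ l that] by auto
    have old: "cell \<sigma>2 4 (base n x y + l) = (if hist n \<sigma> x y \<and> l \<in> edge_slots then 1 else 0)"
      using tb xy l add(6)[of 4] by simp
    define a where "a = base n x y + l"
    define e where "e \<longleftrightarrow> x = u \<and> y = w"
    define f where "f \<longleftrightarrow> x = w \<and> y = u"
    have eqs: "a = ?p + l' \<longleftrightarrow> e \<and> l = l'" "a = ?q + l' \<longleftrightarrow> f \<and> l = l'" if "l' < 16" for l'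
      using eq[OF that] by (simp_all only: a_def e_def f_def conj_assoc)
    have "cell \<sigma>' 4 a = (if (e \<or> f) \<and> (l = 3 \<or> l = 7 \<or> l = 12 \<or> l = 13) then 1 else cell \<sigma>2 4 a)"
      unfolding r using eqs[of 3] eqs[of 7] eqs[of 12] eqs[of 13] by (cases e; cases f) simp_all
    moreover have "cell \<sigma>2 4 a = (if hist n \<sigma> x y \<and> l \<in> edge_slots then 1 else 0)"
      using old by (simp only: a_def)
    moreover have "hist n \<sigma>' x y \<longleftrightarrow> hist n \<sigma> x y \<or> e \<or> f" unfolding hist' e_def f_def ..
    ultimately have "cell \<sigma>' 4 a = (if hist n \<sigma>' x y \<and> l \<in> edge_slots then 1 else 0)"
      by (simp add: edge_slots_def)
    then show "cell \<sigma>' 4 (base n x y + l) = (if hist n \<sigma>' x y \<and> l \<in> edge_slots then 1 else 0)"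
      by (simp only: a_def)
  qed
qed

definition edges_time :: "nat \<Rightarrow> nat" where
  "edges_time m = edge_time * m + cost edge_guard + 1"

lemma edge_static: "loop_free edge_body" "ctame edge_body"
  using add_edge_static by (simp_all add: edge_body_def edge_rest_def tame_def)

definition loaded :: "nat \<Rightarrow> nat set set \<Rightarrow> state \<Rightarrow> state \<Rightarrow> bool" where
  "loaded n E \<sigma> \<rho> \<longleftrightarrow> (\<forall>x. x \<notin> {8, 11, 12, 22, 23} \<longrightarrow> scalar \<rho> x = scalar \<sigma> x) \<and>
     (\<forall>d. d \<notin> {3, 4, 12, 13, 14} \<longrightarrow> cell \<rho> d = cell \<sigma> d) \<and>
     (\<forall>x y. hist n \<rho> x y \<longleftrightarrow> {x, y} \<in> E) \<and> hist_ok n \<rho> \<and>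
     (\<forall>x < n. cell \<rho> 14 x = card (Collect (hist n \<rho> x))) \<and>
     (\<forall>x < n + 2. \<forall>y < n + 2. \<forall>l < 16.
        cell \<rho> 4 (base n x y + l) = (if hist n \<rho> x y \<and> l \<in> edge_slots then 1 else 0))"

lemma edges_spec:
  assumes bd: "bounded_by B \<sigma>" and B: "big n B" and m: "length es + 1 < B"
    and sc: "scalar \<sigma> 1 = length es" "scalar \<sigma> 2 = n + 2" "scalar \<sigma> 8 = 0"
    and inp: "\<forall>k < length es. cell \<sigma> 0 k = fst (es ! k) \<and> cell \<sigma> 1 k = snd (es ! k)"
    and zero: "cell \<sigma> 3 = (\<lambda>_. 0)" "cell \<sigma> 4 = (\<lambda>_. 0)" "cell \<sigma> 12 = (\<lambda>_. 0)" "cell \<sigma> 14 = (\<lambda>_. 0)"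
    and es: "edge_list es E" and E: "edges_below n E"
  shows "tri (B ^ 8) (While edge_guard edge_body) \<sigma> (edges_time (length es))
    (\<lambda>\<rho>. bounded_by B \<rho> \<and> loaded n E \<sigma> \<rho>)"
proof -
  let ?m = "length es"
  have b: "20 < B" using bigD(1)[OF B] by simp
  define edge where "edge k = {fst (es ! k), snd (es ! k)}" for k
  have map_edge: "map (\<lambda>(u, v). {u, v}) es = map edge [0..<?m]"
    by (rule nth_equalityI) (simp_all add: edge_def case_prod_unfold)
  have E_eq: "E = edge ` {..<?m}" and inj: "inj_on edge {..<?m}"
    using es unfolding edge_list_def map_edge by (auto simp: distinct_map atLeast_upt lessThan_atLeast0)
  define I where "I r \<rho> \<longleftrightarrow> bounded_by B \<rho> \<and> loaded n (edge ` {..<scalar \<rho> 8}) \<sigma> \<rho> \<and>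
      scalar \<rho> 8 \<le> ?m \<and> edge_time * (?m - scalar \<rho> 8) \<le> r" for r and \<rho> :: state
  have "tri (B ^ 8) (While edge_guard edge_body) \<sigma> (edge_time * ?m + cost edge_guard + 1)
    (\<lambda>\<sigma>'. (\<exists>r'. I r' \<sigma>') \<and> eval \<sigma>' edge_guard = 0)"
  proof (rule tri_While)
    have none: "\<not> hist n \<sigma> x y" for x y by (simp add: hist_def zero)
    then have "hist n \<sigma> x = (\<lambda>_. False)" for x by (simp add: fun_eq_iff)
    moreover from none have "hist_ok n \<sigma>" by (simp add: hist_ok_def nbs_def zero)
    ultimately show "I (edge_time * ?m) \<sigma>" using bd none by (simp add: I_def loaded_def sc zero)
  next
    fix r \<rho> assume "I r \<rho>"
    then show "fits (B ^ 8) \<rho> edge_guard" using b by (intro fits_tame) (auto simp: I_def tame_def edge_guard_def)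
  next
    fix r \<rho> assume I: "I r \<rho>" and g: "eval \<rho> edge_guard \<noteq> 0"
    let ?k = "scalar \<rho> 8"
    have bd': "bounded_by B \<rho>" and fr: "\<And>x. x \<notin> {8, 11, 12, 22, 23} \<Longrightarrow> scalar \<rho> x = scalar \<sigma> x"
      "\<And>d. d \<notin> {3, 4, 12, 13, 14} \<Longrightarrow> cell \<rho> d = cell \<sigma> d"
      and hist: "\<And>x y. hist n \<rho> x y \<longleftrightarrow> {x, y} \<in> edge ` {..<?k}" and ok: "hist_ok n \<rho>"
      and dg: "\<forall>x < n. cell \<rho> 14 x = card (Collect (hist n \<rho> x))"
      and tb: "\<forall>x < n + 2. \<forall>y < n + 2. \<forall>l < 16.
        cell \<rho> 4 (base n x y + l) = (if hist n \<rho> x y \<and> l \<in> edge_slots then 1 else 0)"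
      and r: "edge_time * (?m - ?k) \<le> r"
      using I unfolding I_def loaded_def by simp_all
    have sc': "scalar \<rho> 1 = ?m" "scalar \<rho> 2 = n + 2" using fr(1) sc by simp_all
    have k: "?k < ?m" using g sc' by (simp add: edge_guard_def split: if_splits)
    define u w where "u = fst (es ! ?k)" and "w = snd (es ! ?k)"
    have uw: "edge ?k = {u, w}" by (simp add: edge_def u_def w_def)
    then have "{u, w} \<in> E" using E_eq k by auto
    then have un: "u < n" "w < n" "u \<noteq> w" using E unfolding edges_below_def by blast+
    have c: "cell \<rho> 0 ?k = u" "cell \<rho> 1 ?k = w" using inp k fr(2) by (simp_all add: u_def w_def)
    \<comment> \<open>Every edge is listed once, so its number is determined by its set of ends and
      cannot have occurred earlier.\<close>
    have new: "\<not> hist n \<rho> u w"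
    proof
      assume "hist n \<rho> u w"
      then obtain j where "j < ?k" "edge j = edge ?k" unfolding hist uw[symmetric] by force
      moreover from this have "j = ?k" using inj_onD[OF inj, of j ?k] k by simp
      ultimately show False by simp
    qed
    have k1: "?k + 1 < B" using k m by simp
    note body = edge_body_spec[OF bd' B sc'(2) k1 c un ok new dg tb]
    have "I (edge_time * (?m - Suc ?k)) (run edge_body \<rho>)" if bd'': "bounded_by B (run edge_body \<rho>)"
      unfolding I_def loaded_def
    proof (intro conjI)
      show "\<forall>x. x \<notin> {8, 11, 12, 22, 23} \<longrightarrow> scalar (run edge_body \<rho>) x = scalar \<sigma> x" using body(6) fr(1) by simp
      show "\<forall>d. d \<notin> {3, 4, 12, 13, 14} \<longrightarrow> cell (run edge_body \<rho>) d = cell \<sigma> d" using body(8) fr(2) by simp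
      show "scalar (run edge_body \<rho>) 8 \<le> ?m" using body(7) k by simp
      show "\<forall>x y. hist n (run edge_body \<rho>) x y \<longleftrightarrow> {x, y} \<in> edge ` {..<scalar (run edge_body \<rho>) 8}"
        unfolding body(2,7) hist by (auto simp: lessThan_Suc uw doubleton_eq_iff)
      show "edge_time * (?m - scalar (run edge_body \<rho>) 8) \<le> edge_time * (?m - Suc ?k)" using body(7) by simp
    qed (fact bd'' body(3-5))+
    then have "tri (B ^ 8) edge_body \<rho> (stime edge_body) (I (edge_time * (?m - Suc ?k)))"
      by (rule tri_run[OF bd' b edge_static body(1)])
    moreover have "?m - ?k = Suc (?m - Suc ?k)" using k by simp
    then have "stime edge_body + edge_time * (?m - Suc ?k) + cost edge_guard + 1 \<le> r"
      using r by (simp add: edge_time_def)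
    ultimately show "\<exists>t r'. t + r' + cost edge_guard + 1 \<le> r \<and> tri (B ^ 8) edge_body \<rho> t (I r')" by blast
  qed
  then show ?thesis unfolding edges_time_def
  proof (rule tri_mono[OF _ le_refl])
    fix \<rho> assume "(\<exists>r'. I r' \<rho>) \<and> eval \<rho> edge_guard = 0"
    then obtain r' where I: "I r' \<rho>" and g: "eval \<rho> edge_guard = 0" by blast
    have "scalar \<rho> 1 = ?m" "scalar \<rho> 8 \<le> ?m" using I sc by (simp_all add: I_def loaded_def)
    then have "scalar \<rho> 8 = ?m" using g by (simp add: edge_guard_def split: if_splits)
    then show "bounded_by B \<rho> \<and> loaded n E \<sigma> \<rho>"
      using I unfolding I_def E_eq by simp
  qed
qed

lemma less_4_cases: "(i::nat) < 4 \<Longrightarrow> i = 0 \<or> i = 1 \<or> i = 2 \<or> i = 3"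
  by arith

lemma initial_tab:
  assumes cell5: "cell \<sigma> 5 = (\<lambda>_. 0)(1 := n + 1)" and np: "scalar \<sigma> 16 = 3" and E: "edges_below n E" and xy: "x \<noteq> y"
    and tb: "\<forall>l < 16. cell \<sigma> 4 (base n x y + l) = (if {x, y} \<in> E \<and> l \<in> edge_slots then 1 else 0)"
  shows "tab n E \<sigma> (\<lambda>_. {}) {} x y"
  unfolding tab_def
proof (intro allI impI)
  fix i j :: nat assume ij: "i < 4" "j < 4"
  have nl: "x \<notin> nbh E x" for x using E unfolding edges_below_def nbh_def by blast
  note ps = psol_empty[OF xy nl nl, of i j]
  define p where "p = entry \<sigma> (base n x y) i j"
  have p: "p = (if {x, y} \<in> E \<and> 4 * i + j \<in> edge_slots then 1 else 0) + off i j"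
    using tb ij by (simp add: p_def entry_def)
  define e where "e = ({x, y} \<in> E)"
  \<comment> \<open>A check of all 16 pairs of states, with and without the edge.\<close>
  have "p < 3 \<and> (p = 0 \<or> p = 2 \<longleftrightarrow> (i = 3 \<or> i = (if j = 3 \<and> e then 1 else 0)) \<and>
    (j = 3 \<or> j = (if i = 3 \<and> e then 1 else 0)))"
    unfolding p e_def[symmetric] using less_4_cases[OF ij(1)] less_4_cases[OF ij(2)]
    by (cases e; elim disjE) (simp_all add: off_def edge_slots_def)
  then have q: "p < 3" "psol E {} x y i j S \<longleftrightarrow> S = {} \<and> (p = 0 \<or> p = 2)" for S
    unfolding ps e_def by blast+
  have c: "cell \<sigma> 5 p = (if p = 0 \<or> p = 2 then 0 else n + 1)" using q(1) by (auto simp: cell5)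
  show "valid n \<sigma> (\<lambda>_. {}) (psol E {} x y i j) (entry \<sigma> (base n x y) i j) \<and>
       (\<forall>S. psol E {} x y i j S \<longrightarrow> cell \<sigma> 5 (entry \<sigma> (base n x y) i j) \<le> card S)"
    unfolding p_def[symmetric] valid_def using q c np by auto
qed

lemma minv_initial:
  assumes bd: "bounded_by B \<sigma>" and ld: "loaded n E \<rho> \<sigma>"
    and sc0: "scalar \<rho> 0 = n" "scalar \<rho> 2 = n + 2" "scalar \<rho> 3 = 0" "scalar \<rho> 10 = n" "scalar \<rho> 16 = 3"
    and zero0: "cell \<rho> 2 = (\<lambda>_. 0)" "cell \<rho> 11 = (\<lambda>_. 0)" "cell \<rho> 15 = (\<lambda>_. 0)(n := 1)" "cell \<rho> 5 = (\<lambda>_. 0)(1 := n + 1)"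
    and q0: "\<forall>j < n. cell \<rho> 16 j = j"
    and red: "reducible {..<n} (adj E)" and E: "edges_below n E"
  shows "minv n E B {} \<sigma>" and "pot n \<sigma> \<le> (pop_time + elim_time + 4 * scan_time) * n"
proof -
  have fr: "\<And>x. x \<notin> {8, 11, 12, 22, 23} \<Longrightarrow> scalar \<sigma> x = scalar \<rho> x"
      "\<And>d. d \<notin> {3, 4, 12, 13, 14} \<Longrightarrow> cell \<sigma> d = cell \<rho> d"
    and hist: "\<forall>x y. hist n \<sigma> x y \<longleftrightarrow> {x, y} \<in> E" and ok: "hist_ok n \<sigma>"
    and deg: "\<forall>x < n. cell \<sigma> 14 x = card (Collect (hist n \<sigma> x))"
    and tb: "\<forall>x < n + 2. \<forall>y < n + 2. \<forall>l < 16.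
        cell \<sigma> 4 (base n x y + l) = (if hist n \<sigma> x y \<and> l \<in> edge_slots then 1 else 0)"
    using ld unfolding loaded_def by simp_all
  have sc: "scalar \<sigma> 0 = n" "scalar \<sigma> 2 = n + 2" "scalar \<sigma> 3 = 0" "scalar \<sigma> 10 = n" "scalar \<sigma> 16 = 3"
    using sc0 by (simp_all add: fr(1))
  have zero: "cell \<sigma> 2 = (\<lambda>_. 0)" "cell \<sigma> 11 = (\<lambda>_. 0)" "cell \<sigma> 15 = (\<lambda>_. 0)(n := 1)" "cell \<sigma> 5 = (\<lambda>_. 0)(1 := n + 1)"
    and q: "\<forall>j < n. cell \<sigma> 16 j = j"
    using zero0 q0 by (simp_all add: fr(2))
  have live: "live n \<sigma> = {..<n}" by (auto simp: live_def zero)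
  have nbr: "nbr n \<sigma> = hist n \<sigma>" by (auto simp: nbr_def live hist_def fun_eq_iff)
  have hadj: "hist n \<sigma> = adj E" using hist by (simp add: adj_def fun_eq_iff)
  have "tables n E {..<n} (hist n \<sigma>) (\<lambda>_. {}) (\<lambda>_. {}) \<sigma>"
    unfolding tables_def
  proof (intro conjI ballI impI)
    show "owners n E {..<n} (hist n \<sigma>) (\<lambda>_. {})" using hist by (auto simp: owners_def)
    show "store_ok n \<sigma> (\<lambda>_. {})" by (auto simp: store_ok_def sc zero)
    show "scalar \<sigma> 16 + 490 * card {..<n} \<le> 3 + 490 * n" by (simp add: sc)
    fix x y assume "x \<in> {..<n} \<union> {n, n + 1}" "y \<in> {..<n} \<union> {n, n + 1}" and xy: "x \<noteq> y"
    then have "x < n + 2" "y < n + 2" by auto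
    moreover have "pieces n {..<n} (\<lambda>_. {}) x y = {}" by (auto simp: pieces_def)
    ultimately show "tab n E \<sigma> (\<lambda>_. {}) (pieces n {..<n} (\<lambda>_. {}) x y) x y"
      using tb hist initial_tab[OF zero(4) sc(5) E xy] by simp
  qed
  then have tbl: "\<exists>h P. tables n E (live n \<sigma>) (nbr n \<sigma>) h P \<sigma>" unfolding live nbr by blast
  show "minv n E B {} \<sigma>" unfolding minv_def
  proof (intro conjI)
    show "\<forall>x\<in>live n \<sigma>. cell \<sigma> 14 x = card (Collect (nbr n \<sigma> x))" using deg by (simp add: live nbr)
    show "reducible (live n \<sigma>) (nbr n \<sigma>)" using red by (simp add: live nbr hadj)
    show "\<forall>x\<in>live n \<sigma> - {}. cell \<sigma> 14 x \<le> 2 \<longrightarrow> (\<exists>j\<ge>scalar \<sigma> 3. j < scalar \<sigma> 10 \<and> cell \<sigma> 16 j = x)"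
      using q by (auto simp: live sc)
    show "\<forall>j<scalar \<sigma> 10. cell \<sigma> 16 j \<le> n" using q by (simp add: sc)
    show "scalar \<sigma> 10 + 2 * card (live n \<sigma>) = 3 * n" by (simp add: sc live)
  qed (use bd sc zero ok tbl in simp_all)
  have g: "graph_on {..<n} (adj E)" using graph_on_nbr[OF ok] unfolding live nbr hadj .
  \<comment> \<open>Handshake: the list lengths add up to the number of ordered adjacent pairs,
    which reducibility limits to \<open>4 * n\<close>.\<close>
  have "(\<Sum>x<n. cell \<sigma> 12 x) = (\<Sum>x<n. card (Collect (adj E x)))"
    by (rule sum.cong) (use hist_ok_count[OF ok] in \<open>simp_all add: hadj\<close>)
  also have "\<dots> = card (SIGMA x:{..<n}. Collect (adj E x))"
    using graph_on_finite_nbrs[OF g] by (intro card_SigmaI[symmetric]) auto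
  also have "(SIGMA x:{..<n}. Collect (adj E x)) = {(x, y). adj E x y}"
    using g by (auto simp: graph_on_def)
  also have "card \<dots> \<le> 4 * n" using reducible_card_edges[OF red g] by simp
  finally have "scan_time * (\<Sum>x<n. cell \<sigma> 12 x) \<le> scan_time * (4 * n)" by (rule mult_le_mono2)
  then show "pot n \<sigma> \<le> (pop_time + elim_time + 4 * scan_time) * n"
    by (simp add: pot_def live sc algebra_simps)
qed

section \<open>The complete program and its linear running time\<close>

definition min12set :: cmd where
  "min12set = Seq init_head (Seq (While queue_guard queue_body) (Seq (Assign 8 (Const 0))
     (Seq (While edge_guard edge_body) (Seq main_loop final))))"

definition total_time :: "nat \<Rightarrow> nat" where
  "total_time n = stime init_head + (queue_time * n + cost queue_guard + 1 + (stime (Assign 8 (Const 0)) +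
     (edges_time (4 * n) + ((pop_time + elim_time + 4 * scan_time) * n + cost main_guard + 1 + final_time n))))"

lemma input_size:
  assumes gsp: "gsp {..<n} E s t" and es: "edge_list es E"
  shows "length es \<le> 4 * n" "2 \<le> n" "edges_below n E"
    "\<And>k. k < length es \<Longrightarrow> fst (es ! k) < n \<and> snd (es ! k) < n"
proof -
  have g: "graph_on {..<n} (adj E)" using gsp_graph_on[OF gsp] .
  then have E: "{x, y} \<in> E \<Longrightarrow> x < n \<and> y < n \<and> x \<noteq> y" for x y unfolding graph_on_def adj_def by blast
  then show "edges_below n E" by (simp add: edges_below_def)
  have sub: "set es \<subseteq> {(x, y). adj E x y}"
  proof
    fix e assume "e \<in> set es"
    then have "(\<lambda>(u, v). {u, v}) e \<in> set (map (\<lambda>(u, v). {u, v}) es)" unfolding set_map by (rule imageI)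
    also have "\<dots> = E" using es unfolding edge_list_def by blast
    finally show "e \<in> {(x, y). adj E x y}" by (simp add: adj_def case_prod_unfold)
  qed
  show "fst (es ! k) < n \<and> snd (es ! k) < n" if "k < length es" for k
  proof -
    have "es ! k \<in> {(x, y). adj E x y}" by (rule subsetD[OF sub nth_mem[OF that]])
    then have "{fst (es ! k), snd (es ! k)} \<in> E" by (simp add: adj_def case_prod_unfold)
    from E[OF this] show ?thesis by simp
  qed
  have "{(x, y). adj E x y} \<subseteq> {..<n} \<times> {..<n}" using g unfolding graph_on_def by blast
  then have "finite {(x, y). adj E x y}" by (rule finite_subset) simp
  then have "card (set es) \<le> card {(x, y). adj E x y}" using sub by (rule card_mono)
  moreover have "distinct es" using es by (simp add: edge_list_def distinct_map)
  ultimately show "length es \<le> 4 * n"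
    using reducible_card_edges[OF gsp_reducible[OF gsp] g] distinct_card[of es] by simp
  have "s < n" "t < n" "s \<noteq> t" using gsp_simple_graph[OF gsp] by auto
  then show "2 \<le> n" by linarith
qed

text \<open>4 ^ 5 = 1024 pays for the factor 1000, since the two terminals force at least two
  vertices; two more powers give the square.\<close>

lemma big_power:
  assumes "2 \<le> (n::nat)"
  shows "big n ((n + 2) ^ 7)"
proof -
  have "(4::nat) ^ 5 \<le> (n + 2) ^ 5" using assms by (intro power_mono) simp_all
  then have "1000 \<le> (n + 2) ^ 5" by simp
  then have "1000 * ((n + 2) * (n + 2)) \<le> (n + 2) ^ 5 * ((n + 2) * (n + 2))" by (rule mult_le_mono1)
  also have "N ^ 5 * (N * N) = N ^ 7" for N :: nat by (simp add: eval_nat_numeral)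
  finally show ?thesis by (simp only: big_def)
qed

lemma min12set_spec:
  assumes gsp: "gsp {..<n} E s t" and es: "edge_list es E"
  shows "tri ((n + 2) ^ 56) min12set (graph_input n es) (total_time n) (\<lambda>\<sigma>. gamma12_set {..<n} E (set_output n \<sigma>))"
proof -
  define B where "B = (n + 2) ^ 7"
  note size = input_size[OF gsp es]
  have big: "big n B" unfolding B_def by (rule big_power[OF size(2)])
  have b: "20 < B" "n + 2 < B" "n + 1 < B" "length es + 1 < B" using bigD(1)[OF big] size(1) by simp_all
  define \<sigma>0 where "\<sigma>0 = graph_input n es"
  have s0: "scalar \<sigma>0 = (\<lambda>x. if x = 0 then n else if x = 1 then length es else 0)"
    "\<And>d. d \<notin> {0, 1} \<Longrightarrow> cell \<sigma>0 d = (\<lambda>_. 0)"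
    "\<And>k. k < length es \<Longrightarrow> cell \<sigma>0 0 k = fst (es ! k) \<and> cell \<sigma>0 1 k = snd (es ! k)"
    by (auto simp: \<sigma>0_def graph_input_def fun_eq_iff)
  have "cell \<sigma>0 d k < B" for d k
    using b size(4)[of k] by (auto simp: \<sigma>0_def graph_input_def)
  then have bd0: "bounded_by B \<sigma>0" using b size(1) by (simp add: bounded_by_def s0)
  have sm: "small B init_head \<sigma>0" using b by (simp add: init_head_def s0)
  define \<sigma>1 where "\<sigma>1 = run init_head \<sigma>0"
  have s1: "scalar \<sigma>1 = (scalar \<sigma>0)(2 := n + 2, 16 := 3, 10 := n)"
    "cell \<sigma>1 = (cell \<sigma>0)(5 := (cell \<sigma>0 5)(1 := n + 1), 15 := (cell \<sigma>0 15)(n := 1))"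
    by (simp_all add: \<sigma>1_def init_head_def s0(1))
  have bd1: "bounded_by B \<sigma>1" unfolding \<sigma>1_def using bd0 sm by (rule run_bounded)
  \<comment> \<open>56 = 7 * 8: the seventh power bounds stored values, the eighth power of that
    bounds intermediate ones.\<close>
  have W: "(n + 2) ^ 56 = B ^ 8" by (simp add: B_def flip: power_mult)
  let ?Q = "\<lambda>\<sigma>. gamma12_set {..<n} E (set_output n \<sigma>)"
  let ?t = "(pop_time + elim_time + 4 * scan_time) * n + cost main_guard + 1 + final_time n"
  have main: "tri (B ^ 8) (Seq main_loop final) \<rho> ?t ?Q" if inv: "minv n E B {} \<rho>"
    and pot: "pot n \<rho> \<le> (pop_time + elim_time + 4 * scan_time) * n" for \<rho>
  proof (rule tri_Seq[OF tri_mono[OF main_loop_spec[OF inv big size(3)]]])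
    show "pot n \<rho> + cost main_guard + 1 \<le> (pop_time + elim_time + 4 * scan_time) * n + cost main_guard + 1"
      using pot by simp
    show "tri (B ^ 8) final \<sigma> (final_time n) ?Q" if "minv n E B {} \<sigma> \<and> live n \<sigma> = {}" for \<sigma>
      using that final_spec big size(3) by blast
  qed
  have load: "tri (B ^ 8) (Seq (While edge_guard edge_body) (Seq main_loop final)) \<rho> (edges_time (4 * n) + ?t) ?Q"
    if bd: "bounded_by B \<rho>" and sc: "scalar \<rho> 0 = n" "scalar \<rho> 1 = length es" "scalar \<rho> 2 = n + 2" "scalar \<rho> 8 = 0"
      "scalar \<rho> 3 = 0" "scalar \<rho> 10 = n" "scalar \<rho> 16 = 3"
    and q: "\<forall>j < n. cell \<rho> 16 j = j" and fr: "\<And>d. d \<noteq> 16 \<Longrightarrow> cell \<rho> d = cell \<sigma>1 d" for \<rho>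
  proof -
    have c: "cell \<rho> 3 = (\<lambda>_. 0)" "cell \<rho> 4 = (\<lambda>_. 0)" "cell \<rho> 12 = (\<lambda>_. 0)" "cell \<rho> 14 = (\<lambda>_. 0)"
      "cell \<rho> 2 = (\<lambda>_. 0)" "cell \<rho> 11 = (\<lambda>_. 0)" "cell \<rho> 15 = (\<lambda>_. 0)(n := 1)" "cell \<rho> 5 = (\<lambda>_. 0)(1 := n + 1)"
      by (simp_all add: fr s1 s0(2))
    have "cell \<rho> d = cell \<sigma>0 d" if "d \<notin> {5, 15, 16}" for d using that by (simp add: fr s1)
    then have inp: "\<forall>k < length es. cell \<rho> 0 k = fst (es ! k) \<and> cell \<rho> 1 k = snd (es ! k)"
      using s0(3) by auto
    show ?thesis
    proof (rule tri_Seq[OF tri_mono[OF edges_spec[OF bd big b(4) sc(2-4) inp c(1-4) es size(3)]]])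
      show "edges_time (length es) \<le> edges_time (4 * n)"
        using mult_le_mono2[OF size(1), of edge_time] by (simp add: edges_time_def)
      show "tri (B ^ 8) (Seq main_loop final) \<sigma> ?t ?Q" if "bounded_by B \<sigma> \<and> loaded n E \<rho> \<sigma>" for \<sigma>
        using minv_initial[OF conjunct1[OF that] conjunct2[OF that] sc(1,3,5-7) c(5-8) q gsp_reducible[OF gsp] size(3)] main
        by blast
    qed
  qed
  have reset: "tri (B ^ 8) (Seq (Assign 8 (Const 0)) (Seq (While edge_guard edge_body) (Seq main_loop final))) \<sigma>
      (stime (Assign 8 (Const 0)) + (edges_time (4 * n) + ?t)) ?Q"
    if q: "bounded_by B \<sigma> \<and> (\<forall>x. x \<noteq> 8 \<longrightarrow> scalar \<sigma> x = scalar \<sigma>1 x) \<and>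
      (\<forall>d. d \<noteq> 16 \<longrightarrow> cell \<sigma> d = cell \<sigma>1 d) \<and> (\<forall>j<n. cell \<sigma> 16 j = j)" for \<sigma>
  proof (rule tri_Seq)
    have bd: "bounded_by B \<sigma>" using q by simp
    show "tri (B ^ 8) (Assign 8 (Const 0)) \<sigma> (stime (Assign 8 (Const 0)))
        (\<lambda>\<rho>. bounded_by B \<rho> \<and> \<rho> = run (Assign 8 (Const 0)) \<sigma>)"
      using b(1) by (intro tri_run[OF bd]) (simp_all add: tame_def)
    show "tri (B ^ 8) (Seq (While edge_guard edge_body) (Seq main_loop final)) \<rho> (edges_time (4 * n) + ?t) ?Q"
      if "bounded_by B \<rho> \<and> \<rho> = run (Assign 8 (Const 0)) \<sigma>" for \<rho>
    proof (rule load)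
      show "bounded_by B \<rho>" using that by blast
    qed (use that q in \<open>simp_all add: s1(1) s0(1)\<close>)
  qed
  have head: "tri (B ^ 8) init_head \<sigma>0 (stime init_head) (\<lambda>\<sigma>. \<sigma> = \<sigma>1)"
    by (rule tri_run[OF bd0 b(1) _ _ sm]) (simp_all add: \<sigma>1_def init_head_def tame_def)
  have sc1: "scalar \<sigma>1 0 = n" "scalar \<sigma>1 8 = 0" by (simp_all add: s1 s0)
  show ?thesis unfolding min12set_def total_time_def \<sigma>0_def[symmetric] W
    using tri_Seq[OF queue_spec[OF bd1 b(1,3) sc1] reset] by (intro tri_Seq[OF head]) simp
qed

lemma total_time_linear: "(\<lambda>n. real (total_time n)) \<in> O(\<lambda>n. real n)"
proof -
  define a where "a = queue_time + 4 * edge_time + pop_time + elim_time + 4 * scan_time + 490 * mark_time"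
  define c where "c = total_time 0"
  \<comment> \<open>All phases are affine in \<open>n\<close>, so the constant part can be read off
    at 0. In \<open>a\<close>, the factor 4 before \<open>edge_time\<close> comes from the bound on
    the number of edges and 490 from the nodes per vertex.\<close>
  have "total_time n = a * n + c" for n
    by (simp add: total_time_def edges_time_def final_time_def a_def c_def algebra_simps)
  then have "real (total_time n) \<le> (a + c) * real n" if "1 \<le> n" for n
    using that mult_left_mono[of 1 "real n" "real c"] by (simp add: algebra_simps)
  then show ?thesis
    by (intro bigoI[of _ "real (a + c)"] eventually_sequentiallyI[of 1]) auto
qed

theorem theorem1:
  shows "\<exists>(c :: cmd) (k :: nat) (T :: nat \<Rightarrow> nat).
           computes_gamma12_set c k T \<and> (\<lambda>n. real (T n)) \<in> O(\<lambda>n. real n)"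
proof (intro exI conjI)
  show "computes_gamma12_set min12set 56 total_time"
    using min12set_spec unfolding computes_gamma12_set_def tri_def by blast
  show "(\<lambda>n. real (total_time n)) \<in> O(\<lambda>n. real n)" by (rule total_time_linear)
qed

end
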